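(* Let $(R_0,\mathfrak m)$ be an Artinian equicharacteristic local ring, $P\in\mathbb Q[X;\mathbb N]$ nonzero and $b\ge1$ an integer. Then: (i) If $P$ is $b$-admissible then $b\ge\deg(P)+1$ and $P$ admits a Gotzmann development. (ii) If $b\ge\deg(P)+2$ and $P$ admits a Gotzmann development then $P$ is $b$-admissible. (iii) $P$ is $(\deg(P)+1)$-admissible if and only if one of the following conditions holds: (a) $0<\gamma(P)<\lambda_{R_0}(R_0)$ and $\Gamma_P$ admits a Gotzmann development; (b) $\gamma(P)=\lambda_{R_0}(R_0)$ and $\Gamma_P=0$.
   Context: $\mathbb N$ includes $0$. $\mathbb Q[X;\mathbb N]=\{P\in\mathbb Q[X]\mid P(n)\in\mathbb N\text{ for }n\gg0\}$. A local ring is equicharacteristic if it has the same characteristic as its residue field; $\lambda_{R_0}$ denotes length. $P$ is $b$-admissible (over $R_0$) if there is a homogeneous ideal $I\subseteq R_+$, where $R=R_0[X_1,\dots,X_b]$ has the standard grading and $R_+=\bigoplus_{n\ge1}R_n$, such that $P$ is the Hilbert polynomial of $R/I$, i.e. $P(n)=\lambda_{R_0}(R_n/I_n)$ for all $n\gg0$. A polynomial $P\in\mathbb Q[X;\mathbb N]$ admits a Gotzmann development if either $P=0$ or there exist integers $c_1\ge\dots\ge c_s\ge0$ such that $P(n)=\binom{n+c_1}{c_1}+\binom{n+c_2-1}{c_2}+\dots+\binom{n+c_s-(s-1)}{c_s}$ for all $n\gg0$. Definition of $\gamma(P)$ and $\Gamma_P$: let $c=\deg P$ and for $n\ge0$ consider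 the Euclidean division $P(n)=\binom{n+c}{c}\gamma(n)+\Gamma(n)$, $0\le\Gamma(n)<\binom{n+c}{c}$. For $n\gg0$, $\gamma(n)$ is constant, and this constant value is denoted $\gamma(P)$; consequently $\Gamma(n)$ agrees for $n\gg0$ with a polynomial, denoted $\Gamma_P\in\mathbb Q[X;\mathbb N]$. Thus $P(X)=\gamma(P)\binom{X+c}{c}+\Gamma_P(X)$, and this is the Euclidean division of $P(n)$ by $\binom{n+c}{c}$ at $X=n$ for all $n\gg0$. *)

theory Defs
  imports
    "HOL-Algebra.Algebraic_Closure_Type"
    "HOL-Library.Poly_Mapping"
    "HOL-Library.Extended_Nat"
    "HOL-Computational_Algebra.Polynomial"
begin

section \<open>Rings and lengths of modules\<close>

definition ring_char :: "('a, 'm) ring_scheme \<Rightarrow> nat" where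
  "ring_char R =
     (if \<exists>n::nat. 0 < n \<and> add_pow R n \<one>\<^bsub>R\<^esub> = \<zero>\<^bsub>R\<^esub>
      then LEAST n. 0 < n \<and> add_pow R n \<one>\<^bsub>R\<^esub> = \<zero>\<^bsub>R\<^esub> else 0)"

definition artinian_ring :: "('a, 'm) ring_scheme \<Rightarrow> bool" where
  "artinian_ring R \<longleftrightarrow> cring R \<and>
     (\<forall>J :: nat \<Rightarrow> 'a set. (\<forall>n. ideal (J n) R) \<and> (\<forall>n. J (Suc n) \<subseteq> J n)
        \<longrightarrow> (\<exists>k. \<forall>n\<ge>k. J n = J k))"

definition local_ring :: "('a, 'm) ring_scheme \<Rightarrow> 'a set \<Rightarrow> bool" where
  "local_ring R \<mm> \<longleftrightarrow> cring R \<and> maximalideal \<mm> R \<and> (\<forall>J. maximalideal J R \<longrightarrow> J = \<mm>)"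

definition equicharacteristic :: "('a, 'm) ring_scheme \<Rightarrow> 'a set \<Rightarrow> bool" where
  "equicharacteristic R \<mm> \<longleftrightarrow> ring_char R = ring_char (R Quot \<mm>)"

definition self_module :: "('a, 'm) ring_scheme \<Rightarrow> ('a, 'a) module" where
  "self_module R =
     \<lparr>carrier = carrier R, monoid.mult = monoid.mult R, monoid.one = monoid.one R,
      ring.zero = ring.zero R, ring.add = ring.add R, module.smult = monoid.mult R\<rparr>"

text \<open>A module record extends a ring record; the ring multiplication and unit of a quotient
  module are irrelevant, and are left unspecified.\<close>

definition quotient_module ::
    "('a, 'b, 'n) module_scheme \<Rightarrow> 'b set \<Rightarrow> ('a, 'b set) module" where
  "quotient_module M N =
     \<lparr>carrier = a_rcosets\<^bsub>M\<^esub> N, monoid.mult = undefined, monoid.one = undefined,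
      ring.zero = N, ring.add = set_add M,
      module.smult = (\<lambda>a C. \<Union>x\<in>C. N +>\<^bsub>M\<^esub> (a \<odot>\<^bsub>M\<^esub> x))\<rparr>"

definition module_length :: "('a, 'm) ring_scheme \<Rightarrow> ('a, 'b, 'n) module_scheme \<Rightarrow> enat" where
  "module_length R M =
     Sup {enat k | k. \<exists>N :: nat \<Rightarrow> 'b set.
            (\<forall>i\<le>k. submodule (N i) R M) \<and> (\<forall>i<k. N i \<subset> N (Suc i))}"


section \<open>Graded polynomial rings\<close>

text \<open>Polynomials in variables indexed by the natural numbers, as finitely supported functions
  from exponent vectors to coefficients; the type class instances of Poly_Mapping make
  this type the polynomial ring. The ring in b variables only uses the variables below b.\<close>

type_synonym 'a mpoly = "(nat \<Rightarrow>\<^sub>0 nat) \<Rightarrow>\<^sub>0 'a"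

definition monom_degree :: "(nat \<Rightarrow>\<^sub>0 nat) \<Rightarrow> nat" where
  "monom_degree \<alpha> = (\<Sum>i\<in>Poly_Mapping.keys \<alpha>. Poly_Mapping.lookup \<alpha> i)"

definition mpoly_ring :: "nat \<Rightarrow> ('a::comm_ring_1, 'a mpoly) module" where
  "mpoly_ring b =
     \<lparr>carrier = {p. \<forall>\<alpha>\<in>Poly_Mapping.keys p. Poly_Mapping.keys \<alpha> \<subseteq> {..<b}},
      monoid.mult = (*), monoid.one = 1, ring.zero = 0, ring.add = (+),
      module.smult = (\<lambda>a p. Poly_Mapping.single 0 a * p)\<rparr>"

definition graded_part :: "nat \<Rightarrow> nat \<Rightarrow> 'a::comm_ring_1 mpoly set" where
  "graded_part b n =
     {p \<in> carrier (mpoly_ring b). \<forall>\<alpha>\<in>Poly_Mapping.keys p. monom_degree \<alpha> = n}"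

definition irrelevant_ideal :: "nat \<Rightarrow> 'a::comm_ring_1 mpoly set" where
  "irrelevant_ideal b =
     {p \<in> carrier (mpoly_ring b). \<forall>\<alpha>\<in>Poly_Mapping.keys p. 1 \<le> monom_degree \<alpha>}"

definition hom_component :: "nat \<Rightarrow> 'a::comm_ring_1 mpoly \<Rightarrow> 'a mpoly" where
  "hom_component n p =
     (\<Sum>\<alpha>\<in>{\<alpha> \<in> Poly_Mapping.keys p. monom_degree \<alpha> = n}.
        Poly_Mapping.single \<alpha> (Poly_Mapping.lookup p \<alpha>))"

definition homogeneous_ideal :: "nat \<Rightarrow> 'a::comm_ring_1 mpoly set \<Rightarrow> bool" where
  "homogeneous_ideal b I \<longleftrightarrow>
     ideal I (mpoly_ring b) \<and> (\<forall>p\<in>I. \<forall>n. hom_component n p \<in> I)"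

definition hilbert_function :: "nat \<Rightarrow> 'a::comm_ring_1 mpoly set \<Rightarrow> nat \<Rightarrow> enat" where
  "hilbert_function b I n =
     module_length (ring_of_type_algebra :: 'a ring)
       (quotient_module ((mpoly_ring b)\<lparr>carrier := graded_part b n\<rparr>) (I \<inter> graded_part b n))"

definition is_hilbert_poly :: "nat \<Rightarrow> 'a::comm_ring_1 mpoly set \<Rightarrow> rat poly \<Rightarrow> bool" where
  "is_hilbert_poly b I P \<longleftrightarrow>
     (\<forall>\<^sub>F n in sequentially. \<exists>k::nat. hilbert_function b I n = enat k \<and> poly P (of_nat n) = of_nat k)"

definition admissible :: "'a::comm_ring_1 itself \<Rightarrow> nat \<Rightarrow> rat poly \<Rightarrow> bool" where
  "admissible R0 b P \<longleftrightarrow>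
     (\<exists>I :: 'a mpoly set. homogeneous_ideal b I \<and> I \<subseteq> irrelevant_ideal b \<and> is_hilbert_poly b I P)"


section \<open>Numerical polynomials\<close>

definition nat_valued_polys :: "rat poly set" where
  "nat_valued_polys = {P. \<forall>\<^sub>F n in sequentially. poly P (of_nat n) \<in> \<nat>}"

text \<open>The subtraction below is truncated, but not for n at least s.\<close>

definition gotzmann_development :: "rat poly \<Rightarrow> bool" where
  "gotzmann_development P \<longleftrightarrow> P = 0 \<or>
     (\<exists>(s::nat) (c :: nat \<Rightarrow> nat). 1 \<le> s \<and> (\<forall>i j. 1 \<le> i \<and> i \<le> j \<and> j \<le> s \<longrightarrow> c j \<le> c i) \<and>
        (\<forall>\<^sub>F n in sequentially.
           poly P (of_nat n) = of_nat (\<Sum>i=1..s. (n + c i - (i - 1)) choose c i)))"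

text \<open>For P in \<^const>\<open>nat_valued_polys\<close> and n large, the dividend is exactly the value of P at n.\<close>

definition gamma_at :: "rat poly \<Rightarrow> nat \<Rightarrow> nat" where
  "gamma_at P n = nat \<lfloor>poly P (of_nat n)\<rfloor> div ((n + Polynomial.degree P) choose Polynomial.degree P)"

definition Gamma_at :: "rat poly \<Rightarrow> nat \<Rightarrow> nat" where
  "Gamma_at P n = nat \<lfloor>poly P (of_nat n)\<rfloor> mod ((n + Polynomial.degree P) choose Polynomial.degree P)"

definition gamma_of :: "rat poly \<Rightarrow> nat" where
  "gamma_of P = (THE g. \<forall>\<^sub>F n in sequentially. gamma_at P n = g)"

definition Gamma_of :: "rat poly \<Rightarrow> rat poly" where
  "Gamma_of P = (THE Q. \<forall>\<^sub>F n in sequentially. poly Q (of_nat n) = of_nat (Gamma_at P n))"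

end

theory Submission
  imports Defs
begin

text \<open>For a homogeneous ideal \<open>I\<close>, filter each graded piece by the monomials in a monomial order.
  The length of degree \<open>n\<close> of the quotient becomes the sum over the monomials \<open>\<alpha>\<close> of degree \<open>n\<close>
  of the colengths of the ideals of leading coefficients at \<open>\<alpha>\<close>. These ideals increase along
  divisibility, so slicing by colength turns the Hilbert function into a sum, over as many
  slices as the length of the base ring, of the counting functions of order ideals of monomials.

  The counting function of an order ideal \<open>D\<close> is shown to be eventually of Gotzmann form by
  well-founded induction (Dickson's lemma), splitting \<open>D\<close> along a variable \<open>x\<close> into the monomials
  free of \<open>x\<close> and the colon order ideal \<open>D : x\<close> shifted by one degree. The combinatorics of this
  step rests on Pascal's rule alone, which makes functions of Gotzmann form stable under sums.
  An order ideal missing some monomial grows with smaller degree than all monomials, so the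
  number of full slices is \<open>\<gamma>(P)\<close> and the others add up to \<open>\<Gamma>\<^sub>P\<close>. Conversely, lexicographic order
  ideals realise all Gotzmann developments, and two consecutive members of a composition series
  of the base ring, imposed on the coefficients off and on the order ideal, supply
  the summand \<open>\<gamma>(P)\<close>.\<close>

section \<open>Sums of Gotzmann type\<close>

text \<open>The obstacle is that two Gotzmann developments do not add up summand by summand, since
  each summand is delayed by its place. Pascal's rule fixes the price of a rearrangement: moving a
  summand of degree c one place further costs a summand of degree c - 1 at its old place. These
  debts have smaller degree, so they are paid off by induction, and this closes the developments
  under addition.

  The number of variables enters through one gap. In b variables the full order ideal grows with
  degree b - 1, a proper one with degree below b - 1. Hence for b \<ge> deg P + 2 all summands of P
  fit into a single lexicographic order ideal, which has a variable to spare, and one slice over the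
  residue field suffices. For b = deg P + 1 the summands of top degree come from full slices only.
  There are at most as many slices as the length of the base ring, and when all of them are full
  there is no room for a remainder: this is the dichotomy between (a) and (b).\<close>

definition gterm :: "nat \<Rightarrow> nat \<Rightarrow> nat \<Rightarrow> nat" where
  "gterm i c n = (n + c - i) choose c"

primrec gsum :: "nat \<Rightarrow> nat list \<Rightarrow> nat \<Rightarrow> nat" where
  "gsum k [] n = 0"
| "gsum k (c # cs) n = gterm k c n + gsum (Suc k) cs n"

text \<open>The offset \<open>k\<close> arises from removing \<open>k\<close> leading summands; Gotzmann developments are the
  case \<open>k = 0\<close>. All \<open>c\<close> are below \<open>m\<close>.\<close>

definition gotz :: "nat \<Rightarrow> nat \<Rightarrow> (nat \<Rightarrow> nat) \<Rightarrow> bool" where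
  "gotz m k f \<longleftrightarrow> (\<exists>cs. sorted_wrt (\<ge>) cs \<and> (\<forall>c\<in>set cs. c < m) \<and>
     (\<forall>\<^sub>F n in sequentially. f n = gsum k cs n))"

lemma gterm_0 [simp]: "gterm i 0 n = 1"
  by (simp add: gterm_def)

text \<open>The exchange rule in its exact form; \<open>i \<le> n\<close> guards against truncated
  subtraction.\<close>

lemma gterm_Suc_index:
  assumes "i \<le> n"
  shows "gterm i (Suc c) n = gterm (Suc i) (Suc c) n + gterm i c n"
proof -
  have "n + Suc c - i = Suc (n + c - i)" "n + Suc c - Suc i = n + c - i"
    using assms by auto
  then show ?thesis by (simp add: gterm_def)
qed

lemma gterm_telescope:
  assumes "j \<le> k" "k \<le> n"
  shows "gterm j (Suc c) n = gterm k (Suc c) n + (\<Sum>i=j..<k. gterm i c n)"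
  using assms
proof (induction k rule: dec_induct)
  case (step k)
  then show ?case using gterm_Suc_index[of k n c] by simp
qed simp

lemma gotzI:
  assumes "sorted_wrt (\<ge>) cs" "\<And>c. c \<in> set cs \<Longrightarrow> c < m"
    "\<forall>\<^sub>F n in sequentially. f n = gsum k cs n"
  shows "gotz m k f"
  using assms unfolding gotz_def by blast

lemma gotz_cong:
  assumes "gotz m k f" "\<forall>\<^sub>F n in sequentially. f n = g n"
  shows "gotz m k g"
proof -
  obtain cs where cs: "sorted_wrt (\<ge>) cs" "\<And>c. c \<in> set cs \<Longrightarrow> c < m"
    "\<forall>\<^sub>F n in sequentially. f n = gsum k cs n"
    using assms(1) unfolding gotz_def by blast
  show ?thesis
    by (rule gotzI[OF cs(1,2)], assumption)
      (use cs(3) assms(2) in \<open>eventually_elim; simp\<close>)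
qed

lemma gotz_mono: "gotz m k f \<Longrightarrow> m \<le> m' \<Longrightarrow> gotz m' k f"
  unfolding gotz_def by (meson order_less_le_trans)

lemma gotz_zero: "gotz m k (\<lambda>_. 0)"
  by (rule gotzI[of "[]"]) auto

lemma gotz_0_iff: "gotz 0 k f \<longleftrightarrow> (\<forall>\<^sub>F n in sequentially. f n = 0)"
proof
  assume "gotz 0 k f"
  then obtain cs where "\<forall>c\<in>set cs. c < (0::nat)" "\<forall>\<^sub>F n in sequentially. f n = gsum k cs n"
    unfolding gotz_def by blast
  moreover from this(1) have "cs = []" by (cases cs) auto
  ultimately show "\<forall>\<^sub>F n in sequentially. f n = 0" by simp
next
  assume "\<forall>\<^sub>F n in sequentially. f n = 0"
  then show "gotz 0 k f" by (intro gotzI[of "[]"]) auto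
qed

lemma gotz_Cons:
  assumes "gotz (Suc c) (Suc k) f"
  shows "gotz (Suc c) k (\<lambda>n. gterm k c n + f n)"
proof -
  obtain cs where cs: "sorted_wrt (\<ge>) cs" "\<And>d. d \<in> set cs \<Longrightarrow> d < Suc c"
    "\<forall>\<^sub>F n in sequentially. f n = gsum (Suc k) cs n"
    using assms unfolding gotz_def by blast
  show ?thesis
  proof (rule gotzI[of "c # cs"])
    show "sorted_wrt (\<ge>) (c # cs)" using cs(1,2) by (auto simp: less_Suc_eq_le)
    show "d < Suc c" if "d \<in> set (c # cs)" for d using that cs(2) by auto
    show "\<forall>\<^sub>F n in sequentially. gterm k c n + f n = gsum k (c # cs) n"
      using cs(3) by eventually_elim simp
  qed
qed

lemma gotz_gsum:
  assumes "sorted_wrt (\<ge>) cs" "\<And>c. c \<in> set cs \<Longrightarrow> c < m"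
  shows "gotz m k (gsum k cs)"
  by (rule gotzI[OF assms]) auto

text \<open>Summands of degree at least \<open>c\<close> stay in front, each raising the offset by
  one. Once all remaining entries are below \<open>c\<close>, the new summand takes the leading
  place \<open>k\<close>: telescoping brings it there from place \<open>j\<close>, the remaining
  entries move on by \<open>shift\<close>, and the debts of degree \<open>c - 1\<close> go in by
  \<open>ins\<close>.\<close>

lemma gotz_insert_step:
  assumes shift: "\<And>k f. gotz c k f \<Longrightarrow> gotz c (Suc k) f"
    and ins: "\<And>c' M k j f. c' < c \<Longrightarrow> c' < M \<Longrightarrow> j \<le> k \<Longrightarrow> gotz M k f \<Longrightarrow>
      gotz M k (\<lambda>n. f n + gterm j c' n)"
    and "sorted_wrt (\<ge>) cs" "\<And>d. d \<in> set cs \<Longrightarrow> d < M" "j \<le> k" "c < M"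
  shows "gotz M k (\<lambda>n. gsum k cs n + gterm j c n)"
proof -
  have low: "gotz M k (\<lambda>n. gsum k cs n + gterm j c n)"
    if srt: "sorted_wrt (\<ge>) cs" and cs: "\<And>d. d \<in> set cs \<Longrightarrow> d < c" and jk: "j \<le> k" and "c < M"
    for cs k M
  proof (cases c)
    \<comment> \<open>In degree 0 all places agree and nothing is left to move.\<close>
    case 0
    with cs have "cs = []" by (cases cs) auto
    with 0 \<open>c < M\<close> show ?thesis
      by (intro gotzI[of "[0]"]) auto
  next
    case (Suc c')
    have base: "gotz c (Suc k) (gsum k cs)"
      using shift gotz_gsum[OF srt cs] by blast
    have "gotz c (Suc k) (\<lambda>n. gsum k cs n + (\<Sum>i=j..<l. gterm i c' n))" if "j \<le> l" "l \<le> k" for l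
      using that
    proof (induction l rule: dec_induct)
      case base': base
      then show ?case using base by simp
    next
      case (step l)
      then have "gotz c (Suc k) (\<lambda>n. (gsum k cs n + (\<Sum>i=j..<l. gterm i c' n)) + gterm l c' n)"
        using ins[of c' c l "Suc k"] Suc by auto
      then show ?case using step by (simp add: add.assoc)
    qed
    from this[of k] jk have "gotz c (Suc k) (\<lambda>n. gsum k cs n + (\<Sum>i=j..<k. gterm i c' n))" by simp
    from gotz_Cons[OF gotz_mono[OF this]]
    have "gotz (Suc c) k (\<lambda>n. gterm k c n + (gsum k cs n + (\<Sum>i=j..<k. gterm i c' n)))" by simp
    then have "gotz (Suc c) k (\<lambda>n. gsum k cs n + gterm j c n)"
      by (rule gotz_cong)
        (use eventually_ge_at_top[of k] in eventually_elim, simp add: Suc gterm_telescope[OF jk])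
    then show ?thesis using \<open>c < M\<close> by (auto intro: gotz_mono)
  qed
  show ?thesis
    using assms(3-)
  proof (induction cs arbitrary: k M)
    case Nil
    then show ?case by (intro low) auto
  next
    case (Cons d ds)
    show ?case
    proof (cases "c \<le> d")
      case True
      have "gotz (Suc d) (Suc k) (\<lambda>n. gsum (Suc k) ds n + gterm j c n)"
        using Cons.prems True by (intro Cons.IH) (auto simp: less_Suc_eq_le)
      from gotz_Cons[OF this] have "gotz (Suc d) k (\<lambda>n. gsum k (d # ds) n + gterm j c n)"
        by (simp add: add.assoc)
      then show ?thesis by (rule gotz_mono) (use Cons.prems in \<open>simp add: Suc_leI\<close>)
    next
      case False
      then show ?thesis using Cons.prems by (intro low) (auto intro: le_less_trans)
    qed
  qed
qed

text \<open>The two claims need each other. Inserting degree \<open>c'\<close> uses shifting and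
  insertion below \<open>c'\<close>; shifting a list moves its head by Pascal's rule and inserts the
  debt, whose degree is one less.\<close>

lemma gotz_shift_insert:
  "(\<forall>k f. gotz c k f \<longrightarrow> gotz c (Suc k) f) \<and>
   (\<forall>c' M k j f. c' < c \<longrightarrow> c' < M \<longrightarrow> j \<le> k \<longrightarrow> gotz M k f \<longrightarrow>
      gotz M k (\<lambda>n. f n + gterm j c' n))"
proof (induction c rule: less_induct)
  case (less c)
  have ins: "gotz M k (\<lambda>n. f n + gterm j c' n)" if "c' < c" "c' < M" "j \<le> k" "gotz M k f" for c' M k j f
  proof -
    obtain cs where cs: "sorted_wrt (\<ge>) cs" "\<And>c. c \<in> set cs \<Longrightarrow> c < M"
      "\<forall>\<^sub>F n in sequentially. f n = gsum k cs n"
      using \<open>gotz M k f\<close> unfolding gotz_def by blast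
    have "gotz M k (\<lambda>n. gsum k cs n + gterm j c' n)"
      using less.IH[OF \<open>c' < c\<close>] cs(1,2) that by (intro gotz_insert_step) auto
    then show ?thesis
      by (rule gotz_cong) (use cs(3) in eventually_elim, simp)
  qed
  have "gotz c (Suc k) (gsum k cs)" if "sorted_wrt (\<ge>) cs" "\<And>d. d \<in> set cs \<Longrightarrow> d < c" for cs k
    using that
  proof (induction cs arbitrary: k)
    case Nil
    then show ?case using gotz_zero by (auto intro: gotz_cong)
  next
    case (Cons d ds)
    have d: "d < c" using Cons.prems by simp
    \<comment> \<open>If the head has the largest degree allowed, the tail falls under the induction
      on the list; otherwise the outer induction covers it.\<close>
    have tl: "gotz (Suc d) (Suc (Suc k)) (gsum (Suc k) ds)"
    proof (cases "Suc d = c")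
      case True
      then show ?thesis using Cons by auto
    next
      case False
      with d have "Suc d < c" by simp
      moreover have "gotz (Suc d) (Suc k) (gsum (Suc k) ds)"
        using Cons.prems by (intro gotz_gsum) (auto simp: less_Suc_eq_le)
      ultimately show ?thesis using less.IH[of "Suc d"] by blast
    qed
    note hd = gotz_Cons[OF tl]
    show ?case
    proof (cases d)
      case 0
      have "gotz c (Suc k) (\<lambda>n. gterm (Suc k) d n + gsum (Suc k) ds n)"
        using hd d by (auto intro: gotz_mono)
      then show ?thesis
        by (rule gotz_cong) (simp add: 0)
    next
      case (Suc e)
      have "gotz (Suc d) (Suc k) (\<lambda>n. (gterm (Suc k) d n + gsum (Suc k) ds n) + gterm k e n)"
        using hd d Suc by (intro ins) auto
      then have "gotz (Suc d) (Suc k) (gsum k (d # ds))"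
        by (rule gotz_cong)
          (use eventually_ge_at_top[of k] in eventually_elim, simp add: Suc gterm_Suc_index)
      then show ?thesis by (rule gotz_mono) (use d in simp)
    qed
  qed
  note shift_gsum = this
  have "gotz c (Suc k) f" if fc: "gotz c k f" for k f
  proof -
    obtain cs where cs: "sorted_wrt (\<ge>) cs" "\<And>d. d \<in> set cs \<Longrightarrow> d < c"
      "\<forall>\<^sub>F n in sequentially. f n = gsum k cs n"
      using fc unfolding gotz_def by blast
    show ?thesis
      by (rule gotz_cong[OF shift_gsum[OF cs(1,2)]])
        (assumption, use cs(3) in eventually_elim, simp)
  qed
  with ins show ?case by blast
qed

lemma gotz_shift: "gotz m k f \<Longrightarrow> gotz m (Suc k) f"
  using gotz_shift_insert by blast

lemma gotz_insert: "gotz M k f \<Longrightarrow> c < M \<Longrightarrow> j \<le> k \<Longrightarrow> gotz M k (\<lambda>n. f n + gterm j c n)"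
  using gotz_shift_insert[of "Suc c"] by blast

lemma gotz_insert_sum:
  assumes "gotz M k f" "c < M" "l \<le> Suc k"
  shows "gotz M k (\<lambda>n. f n + (\<Sum>i=j..<l. gterm i c n))"
  using assms
proof (induction l)
  case (Suc l)
  then show ?case
    using gotz_insert[of M k "\<lambda>n. f n + (\<Sum>i=j..<l. gterm i c n)" c l]
    by (cases "j \<le> l") (auto simp: add.assoc)
qed simp

text \<open>The entries of \<open>ds\<close> cannot be inserted one by one with
  \<open>gotz_insert\<close>, because their places run from \<open>j\<close> on and may exceed
  \<open>k\<close>. Putting the head \<open>d\<close> in front raises the offset to
  \<open>Suc k\<close>, which keeps the tail, now starting at \<open>Suc j\<close>, within
  range.\<close>

lemma gotz_add_gsum:
  assumes "sorted_wrt (\<ge>) ds" "\<And>d. d \<in> set ds \<Longrightarrow> d < M" "j \<le> k"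
    "sorted_wrt (\<ge>) cs" "\<And>d. d \<in> set cs \<Longrightarrow> d < M"
  shows "gotz M k (\<lambda>n. gsum k cs n + gsum j ds n)"
  using assms
proof (induction ds arbitrary: k M j cs)
  case Nil
  then show ?case using gotz_gsum[of cs M k] by simp
next
  case (Cons d ds)
  have IH: "gotz M k (\<lambda>n. f n + gsum j ds n)" if fM: "gotz M k f" "\<And>d. d \<in> set ds \<Longrightarrow> d < M" "j \<le> k" for k M j f
  proof -
    obtain cs where cs: "sorted_wrt (\<ge>) cs" "\<And>d. d \<in> set cs \<Longrightarrow> d < M"
      "\<forall>\<^sub>F n in sequentially. f n = gsum k cs n"
      using fM(1) unfolding gotz_def by blast
    have "gotz M k (\<lambda>n. gsum k cs n + gsum j ds n)"
      using that cs Cons.prems(1) by (intro Cons.IH) auto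
    then show ?thesis by (rule gotz_cong) (use cs(3) in eventually_elim, simp)
  qed
  \<comment> \<open>All of \<open>cs\<close> is below \<open>d\<close>: the shifted
    \<open>cs\<close>, the debts of \<open>d\<close> and the tail \<open>ds\<close> are collected at
    offset \<open>Suc k\<close>, and then \<open>d\<close> goes in front.\<close>
  have low: "gotz M k (\<lambda>n. gsum k cs n + gsum j (d # ds) n)"
    if cs: "sorted_wrt (\<ge>) cs" "\<And>e. e \<in> set cs \<Longrightarrow> e < d" and jk: "j \<le> k" and dM: "d < M" for k M cs
  proof -
    have base: "gotz d (Suc k) (gsum k cs)" using cs by (intro gotz_shift gotz_gsum)
    have dsd: "\<And>e. e \<in> set ds \<Longrightarrow> e < Suc d" using Cons.prems(1) by (auto simp: less_Suc_eq_le)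
    have "gotz (Suc d) k (\<lambda>n. gsum k cs n + gsum j (d # ds) n)"
    proof (cases d)
      case 0
      have "gotz (Suc d) (Suc k) (\<lambda>n. gsum k cs n + gsum (Suc j) ds n)"
        using base dsd jk by (intro IH) (auto intro: gotz_mono)
      from gotz_Cons[OF this] show ?thesis by (rule gotz_cong) (simp add: 0)
    next
      case (Suc e)
      have "gotz d (Suc k) (\<lambda>n. gsum k cs n + (\<Sum>i=j..<k. gterm i e n))"
        using base Suc by (intro gotz_insert_sum) auto
      then have "gotz (Suc d) (Suc k)
        (\<lambda>n. (gsum k cs n + (\<Sum>i=j..<k. gterm i e n)) + gsum (Suc j) ds n)"
        using dsd jk by (intro IH) (auto intro: gotz_mono)
      from gotz_Cons[OF this] show ?thesis
        by (rule gotz_cong)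
          (use eventually_ge_at_top[of k] in eventually_elim, simp add: Suc gterm_telescope[OF jk])
    qed
    then show ?thesis using dM by (auto intro: gotz_mono)
  qed
  show ?case
    using Cons.prems(3-)
      Cons.prems(2)[of d]
  proof (induction cs arbitrary: k M)
    case Nil
    then show ?case by (intro low) auto
  next
    case (Cons c cs)
    show ?case
    proof (cases "d \<le> c")
      case True
      have "gotz (Suc c) (Suc k) (\<lambda>n. gsum (Suc k) cs n + gsum j (d # ds) n)"
        using Cons.prems True by (intro Cons.IH) (auto simp: less_Suc_eq_le)
      from gotz_Cons[OF this] have "gotz (Suc c) k (\<lambda>n. gsum k (c # cs) n + gsum j (d # ds) n)"
        by (simp add: add.assoc)
      then show ?thesis by (rule gotz_mono) (use Cons.prems in \<open>simp add: Suc_leI\<close>)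
    next
      case False
      then show ?thesis using Cons.prems by (intro low) (auto intro: le_less_trans)
    qed
  qed
qed

lemma gotz_add:
  assumes "gotz M k f" "gotz M k g"
  shows "gotz M k (\<lambda>n. f n + g n)"
proof -
  obtain cs where cs: "sorted_wrt (\<ge>) cs" "\<And>d. d \<in> set cs \<Longrightarrow> d < M"
    "\<forall>\<^sub>F n in sequentially. f n = gsum k cs n"
    using assms(1) unfolding gotz_def by blast
  obtain ds where ds: "sorted_wrt (\<ge>) ds" "\<And>d. d \<in> set ds \<Longrightarrow> d < M"
    "\<forall>\<^sub>F n in sequentially. g n = gsum k ds n"
    using assms(2) unfolding gotz_def by blast
  have "gotz M k (\<lambda>n. gsum k cs n + gsum k ds n)"
    using cs(1,2) ds(1,2) by (intro gotz_add_gsum) auto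
  then show ?thesis by (rule gotz_cong) (use cs(3) ds(3) in eventually_elim, simp)
qed

lemma gotz_sum:
  assumes "finite A" "\<And>x. x \<in> A \<Longrightarrow> gotz M k (f x)"
  shows "gotz M k (\<lambda>n. \<Sum>x\<in>A. f x n)"
  using assms by (induction A rule: finite_induct) (auto intro: gotz_zero gotz_add)


section \<open>Monotonicity of the summands and their polynomial form\<close>

lemma gterm_antimono: "gterm (Suc i) c n \<le> gterm i c n"
  unfolding gterm_def by (rule binomial_right_mono) simp

lemma gterm_pos: "i \<le> n \<Longrightarrow> 0 < gterm i c n"
  unfolding gterm_def by (simp add: zero_less_binomial_iff)

lemma gsum_antimono: "gsum (Suc i) cs n \<le> gsum i cs n"
  by (induction cs arbitrary: i) (auto intro: add_mono gterm_antimono)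

text \<open>Delay and offset are the same thing: one degree earlier means one place further. This is
  how multiplication by a variable, which raises the degree by one, is matched with places in a
  development.\<close>

lemma gsum_pred: "1 \<le> n \<Longrightarrow> gsum i cs (n - 1) = gsum (Suc i) cs n"
  by (induction cs arbitrary: i) (simp_all add: gterm_def)

lemma gsum_zeros: "(\<And>c. c \<in> set cs \<Longrightarrow> c = 0) \<Longrightarrow> gsum i cs n = length cs"
proof (induction cs arbitrary: i)
  case (Cons c cs)
  then have "c = 0" by simp
  with Cons show ?case by simp
qed simp

lemma gterm_rec:
  assumes "i \<le> n"
  shows "Suc c * gterm i (Suc c) n = (n + Suc c - i) * gterm i c n"
proof -
  have "n + Suc c - i = Suc (n + c - i)" using assms by auto
  then show ?thesis unfolding gterm_def by (simp only: Suc_times_binomial)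
qed

text \<open>The absorption identity \<open>gterm_rec\<close> read as a recursion, from which degree
  \<open>c\<close> and leading coefficient \<open>1 / fact c\<close> can be read off.\<close>

primrec gterm_poly :: "nat \<Rightarrow> nat \<Rightarrow> rat poly" where
  "gterm_poly i 0 = 1"
| "gterm_poly i (Suc c) =
     smult (1 / of_nat (Suc c)) ([:of_nat (Suc c) - of_nat i, 1:] * gterm_poly i c)"

lemma poly_gterm_poly: "i \<le> n \<Longrightarrow> poly (gterm_poly i c) (of_nat n) = of_nat (gterm i c n)"
proof (induction c)
  case (Suc c)
  have "of_nat (Suc c) * of_nat (gterm i (Suc c) n) =
      (of_nat (n + Suc c - i) * of_nat (gterm i c n) :: rat)"
    using gterm_rec[OF Suc.prems, of c] by (metis of_nat_mult)
  also have "of_nat (n + Suc c - i) = (of_nat (Suc c) - of_nat i + of_nat n :: rat)"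
    using Suc.prems by (simp add: of_nat_diff)
  finally show ?case using Suc by (simp add: field_simps)
qed simp

lemma gterm_poly_lead:
  "Polynomial.degree (gterm_poly i c) = c \<and> Polynomial.lead_coeff (gterm_poly i c) = 1 / fact c"
proof (induction c)
  case (Suc c)
  have nz: "gterm_poly i c \<noteq> 0" using Suc by auto
  have "Polynomial.degree (gterm_poly i (Suc c)) = Suc c"
    using nz Suc by (simp add: degree_mult_eq del: mult_pCons_left)
  moreover have "Polynomial.lead_coeff (gterm_poly i (Suc c)) = 1 / fact (Suc c)"
    using conjunct2[OF Suc] unfolding gterm_poly.simps lead_coeff_smult lead_coeff_mult
    by (simp del: of_nat_Suc)
  ultimately show ?case by simp
qed simp

primrec gsum_poly :: "nat \<Rightarrow> nat list \<Rightarrow> rat poly" where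
  "gsum_poly i [] = 0"
| "gsum_poly i (c # cs) = gterm_poly i c + gsum_poly (Suc i) cs"

lemma poly_gsum_poly:
  "i + length cs \<le> n \<Longrightarrow> poly (gsum_poly i cs) (of_nat n) = of_nat (gsum i cs n)"
  by (induction cs arbitrary: i) (auto simp: poly_gterm_poly)

lemma eventually_poly_gsum_poly:
  "\<forall>\<^sub>F n in sequentially. poly (gsum_poly i cs) (of_nat n) = of_nat (gsum i cs n)"
  using eventually_ge_at_top[of "i + length cs"] by eventually_elim (rule poly_gsum_poly)

lemma degree_gsum_poly:
  "(\<And>c. c \<in> set cs \<Longrightarrow> c \<le> d) \<Longrightarrow> Polynomial.degree (gsum_poly i cs) \<le> d"
  by (induction cs arbitrary: i) (auto intro!: degree_add_le simp: gterm_poly_lead)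

section \<open>Eventual signs of polynomials\<close>

text \<open>A bound away from 0, instead of mere positivity, is what the induction needs: in
  \<open>a + x * p x\<close> the product is seen to outgrow the constant \<open>a\<close> because
  \<open>p x\<close> stays above a fixed \<open>e\<close>.\<close>

lemma poly_eventually_ge:
  fixes p :: "rat poly"
  assumes "0 < Polynomial.lead_coeff p"
  shows "\<exists>e>0. \<forall>\<^sub>F n in sequentially. e \<le> poly p (of_nat n)"
  using assms
proof (induction p)
  case (pCons a p)
  show ?case
  proof (cases "p = 0")
    case True
    then show ?thesis using pCons.prems by (intro exI[of _ a]) auto
  next
    case False
    then obtain e where e: "e > 0" "\<forall>\<^sub>F n in sequentially. e \<le> poly p (of_nat n)"
      using pCons by auto
    obtain N :: nat where N: "(1 - a) / e \<le> of_nat N" using real_arch_simple by blast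
    have "\<forall>\<^sub>F n in sequentially. 1 \<le> poly (pCons a p) (of_nat n)"
      using e(2) eventually_ge_at_top[of N]
    proof eventually_elim
      case (elim n)
      have "1 - a \<le> of_nat N * e" using N e(1) by (simp add: field_simps)
      also have "\<dots> \<le> of_nat n * poly p (of_nat n)" using elim e(1) by (intro mult_mono) auto
      finally show ?case by simp
    qed
    then show ?thesis by (intro exI[of _ 1]) auto
  qed
qed simp

lemma poly_eventually_pos:
  fixes p :: "rat poly"
  assumes "0 < Polynomial.lead_coeff p"
  shows "\<forall>\<^sub>F n in sequentially. 0 < poly p (of_nat n)"
proof -
  obtain e where "e > 0" "\<forall>\<^sub>F n in sequentially. e \<le> poly p (of_nat n)"
    using poly_eventually_ge[OF assms] by blast
  then show ?thesis by (auto elim: eventually_mono)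
qed

lemma degree_le_of_eventually_le:
  fixes p q :: "rat poly"
  assumes "0 < Polynomial.lead_coeff p"
    and "\<forall>\<^sub>F n in sequentially. poly p (of_nat n) \<le> poly q (of_nat n)"
  shows "Polynomial.degree p \<le> Polynomial.degree q"
proof (rule ccontr)
  assume "\<not> ?thesis"
  then have lt: "Polynomial.degree q < Polynomial.degree p" by simp
  then have "Polynomial.degree (p - q) = Polynomial.degree p"
    using degree_add_eq_left[of "- q" p] by simp
  with lt have "Polynomial.lead_coeff (p - q) = Polynomial.lead_coeff p"
    by (simp add: coeff_eq_0)
  with assms(1) have "\<forall>\<^sub>F n in sequentially. 0 < poly (p - q) (of_nat n)"
    by (intro poly_eventually_pos) simp
  with assms(2) have "\<forall>\<^sub>F n::nat in sequentially. False" by eventually_elim simp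
  then show False by simp
qed

lemma poly_eventually_sign:
  fixes p :: "rat poly"
  shows "(\<forall>\<^sub>F n in sequentially. 0 \<le> poly p (of_nat n)) \<or>
    (\<forall>\<^sub>F n in sequentially. poly p (of_nat n) < 0)"
proof -
  consider "p = 0" | "0 < Polynomial.lead_coeff p" | "0 < Polynomial.lead_coeff (- p)"
    by (cases "Polynomial.lead_coeff p" "0 :: rat" rule: linorder_cases) auto
  then show ?thesis
  proof cases
    case 2
    from poly_eventually_pos[OF this] show ?thesis by (auto elim: eventually_mono)
  next
    case 3
    from poly_eventually_pos[OF this] show ?thesis by simp
  qed simp
qed

lemma poly_eq_of_eventually_eq:
  fixes p q :: "rat poly"
  assumes "\<forall>\<^sub>F n in sequentially. poly p (of_nat n) = poly q (of_nat n)"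
  shows "p = q"
proof -
  have False if "0 < Polynomial.lead_coeff (p - q) \<or> 0 < Polynomial.lead_coeff (q - p)"
    using that
  proof
    assume "0 < Polynomial.lead_coeff (p - q)"
    from poly_eventually_pos[OF this] assms have "\<forall>\<^sub>F n::nat in sequentially. False"
      by eventually_elim simp
    then show False by simp
  next
    assume "0 < Polynomial.lead_coeff (q - p)"
    from poly_eventually_pos[OF this] assms have "\<forall>\<^sub>F n::nat in sequentially. False"
      by eventually_elim simp
    then show False by simp
  qed
  moreover have "Polynomial.lead_coeff (q - p) = - Polynomial.lead_coeff (p - q)"
    using degree_minus[of "p - q"] coeff_minus[of "p - q"] by simp
  ultimately have "Polynomial.lead_coeff (p - q) = 0"
    by (cases "Polynomial.lead_coeff (p - q)" "0 :: rat" rule: linorder_cases) auto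
  then have "p - q = 0" by (simp only: leading_coeff_0_iff)
  then show "p = q" by simp
qed

section \<open>Gotzmann sums with one part delayed by a degree\<close>

lemma gterm_le_gsum:
  assumes "\<forall>\<^sub>F n in sequentially. gterm j d n \<le> gsum i cs n" "sorted_wrt (\<ge>) cs"
  shows "\<exists>c cs'. cs = c # cs' \<and> d \<le> c"
proof (cases cs)
  case Nil
  have "\<forall>\<^sub>F n::nat in sequentially. False"
    using assms(1) eventually_ge_at_top[of j]
  proof eventually_elim
    case (elim n)
    then show ?case using gterm_pos[of j n d] Nil by simp
  qed
  then show ?thesis by simp
next
  case (Cons c cs')
  have "\<forall>\<^sub>F n in sequentially. poly (gterm_poly j d) (of_nat n) \<le> poly (gsum_poly i cs) (of_nat n)"
    using assms(1) eventually_ge_at_top[of j] eventually_poly_gsum_poly[of i cs]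
    by eventually_elim (simp add: poly_gterm_poly)
  moreover have "0 < Polynomial.lead_coeff (gterm_poly j d)"
    using conjunct2[OF gterm_poly_lead[of j d]] by (simp only:) simp
  ultimately have "d \<le> Polynomial.degree (gsum_poly i cs)"
    using degree_le_of_eventually_le[of "gterm_poly j d" "gsum_poly i cs"] gterm_poly_lead[of j d] by simp
  also have "\<dots> \<le> c" using assms(2) Cons by (intro degree_gsum_poly) auto
  finally show ?thesis using Cons by simp
qed

text \<open>This replaces the numerical form of Macaulay's bound. If the leading term of \<open>ds\<close>
  exceeds that of \<open>cs\<close>, the hypothesis forces it to exceed it by exactly one, and
  shifting it back by one consumes the leading term of \<open>cs\<close>.\<close>

lemma gotz_colon_gsum:
  assumes "sorted_wrt (\<ge>) cs" "\<And>c. c \<in> set cs \<Longrightarrow> c < M"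
    "sorted_wrt (\<ge>) ds" "\<And>d. d \<in> set ds \<Longrightarrow> d < M"
    "\<forall>\<^sub>F n in sequentially. gsum k ds n \<le> gsum k cs n + gsum (Suc k) ds n"
  shows "gotz M k (\<lambda>n. gsum k cs n + gsum (Suc k) ds n)"
  using assms
proof (induction ds arbitrary: k cs M)
  case Nil
  then show ?case using gotz_gsum[of cs M k] by simp
next
  case (Cons d ds)
  have srt: "\<And>e. e \<in> set ds \<Longrightarrow> e \<le> d" "sorted_wrt (\<ge>) ds" using Cons.prems(3) by auto
  consider c cs' where "cs = c # cs'" "d \<le> c" | "\<And>c. c \<in> set cs \<Longrightarrow> c < d"
  proof (cases cs)
    case (Cons c cs')
    then show ?thesis using that(1) that(2) Cons.prems(1) by (cases "d \<le> c") fastforce+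
  qed (use that in auto)
  then show ?case
  proof cases
    case (1 c cs')
    \<comment> \<open>\<open>c\<close> leads, and both remainders now start at offset
      \<open>Suc k\<close>, so they add.\<close>
    have "gotz (Suc c) (Suc k) (\<lambda>n. gsum (Suc k) cs' n + gsum (Suc k) (d # ds) n)"
      using 1 Cons.prems by (intro gotz_add gotz_gsum) (auto simp: less_Suc_eq_le)
    from gotz_Cons[OF this] have "gotz (Suc c) k (\<lambda>n. gsum k cs n + gsum (Suc k) (d # ds) n)"
      using 1 by (simp add: add.assoc)
    then show ?thesis by (rule gotz_mono) (use Cons.prems(2) 1 in \<open>simp add: Suc_leI\<close>)
  next
    case 2
    show ?thesis
    proof (cases d)
      case 0
      with 2 have "cs = []" by (cases cs) auto
      moreover have "gsum (Suc k) (d # ds) n = gsum k (d # ds) n" for n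
        using srt(1) 0 by (subst (1 2) gsum_zeros) auto
      ultimately show ?thesis
        using gotz_gsum[OF Cons.prems(3,4), of k] by (auto intro: gotz_cong)
    next
      case (Suc e)
      \<comment> \<open>Pascal's rule cancels \<open>gterm (Suc k) d\<close> on both sides and
        leaves a summand of degree \<open>e\<close> on the left; the tails of \<open>ds\<close>
        compare in the right direction.\<close>
      have "\<forall>\<^sub>F n in sequentially. gterm k e n \<le> gsum k cs n"
        using Cons.prems(5) eventually_ge_at_top[of k]
      proof eventually_elim
        case (elim n)
        then show ?case
          using gterm_Suc_index[of k n e] gsum_antimono[of "Suc k" ds n] Suc by simp
      qed
      then obtain c cs' where "cs = c # cs'" "e \<le> c"
        using gterm_le_gsum Cons.prems(1) by blast
      with 2[of c] Suc have cs: "cs = e # cs'" by simp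
      \<comment> \<open>The leading entries \<open>e\<close> and \<open>d\<close> merge by Pascal's
        rule into \<open>d\<close> at place \<open>k\<close>. Cancelling the common
        \<open>gterm k e\<close> leaves the same hypothesis for the tails.\<close>
      have "gotz (Suc d) (Suc k) (\<lambda>n. gsum (Suc k) cs' n + gsum (Suc (Suc k)) ds n)"
      proof (rule Cons.IH)
        show "\<forall>\<^sub>F n in sequentially. gsum (Suc k) ds n \<le> gsum (Suc k) cs' n + gsum (Suc (Suc k)) ds n"
          using Cons.prems(5) eventually_ge_at_top[of k]
        proof eventually_elim
          case (elim n)
          then show ?case using gterm_Suc_index[of k n e] Suc cs by simp
        qed
      qed (use Cons.prems cs srt Suc in \<open>auto simp: less_Suc_eq_le intro: le_SucI\<close>)
      from gotz_Cons[OF this]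
      have "gotz (Suc d) k (\<lambda>n. gsum k cs n + gsum (Suc k) (d # ds) n)"
        by (rule gotz_cong)
          (use eventually_ge_at_top[of k] in eventually_elim, simp add: Suc cs gterm_Suc_index)
      then show ?thesis by (rule gotz_mono) (use Cons.prems(4) in \<open>simp add: Suc_leI\<close>)
    qed
  qed
qed

text \<open>In the application \<open>f\<close> counts the monomials of \<open>D\<close> free of
  \<open>x\<close> and \<open>g\<close> those of the colon, so that the sum counts \<open>D\<close>.
  The last hypothesis then expresses that the colon is contained in \<open>D\<close>.\<close>

lemma gotz_colon:
  assumes "gotz M 0 f" "gotz M 0 g" "\<forall>\<^sub>F n in sequentially. g n \<le> f n + g (n - 1)"
  shows "gotz M 0 (\<lambda>n. f n + g (n - 1))"
proof -
  obtain cs where cs: "sorted_wrt (\<ge>) cs" "\<And>d. d \<in> set cs \<Longrightarrow> d < M"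
    "\<forall>\<^sub>F n in sequentially. f n = gsum 0 cs n"
    using assms(1) unfolding gotz_def by blast
  obtain ds where ds: "sorted_wrt (\<ge>) ds" "\<And>d. d \<in> set ds \<Longrightarrow> d < M"
    "\<forall>\<^sub>F n in sequentially. g n = gsum 0 ds n"
    using assms(2) unfolding gotz_def by blast
  have g': "\<forall>\<^sub>F n in sequentially. g (n - 1) = gsum (Suc 0) ds n"
  proof -
    obtain N where N: "\<And>n. n \<ge> N \<Longrightarrow> g n = gsum 0 ds n"
      using ds(3) unfolding eventually_sequentially by blast
    show ?thesis
      using eventually_ge_at_top[of "Suc N"]
    proof eventually_elim
      case (elim n)
      then show ?case using N[of "n - 1"] gsum_pred[of n 0 ds] by simp
    qed
  qed
  have "gotz M 0 (\<lambda>n. gsum 0 cs n + gsum (Suc 0) ds n)"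
  proof (rule gotz_colon_gsum[OF cs(1,2) ds(1,2)])
    show "\<forall>\<^sub>F n in sequentially. gsum 0 ds n \<le> gsum 0 cs n + gsum (Suc 0) ds n"
      using assms(3) cs(3) ds(3) g' by eventually_elim simp
  qed
  then show ?thesis by (rule gotz_cong) (use cs(3) g' in eventually_elim, simp)
qed

lemma gterm_zero_mono:
  assumes "d \<le> c"
  shows "gterm 0 d n \<le> gterm 0 c n"
proof -
  have "(n + d) choose n \<le> (n + c) choose n" using assms by (intro binomial_right_mono) simp
  then show ?thesis
    unfolding gterm_def using binomial_symmetric[of n "n + d"] binomial_symmetric[of n "n + c"] by simp
qed

text \<open>A leading summand of degree at least \<open>d\<close> sits at place 0 and would already
  reach the bound.\<close>

lemma gotz_lower:
  assumes "gotz M 0 f" "\<forall>\<^sub>F n in sequentially. f n < gterm 0 d n"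
  shows "gotz d 0 f"
proof -
  obtain cs where cs: "sorted_wrt (\<ge>) cs" "\<forall>\<^sub>F n in sequentially. f n = gsum 0 cs n"
    using assms(1) unfolding gotz_def by blast
  have "c < d" if c: "c \<in> set cs" for c
  proof (rule ccontr)
    assume "\<not> c < d"
    then obtain c' cs' where cs': "cs = c' # cs'" "d \<le> c'"
      using cs(1) c by (cases cs) (auto intro: order_trans)
    have "\<forall>\<^sub>F n::nat in sequentially. False"
      using assms(2) cs(2)
    proof eventually_elim
      case (elim n)
      then show ?case using gterm_zero_mono[OF cs'(2), of n] cs'(1) by simp
    qed
    then show False by simp
  qed
  with cs show ?thesis by (intro gotzI)
qed

section \<open>Monomials\<close>

definition monoms :: "nat set \<Rightarrow> (nat \<Rightarrow>\<^sub>0 nat) set" where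
  "monoms V = {\<alpha>. Poly_Mapping.keys \<alpha> \<subseteq> V}"

text \<open>Exponent vectors add, so divisibility is the existence of a cofactor \<beta>. The
  complement within \<open>monoms V\<close> is the set of monomials of a monomial ideal.\<close>

definition downset :: "nat set \<Rightarrow> (nat \<Rightarrow>\<^sub>0 nat) set \<Rightarrow> bool" where
  "downset V D \<longleftrightarrow> D \<subseteq> monoms V \<and> (\<forall>\<alpha> \<beta>. \<alpha> + \<beta> \<in> D \<longrightarrow> \<alpha> \<in> D)"

definition count_deg :: "(nat \<Rightarrow>\<^sub>0 nat) set \<Rightarrow> nat \<Rightarrow> nat" where
  "count_deg D n = card {\<alpha> \<in> D. monom_degree \<alpha> = n}"

abbreviation indet :: "nat \<Rightarrow> (nat \<Rightarrow>\<^sub>0 nat)" where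
  "indet x \<equiv> Poly_Mapping.single x (Suc 0)"

lemma keys_add_nat: "Poly_Mapping.keys (\<alpha> + \<beta>) = Poly_Mapping.keys \<alpha> \<union> Poly_Mapping.keys (\<beta> :: nat \<Rightarrow>\<^sub>0 nat)"
  by (auto simp: in_keys_iff lookup_add)

lemma monom_degree_eq:
  assumes "finite V" "Poly_Mapping.keys \<alpha> \<subseteq> V"
  shows "monom_degree \<alpha> = (\<Sum>i\<in>V. Poly_Mapping.lookup \<alpha> i)"
  unfolding monom_degree_def using assms by (intro sum.mono_neutral_left) (auto simp: in_keys_iff)

lemma monom_degree_add: "monom_degree (\<alpha> + \<beta>) = monom_degree \<alpha> + monom_degree \<beta>"
proof -
  let ?V = "Poly_Mapping.keys \<alpha> \<union> Poly_Mapping.keys \<beta>"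
  show ?thesis
    using monom_degree_eq[of ?V \<alpha>] monom_degree_eq[of ?V \<beta>] monom_degree_eq[of ?V "\<alpha> + \<beta>"]
    by (simp add: keys_add_nat lookup_add sum.distrib)
qed

lemma monom_degree_0 [simp]: "monom_degree 0 = 0"
  by (simp add: monom_degree_def)

lemma monom_degree_indet [simp]: "monom_degree (indet x) = 1"
  by (simp add: monom_degree_def)

lemma monom_degree_eq_0_iff: "monom_degree \<alpha> = 0 \<longleftrightarrow> \<alpha> = 0"
proof
  assume "monom_degree \<alpha> = 0"
  then have "\<forall>i\<in>Poly_Mapping.keys \<alpha>. Poly_Mapping.lookup \<alpha> i = 0"
    unfolding monom_degree_def by (subst (asm) sum_eq_0_iff) auto
  then have "Poly_Mapping.keys \<alpha> = {}" by (meson all_not_in_conv in_keys_iff)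
  then show "\<alpha> = 0" by simp
qed simp

lemma monom_split:
  assumes "x \<in> Poly_Mapping.keys \<alpha>"
  shows "\<exists>\<beta>. \<alpha> = \<beta> + indet x"
proof
  show "\<alpha> = (\<alpha> - indet x) + indet x"
    using assms by (intro poly_mapping_eqI) (auto simp: lookup_add lookup_minus lookup_single in_keys_iff when_def)
qed

lemma monoms_add_iff [simp]: "\<alpha> + \<beta> \<in> monoms V \<longleftrightarrow> \<alpha> \<in> monoms V \<and> \<beta> \<in> monoms V"
  by (auto simp: monoms_def keys_add_nat)

lemma indet_in_monoms [simp]: "indet x \<in> monoms V \<longleftrightarrow> x \<in> V"
  by (auto simp: monoms_def)

lemma zero_in_monoms [simp]: "0 \<in> monoms V"
  by (auto simp: monoms_def)

lemma finite_monoms_deg: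
  assumes "finite V"
  shows "finite {\<alpha> \<in> monoms V. monom_degree \<alpha> = n}"
proof (induction n)
  case 0
  have "{\<alpha> \<in> monoms V. monom_degree \<alpha> = 0} \<subseteq> {0}" by (auto simp: monom_degree_eq_0_iff)
  then show ?case using finite_subset by blast
next
  case (Suc n)
  have "{\<alpha> \<in> monoms V. monom_degree \<alpha> = Suc n} \<subseteq>
    (\<Union>x\<in>V. (\<lambda>\<beta>. \<beta> + indet x) ` {\<alpha> \<in> monoms V. monom_degree \<alpha> = n})"
  proof
    fix \<alpha> assume \<alpha>: "\<alpha> \<in> {\<alpha> \<in> monoms V. monom_degree \<alpha> = Suc n}"
    then have "\<alpha> \<noteq> 0" by auto
    then obtain x where x: "x \<in> Poly_Mapping.keys \<alpha>" by (metis keys_eq_empty all_not_in_conv)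
    then obtain \<beta> where \<beta>: "\<alpha> = \<beta> + indet x" using monom_split by blast
    have "monom_degree \<beta> = n" using \<alpha> by (simp add: \<beta> monom_degree_add)
    moreover have "\<beta> \<in> monoms V" "x \<in> V" using \<alpha> by (auto simp: \<beta>)
    ultimately show "\<alpha> \<in> (\<Union>x\<in>V. (\<lambda>\<beta>. \<beta> + indet x) ` {\<alpha> \<in> monoms V. monom_degree \<alpha> = n})"
      using \<beta> by blast
  qed
  then show ?case using Suc assms by (meson finite_UN_I finite_imageI finite_subset)
qed

lemma finite_deg:
  assumes "finite V" "D \<subseteq> monoms V"
  shows "finite {\<alpha> \<in> D. monom_degree \<alpha> = n}"
  by (rule finite_subset[OF _ finite_monoms_deg[OF assms(1), of n]]) (use assms(2) in auto)

lemma downset_monoms: "downset V (monoms V)"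
  by (auto simp: downset_def)

lemma downset_colon:
  assumes "downset V D"
  shows "downset V {\<alpha>. \<alpha> + \<beta> \<in> D}" "{\<alpha>. \<alpha> + \<beta> \<in> D} \<subseteq> D"
proof -
  have D: "D \<subseteq> monoms V" "\<And>\<alpha> \<gamma>. \<alpha> + \<gamma> \<in> D \<Longrightarrow> \<alpha> \<in> D" using assms unfolding downset_def by auto
  then show sub: "{\<alpha>. \<alpha> + \<beta> \<in> D} \<subseteq> D" by blast
  have "\<alpha> + \<beta> \<in> D" if "\<alpha> + \<gamma> + \<beta> \<in> D" for \<alpha> \<gamma>
    using that D(2)[of "\<alpha> + \<beta>" \<gamma>] by (simp add: ac_simps)
  then show "downset V {\<alpha>. \<alpha> + \<beta> \<in> D}" using sub D(1) unfolding downset_def by blast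
qed

lemma downset_section:
  assumes "downset V D"
  shows "downset (V - {x}) {\<alpha> \<in> D. x \<notin> Poly_Mapping.keys \<alpha>}"
  using assms unfolding downset_def monoms_def by (auto simp: keys_add_nat)

section \<open>Counting monomials by degree\<close>

lemma count_deg_shift:
  "card {\<alpha> \<in> (\<lambda>\<beta>. \<beta> + \<delta>) ` E. monom_degree \<alpha> = n} =
    (if monom_degree \<delta> \<le> n then count_deg E (n - monom_degree \<delta>) else 0)"
proof (cases "monom_degree \<delta> \<le> n")
  case True
  have "{\<alpha> \<in> (\<lambda>\<beta>. \<beta> + \<delta>) ` E. monom_degree \<alpha> = n} =
    (\<lambda>\<beta>. \<beta> + \<delta>) ` {\<alpha> \<in> E. monom_degree \<alpha> = n - monom_degree \<delta>}"
    using True by (auto simp: monom_degree_add)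
  moreover have "inj_on (\<lambda>\<beta>. \<beta> + \<delta>) {\<alpha> \<in> E. monom_degree \<alpha> = n - monom_degree \<delta>}"
    by (auto intro: inj_onI)
  ultimately show ?thesis using True unfolding count_deg_def by (simp add: card_image)
next
  case False
  then have "{\<alpha> \<in> (\<lambda>\<beta>. \<beta> + \<delta>) ` E. monom_degree \<alpha> = n} = {}" by (auto simp: monom_degree_add)
  with False show ?thesis by (simp only: card.empty if_False)
qed

lemma count_deg_Un:
  assumes "finite V" "A \<union> B \<subseteq> monoms V" "A \<inter> B = {}"
  shows "count_deg (A \<union> B) n = count_deg A n + count_deg B n"
proof -
  have "{\<alpha> \<in> A \<union> B. monom_degree \<alpha> = n} = {\<alpha> \<in> A. monom_degree \<alpha> = n} \<union> {\<alpha> \<in> B. monom_degree \<alpha> = n}"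
    by auto
  then show ?thesis
    unfolding count_deg_def using assms by (simp add: card_Un_disjoint finite_deg disjoint_iff)
qed

text \<open>The counting form of the exact sequence attached to multiplication by \<open>x\<close>:
  the quotient that kills \<open>x\<close>, and the colon quotient delayed by one degree.\<close>

lemma count_deg_split:
  assumes "finite V" "downset V D" "1 \<le> n"
  shows "count_deg D n =
    count_deg {\<alpha> \<in> D. x \<notin> Poly_Mapping.keys \<alpha>} n + count_deg {\<alpha>. \<alpha> + indet x \<in> D} (n - 1)"
proof -
  let ?A = "{\<alpha> \<in> D. x \<notin> Poly_Mapping.keys \<alpha>}"
  let ?B = "(\<lambda>\<beta>. \<beta> + indet x) ` {\<alpha>. \<alpha> + indet x \<in> D}"
  have D: "D = ?A \<union> ?B"
    using monom_split by (fastforce simp: image_iff)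
  have "count_deg (?A \<union> ?B) n = count_deg ?A n + count_deg ?B n"
  proof (rule count_deg_Un[OF assms(1)])
    show "?A \<union> ?B \<subseteq> monoms V" using D assms(2) unfolding downset_def by auto
    show "?A \<inter> ?B = {}" by (auto simp: keys_add_nat)
  qed
  moreover have "count_deg ?B n = count_deg {\<alpha>. \<alpha> + indet x \<in> D} (n - 1)"
    using count_deg_shift[of "indet x" _ n] assms(3) unfolding count_deg_def[of ?B] by simp
  ultimately show ?thesis using D by simp
qed

lemma count_deg_le:
  assumes "finite V" "A \<subseteq> B" "B \<subseteq> monoms V"
  shows "count_deg A n \<le> count_deg B n"
  unfolding count_deg_def using assms by (intro card_mono finite_deg) auto

lemma count_deg_0: "count_deg {0} n = (if n = 0 then 1 else 0)"
proof -
  have "{\<alpha> \<in> {0}. monom_degree \<alpha> = n} = (if n = 0 then {0} else {})" by auto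
  then show ?thesis unfolding count_deg_def by simp
qed

lemma monoms_empty: "monoms {} = {0}"
  by (auto simp: monoms_def)

lemma count_deg_monoms:
  assumes "finite V" "V \<noteq> {}"
  shows "count_deg (monoms V) n = gterm 0 (card V - 1) n"
  using assms
proof (induction V arbitrary: n rule: finite_induct)
  case (insert x V)
  have sec: "{\<alpha> \<in> monoms (insert x V). x \<notin> Poly_Mapping.keys \<alpha>} = monoms V"
    using insert.hyps(2) by (auto simp: monoms_def)
  have col: "{\<alpha>. \<alpha> + indet x \<in> monoms (insert x V)} = monoms (insert x V)" by auto
  \<comment> \<open>Stated in positive degrees, where an empty \<open>V\<close> contributes 0 and no
    truncated \<open>card V - 1\<close> occurs.\<close>
  have IH: "count_deg (monoms V) (Suc n) + gterm 0 (card V) n = gterm 0 (card V) (Suc n)" for n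
  proof (cases "V = {}")
    case True
    then show ?thesis by (simp add: monoms_empty count_deg_0)
  next
    case False
    then obtain c where c: "card V = Suc c" using insert.hyps(1) by (cases "card V") auto
    show ?thesis using insert.IH[OF False, of "Suc n"] unfolding c gterm_def by simp
  qed
  show ?case
  proof (induction n)
    case 0
    have "{\<alpha> \<in> monoms (insert x V). monom_degree \<alpha> = 0} = {0}"
      by (auto simp: monom_degree_eq_0_iff)
    then show ?case unfolding count_deg_def gterm_def by simp
  next
    case (Suc n)
    have "count_deg (monoms (insert x V)) (Suc n) =
      count_deg (monoms V) (Suc n) + count_deg (monoms (insert x V)) n"
      using count_deg_split[OF _ downset_monoms, of "insert x V" "Suc n" x] insert.hyps(1)
      by (simp only: sec col) simp
    then show ?case using Suc IH[of n] insert.hyps by simp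
  qed
qed simp

section \<open>Dickson's lemma\<close>

text \<open>A monotone subsequence always exists; a decreasing one in the natural numbers is
  constant once it attains its least value.\<close>

lemma nat_incseq_subseq:
  fixes g :: "nat \<Rightarrow> nat"
  shows "\<exists>s. strict_mono s \<and> incseq (\<lambda>k. g (s k))"
proof -
  obtain s where s: "strict_mono s" "monoseq (\<lambda>k. g (s k))" using seq_monosub[of g] by blast
  show ?thesis
  proof (cases "incseq (\<lambda>k. g (s k))")
    case False
    then have dec: "decseq (\<lambda>k. g (s k))" using s(2) by (simp add: monoseq_iff)
    define m where "m = (LEAST v. v \<in> range (\<lambda>k. g (s k)))"
    have "m \<in> range (\<lambda>k. g (s k))" unfolding m_def by (rule LeastI[of _ "g (s 0)"]) simp
    then obtain N where N: "g (s N) = m" by auto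
    have "g (s (N + k)) = m" for k
    proof (rule antisym)
      show "g (s (N + k)) \<le> m" using decseqD[OF dec, of N "N + k"] N by simp
      show "m \<le> g (s (N + k))" unfolding m_def by (rule Least_le) simp
    qed
    then have "incseq (\<lambda>k. g (s (N + k)))" by simp
    moreover have "strict_mono (\<lambda>k. s (N + k))" using s(1) by (simp add: strict_mono_def)
    ultimately show ?thesis by blast
  qed (use s in blast)
qed

lemma dickson_subseq:
  fixes f :: "nat \<Rightarrow> nat \<Rightarrow>\<^sub>0 nat"
  assumes "finite V"
  shows "\<exists>r. strict_mono r \<and> (\<forall>x\<in>V. incseq (\<lambda>k. Poly_Mapping.lookup (f (r k)) x))"
  using assms
proof (induction V rule: finite_induct)
  case empty
  then show ?case by (intro exI[of _ id]) (simp add: strict_mono_def)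
next
  case (insert x V)
  then obtain r where r: "strict_mono r" "\<And>y. y \<in> V \<Longrightarrow> incseq (\<lambda>k. Poly_Mapping.lookup (f (r k)) y)"
    by blast
  obtain s where s: "strict_mono s" "incseq (\<lambda>k. Poly_Mapping.lookup (f (r (s k))) x)"
    using nat_incseq_subseq[of "\<lambda>k. Poly_Mapping.lookup (f (r k)) x"] by blast
  show ?case
  proof (intro exI[of _ "\<lambda>k. r (s k)"] conjI ballI)
    show "strict_mono (\<lambda>k. r (s k))" using r(1) s(1) by (simp add: strict_mono_def)
    show "incseq (\<lambda>k. Poly_Mapping.lookup (f (r (s k))) y)" if "y \<in> insert x V" for y
    proof (cases "y = x")
      case False
      with that r(2)[of y] have "incseq (\<lambda>k. Poly_Mapping.lookup (f (r k)) y)" by simp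
      then show ?thesis
        using s(1) by (auto simp: incseq_def strict_mono_less_eq)
    qed (use s in simp)
  qed
qed

text \<open>Pick a monomial lost at each step of a descending chain. By Dickson's lemma one of them
  divides a later one; the later one still lies in the order ideal that has just lost its divisor,
  which is absurd.\<close>

lemma wf_downset:
  assumes "finite V"
  shows "wf {(E, D). downset V E \<and> downset V D \<and> E \<subset> D}"
  unfolding wf_iff_no_infinite_down_chain
proof
  assume "\<exists>D. \<forall>i. (D (Suc i), D i) \<in> {(E, D). downset V E \<and> downset V D \<and> E \<subset> D}"
  then obtain D where D: "\<And>i. downset V (D i)" "\<And>i. D (Suc i) \<subset> D i" by blast
  have "\<forall>i. \<exists>\<alpha>. \<alpha> \<in> D i - D (Suc i)" using D(2) by blast
  then obtain f where f: "\<And>i. f i \<in> D i - D (Suc i)" by metis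
  obtain r where r: "strict_mono r" "\<And>x. x \<in> V \<Longrightarrow> incseq (\<lambda>k. Poly_Mapping.lookup (f (r k)) x)"
    using dickson_subseq[OF assms] by blast
  have keys: "Poly_Mapping.keys (f i) \<subseteq> V" for i
    using f[of i] D(1)[of i] unfolding downset_def monoms_def by blast
  have le: "Poly_Mapping.lookup (f (r 0)) x \<le> Poly_Mapping.lookup (f (r 1)) x" for x
  proof (cases "x \<in> V")
    case True
    then show ?thesis using incseqD[OF r(2), of x 0 1] by simp
  next
    case False
    then have "x \<notin> Poly_Mapping.keys (f (r 0))" using keys[of "r 0"] by auto
    then have "Poly_Mapping.lookup (f (r 0)) x = 0" by (simp only: not_in_keys_iff_lookup_eq_zero)
    then show ?thesis by (simp only: le0)
  qed
  define g where "g = f (r 1) - f (r 0)"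
  have eq: "f (r 0) + g = f (r 1)"
    unfolding g_def using le by (intro poly_mapping_eqI) (simp add: lookup_add lookup_minus)
  have "f (r 1) \<in> D (Suc (r 0))"
  proof -
    have "Suc (r 0) \<le> r 1" using strict_monoD[OF r(1), of 0 1] by simp
    then have "D (r 1) \<subseteq> D (Suc (r 0))"
      by (rule lift_Suc_antimono_le[rotated]) (use D(2) in blast)
    then show ?thesis using f by blast
  qed
  then have "f (r 0) + g \<in> D (Suc (r 0))" by (simp only: eq)
  then have "f (r 0) \<in> D (Suc (r 0))" using D(1)[of "Suc (r 0)"] unfolding downset_def by blast
  then show False using f by blast
qed

section \<open>Order ideals of monomials have Gotzmann growth\<close>

text \<open>Keeps the induction on order ideals moving: unless \<open>D\<close> is empty or full,
  some variable gives a strictly smaller colon.\<close>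

lemma downset_colon_invariant:
  assumes "downset V D" "\<And>x. x \<in> V \<Longrightarrow> {\<alpha>. \<alpha> + indet x \<in> D} = D" "D \<noteq> {}"
  shows "D = monoms V"
proof -
  have "0 \<in> D" using assms(1,3) unfolding downset_def by (metis add_0 ex_in_conv)
  have "\<alpha> \<in> D" if "\<alpha> \<in> monoms V" for \<alpha>
    using that
  proof (induction "monom_degree \<alpha>" arbitrary: \<alpha>)
    case 0
    then show ?case using \<open>0 \<in> D\<close> monom_degree_eq_0_iff by auto
  next
    case (Suc n)
    then have "\<alpha> \<noteq> 0" by auto
    then obtain x where x: "x \<in> Poly_Mapping.keys \<alpha>" by (metis keys_eq_empty all_not_in_conv)
    then obtain \<beta> where \<beta>: "\<alpha> = \<beta> + indet x" using monom_split by blast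
    have "\<beta> \<in> D" using Suc by (intro Suc.hyps) (auto simp: \<beta> monom_degree_add)
    then show ?case using assms(2)[of x] Suc.prems by (auto simp: \<beta>)
  qed
  then show ?thesis using assms(1) unfolding downset_def by blast
qed

text \<open>Two nested inductions: the monomials free of \<open>x\<close> live in fewer variables,
  and the colon by \<open>x\<close> is a smaller order ideal in the same variables.\<close>

lemma gotz_downset_card:
  assumes "finite V" "downset V D"
  shows "gotz (card V) 0 (count_deg D)"
  using assms
proof (induction "card V" arbitrary: V D rule: less_induct)
  case less
  show ?case
    using less.prems(2)
  proof (induction D rule: wf_induct_rule[OF wf_downset[OF less.prems(1)]])
    case (1 D)
    consider "D = {}" | "D = monoms V" | x where "x \<in> V" "{\<alpha>. \<alpha> + indet x \<in> D} \<noteq> D"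
      using downset_colon_invariant[OF 1(2)] by blast
    then show ?case
    proof cases
      case 1
      then show ?thesis using gotz_zero by (simp add: count_deg_def)
    next
      case 2
      show ?thesis
      proof (cases "V = {}")
        case True
        \<comment> \<open>Without variables the only monomial is 1, which counts in degree 0
          alone.\<close>
        then have "count_deg D n = 0" if "n \<ge> 1" for n
          using 2 that by (simp add: monoms_empty count_deg_0)
        then show ?thesis
          using True eventually_ge_at_top[of 1] by (auto simp: gotz_0_iff eventually_sequentially)
      next
        case False
        then have "0 < card V" using less.prems(1) by (simp add: card_gt_0_iff)
        then show ?thesis
          using 2 count_deg_monoms[OF less.prems(1) False] by (intro gotzI[of "[card V - 1]"]) auto
      qed
    next
      case (3 x)
      let ?E = "{\<alpha>. \<alpha> + indet x \<in> D}" and ?D0 = "{\<alpha> \<in> D. x \<notin> Poly_Mapping.keys \<alpha>}"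
      have lt: "card (V - {x}) < card V" using 3 less.prems(1) by (meson card_Diff1_less)
      have D0: "gotz (card V) 0 (count_deg ?D0)"
        using less.hyps[OF lt _ downset_section[OF 1(2)]] lt less.prems(1) by (auto intro: gotz_mono)
      have E: "gotz (card V) 0 (count_deg ?E)"
        using 3 downset_colon[OF 1(2)] 1(2) by (intro 1(1)) auto
      have split: "\<forall>\<^sub>F n in sequentially. count_deg D n = count_deg ?D0 n + count_deg ?E (n - 1)"
        using eventually_ge_at_top[of 1]
        by eventually_elim (rule count_deg_split[OF less.prems(1) 1(2)])
      have "gotz (card V) 0 (\<lambda>n. count_deg ?D0 n + count_deg ?E (n - 1))"
      proof (rule gotz_colon[OF D0 E])
        show "\<forall>\<^sub>F n in sequentially. count_deg ?E n \<le> count_deg ?D0 n + count_deg ?E (n - 1)"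
          using split
        proof eventually_elim
          case (elim n)
          have "count_deg ?E n \<le> count_deg D n"
            using 1(2) downset_colon(2)[OF 1(2)] less.prems(1)
            by (intro count_deg_le[of V]) (auto simp: downset_def)
          then show ?case using elim by simp
        qed
      qed
      then show ?thesis by (rule gotz_cong) (use split in eventually_elim, simp)
    qed
  qed
qed

text \<open>A missing \<alpha> takes all its multiples with it, a copy of all monomials delayed by
  the degree of \<alpha>. The count is therefore strictly below that of all monomials, which is what
  \<open>gotz_lower\<close> asks for.\<close>

lemma gotz_downset_proper:
  assumes "finite V" "V \<noteq> {}" "downset V D" "D \<noteq> monoms V"
  shows "gotz (card V - 1) 0 (count_deg D)"
proof (rule gotz_lower[OF gotz_downset_card[OF assms(1,3)]])
  have DV: "D \<subseteq> monoms V" using assms(3) by (simp add: downset_def)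
  then obtain \<alpha> where \<alpha>: "\<alpha> \<in> monoms V" "\<alpha> \<notin> D" using assms(4) by blast
  show "\<forall>\<^sub>F n in sequentially. count_deg D n < gterm 0 (card V - 1) n"
    using eventually_ge_at_top[of "monom_degree \<alpha>"]
  proof eventually_elim
    case (elim n)
    let ?B = "(\<lambda>\<beta>. \<beta> + \<alpha>) ` monoms V"
    have "count_deg D n + count_deg ?B n = count_deg (D \<union> ?B) n"
    proof (rule count_deg_Un[OF assms(1), symmetric])
      show "D \<inter> ?B = {}"
        using \<alpha>(2) assms(3) unfolding downset_def by (auto simp: add.commute[of _ \<alpha>])
    qed (use DV \<alpha> in auto)
    also have "\<dots> \<le> count_deg (monoms V) n" using DV \<alpha> assms(1) by (intro count_deg_le[of V]) auto
    finally have "count_deg D n + count_deg ?B n \<le> gterm 0 (card V - 1) n"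
      using count_deg_monoms[OF assms(1,2)] by simp
    moreover have "count_deg ?B n = gterm 0 (card V - 1) (n - monom_degree \<alpha>)"
      using count_deg_shift[of \<alpha> "monoms V" n] elim count_deg_monoms[OF assms(1,2)]
      unfolding count_deg_def[of ?B] by simp
    ultimately show ?case using gterm_pos[of 0 "n - monom_degree \<alpha>" "card V - 1"] by simp
  qed
qed

section \<open>Lexicographic order ideals\<close>

text \<open>For a decreasing list these are the monomials lexicographically last in their degree:
  those in the last \<open>c + 1\<close> variables, then the variable \<open>b - 2 - c\<close> just
  before them times the order ideal of the tail. That extra variable must exist, hence the condition
  \<open>c + 2 \<le> b\<close> below and the bound in part (ii).\<close>

primrec lex_downset :: "nat \<Rightarrow> nat list \<Rightarrow> (nat \<Rightarrow>\<^sub>0 nat) set" where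
  "lex_downset b [] = {}"
| "lex_downset b (c # cs) =
     monoms {b - 1 - c..<b} \<union> (\<lambda>\<alpha>. \<alpha> + indet (b - 2 - c)) ` lex_downset b cs"

lemma lex_downset_monoms:
  "sorted_wrt (\<ge>) cs \<Longrightarrow> (\<And>c. c \<in> set cs \<Longrightarrow> c \<le> d) \<Longrightarrow> d + 2 \<le> b \<Longrightarrow>
    lex_downset b cs \<subseteq> monoms {b - 2 - d..<b}"
proof (induction cs arbitrary: d)
  case (Cons c cs)
  have "lex_downset b cs \<subseteq> monoms {b - 2 - c..<b}"
    using Cons.prems(1,3) Cons.prems(2)[of c] by (intro Cons.IH) auto
  moreover have "c \<le> d" using Cons.prems by simp
  ultimately show ?case
    using Cons.prems(3) by (auto simp: monoms_def keys_add_nat) (fastforce | linarith)+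
qed simp

text \<open>If the extra variable of a product sits in the cofactor, the divisor is only known to
  lie in the order ideal of the tail; this inclusion brings it back. A tail with smaller first entry
  uses only the last \<open>c + 1\<close> variables, and one with equal first entry is handled by
  induction.\<close>

lemma lex_downset_subset_Cons:
  "sorted_wrt (\<ge>) cs \<Longrightarrow> (\<And>d. d \<in> set cs \<Longrightarrow> d \<le> c) \<Longrightarrow> c + 2 \<le> b \<Longrightarrow>
    lex_downset b cs \<subseteq> lex_downset b (c # cs)"
proof (induction cs arbitrary: c)
  case (Cons d cs)
  show ?case
  proof (cases "d = c")
    case True
    have "lex_downset b cs \<subseteq> lex_downset b (d # cs)"
      using Cons.prems True by (intro Cons.IH) auto
    then show ?thesis using True by auto
  next
    case False
    then have "d < c" using Cons.prems by (simp add: order_less_le)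
    have "lex_downset b (d # cs) \<subseteq> monoms {b - 2 - d..<b}"
      using Cons.prems \<open>d < c\<close> by (intro lex_downset_monoms) auto
    also have "{b - 2 - d..<b} \<subseteq> {b - 1 - c..<b}" using \<open>d < c\<close> by auto
    then have "monoms {b - 2 - d..<b} \<subseteq> monoms {b - 1 - c..<b}" by (auto simp: monoms_def)
    finally show ?thesis by auto
  qed
qed simp

lemma downset_lex_downset:
  "sorted_wrt (\<ge>) cs \<Longrightarrow> (\<And>c. c \<in> set cs \<Longrightarrow> c + 2 \<le> b) \<Longrightarrow> downset {..<b} (lex_downset b cs)"
proof (induction cs)
  case (Cons c cs)
  have c: "c + 2 \<le> b" "\<And>d. d \<in> set cs \<Longrightarrow> d \<le> c" "sorted_wrt (\<ge>) cs" using Cons.prems by auto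
  have IH: "downset {..<b} (lex_downset b cs)" using Cons by simp
  have "\<alpha> \<in> lex_downset b (c # cs)" if mem: "\<alpha> + \<beta> \<in> lex_downset b (c # cs)" for \<alpha> \<beta>
  proof -
    consider "\<alpha> + \<beta> \<in> monoms {b - 1 - c..<b}"
      | \<delta> where "\<alpha> + \<beta> = \<delta> + indet (b - 2 - c)" "\<delta> \<in> lex_downset b cs"
      using mem unfolding lex_downset.simps by blast
    then show ?thesis
    proof cases
      case (2 \<delta>)
      have "b - 2 - c \<in> Poly_Mapping.keys (\<delta> + indet (b - 2 - c))" by (simp add: keys_add_nat)
      then have "b - 2 - c \<in> Poly_Mapping.keys \<alpha> \<or> b - 2 - c \<in> Poly_Mapping.keys \<beta>"
        unfolding 2(1)[symmetric] keys_add_nat by simp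
      then consider \<alpha>' where "\<alpha> = \<alpha>' + indet (b - 2 - c)" | \<beta>' where "\<beta> = \<beta>' + indet (b - 2 - c)"
        using monom_split by blast
      then show ?thesis
      proof cases
        case (1 \<alpha>')
        have "(\<alpha>' + \<beta>) + indet (b - 2 - c) = \<delta> + indet (b - 2 - c)"
          using 2(1) unfolding 1 by (simp only: add.assoc add.commute[of \<beta>])
        then have "\<alpha>' + \<beta> = \<delta>" by (rule add_right_imp_eq)
        then have "\<alpha>' \<in> lex_downset b cs" using 2 IH unfolding downset_def by blast
        with 1 show ?thesis by auto
      next
        case (2 \<beta>')
        with \<open>\<alpha> + \<beta> = _\<close> have "\<alpha> + \<beta>' = \<delta>"
          by (simp add: add.assoc[symmetric])
        then have "\<alpha> \<in> lex_downset b cs" using \<open>\<delta> \<in> _\<close> IH unfolding downset_def by blast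
        then show ?thesis using lex_downset_subset_Cons[OF c(3,2,1)] by blast
      qed
    qed simp
  qed
  moreover have "lex_downset b (c # cs) \<subseteq> monoms {..<b}"
  proof -
    have "lex_downset b cs \<subseteq> monoms {..<b}" using IH unfolding downset_def by blast
    moreover have "monoms {b - 1 - c..<b} \<subseteq> monoms {..<b}" by (auto simp: monoms_def)
    ultimately show ?thesis using c(1) by auto
  qed
  ultimately show ?case unfolding downset_def by blast
qed (simp add: downset_def)

text \<open>\<open>length cs \<le> n\<close> leaves one degree for each of the nested extra
  variables.\<close>

lemma count_deg_lex_downset:
  "sorted_wrt (\<ge>) cs \<Longrightarrow> (\<And>c. c \<in> set cs \<Longrightarrow> c + 2 \<le> b) \<Longrightarrow> length cs \<le> n \<Longrightarrow>
    count_deg (lex_downset b cs) n = gsum 0 cs n"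
proof (induction cs arbitrary: n)
  case (Cons c cs)
  let ?B = "(\<lambda>\<alpha>. \<alpha> + indet (b - 2 - c)) ` lex_downset b cs"
  have c: "c + 2 \<le> b" using Cons.prems by auto
  have "count_deg (lex_downset b (c # cs)) n =
    count_deg (monoms {b - 1 - c..<b}) n + count_deg ?B n"
    unfolding lex_downset.simps
  proof (rule count_deg_Un[of "{..<b}"])
    show "monoms {b - 1 - c..<b} \<union> ?B \<subseteq> monoms {..<b}"
      using downset_lex_downset[OF Cons.prems(1,2)] unfolding downset_def by simp
    show "monoms {b - 1 - c..<b} \<inter> ?B = {}" using c by (auto simp: monoms_def keys_add_nat)
  qed simp
  also have "count_deg (monoms {b - 1 - c..<b}) n = gterm 0 c n"
    using c by (subst count_deg_monoms) auto
  also have "count_deg ?B n = count_deg (lex_downset b cs) (n - 1)"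
    using count_deg_shift[of "indet (b - 2 - c)" _ n] Cons.prems(3)
    unfolding count_deg_def[of ?B] by simp
  also have "\<dots> = gsum 0 cs (n - 1)" using Cons.prems by (intro Cons.IH) auto
  also have "\<dots> = gsum (Suc 0) cs n" using Cons.prems(3) by (intro gsum_pred) simp
  finally show ?case by simp
qed (simp add: count_deg_def)

section \<open>Chains of submodules and length\<close>

text \<open>Measures the quotient of \<open>B\<close> by \<open>A\<close> inside the lattice of
  submodules, so that no quotient is formed. The chain need not reach \<open>A\<close> or
  \<open>B\<close>, which makes the notion monotone in both ends.\<close>

definition has_chain :: "('r::comm_ring_1 \<Rightarrow> 'b::ab_group_add \<Rightarrow> 'b) \<Rightarrow> nat \<Rightarrow> 'b set \<Rightarrow> 'b set \<Rightarrow> bool" where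
  "has_chain s k A B \<longleftrightarrow> (\<exists>N :: nat \<Rightarrow> 'b set.
     (\<forall>i\<le>k. module.subspace s (N i) \<and> A \<subseteq> N i \<and> N i \<subseteq> B) \<and> (\<forall>i<k. N i \<subset> N (Suc i)))"

definition has_length :: "('r::comm_ring_1 \<Rightarrow> 'b::ab_group_add \<Rightarrow> 'b) \<Rightarrow> nat \<Rightarrow> 'b set \<Rightarrow> 'b set \<Rightarrow> bool" where
  "has_length s n A B \<longleftrightarrow> has_chain s n A B \<and> (\<forall>k. has_chain s k A B \<longrightarrow> k \<le> n)"

lemma has_chainE:
  assumes "has_chain s k A B"
  obtains N where "\<And>i. i \<le> k \<Longrightarrow> module.subspace s (N i)" "\<And>i. i \<le> k \<Longrightarrow> A \<subseteq> N i"
    "\<And>i. i \<le> k \<Longrightarrow> N i \<subseteq> B" "\<And>i. i < k \<Longrightarrow> N i \<subset> N (Suc i)"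
proof -
  from assms obtain N where N: "\<forall>i\<le>k. module.subspace s (N i) \<and> A \<subseteq> N i \<and> N i \<subseteq> B"
    "\<forall>i<k. N i \<subset> N (Suc i)"
    unfolding has_chain_def by (elim exE conjE)
  show ?thesis by (rule that[of N]) (use N in simp_all)
qed

lemma has_chainI:
  assumes "\<And>i. i \<le> k \<Longrightarrow> module.subspace s (N i)" "\<And>i. i \<le> k \<Longrightarrow> A \<subseteq> N i"
    "\<And>i. i \<le> k \<Longrightarrow> N i \<subseteq> B" "\<And>i. i < k \<Longrightarrow> N i \<subset> N (Suc i)"
  shows "has_chain s k A B"
  unfolding has_chain_def by (intro exI[of _ N]) (simp add: assms)

lemma has_chain_mono:
  assumes "has_chain s k A B" "A' \<subseteq> A" "B \<subseteq> B'"
  shows "has_chain s k A' B'"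
proof -
  obtain N where N: "\<And>i. i \<le> k \<Longrightarrow> module.subspace s (N i)" "\<And>i. i \<le> k \<Longrightarrow> A \<subseteq> N i"
    "\<And>i. i \<le> k \<Longrightarrow> N i \<subseteq> B" "\<And>i. i < k \<Longrightarrow> N i \<subset> N (Suc i)"
    using assms(1) by (rule has_chainE) blast
  show ?thesis
    by (rule has_chainI[of k s N]) (fact N order_trans[OF assms(2) N(2)] order_trans[OF N(3) assms(3)])+
qed

lemma has_chain_subset:
  assumes "has_chain s k A B"
  shows "A \<subseteq> B"
proof -
  obtain N where "\<And>i. i \<le> k \<Longrightarrow> module.subspace s (N i)" "\<And>i. i \<le> k \<Longrightarrow> A \<subseteq> N i"
    "\<And>i. i \<le> k \<Longrightarrow> N i \<subseteq> B" "\<And>i. i < k \<Longrightarrow> N i \<subset> N (Suc i)"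
    using assms by (rule has_chainE) blast
  from this(2,3)[of 0] show ?thesis by simp
qed

lemma has_chain_0: "module.subspace s A \<Longrightarrow> A \<subseteq> B \<Longrightarrow> has_chain s 0 A B"
  unfolding has_chain_def by (intro exI[of _ "\<lambda>_. A"]) auto

lemma has_chain_append:
  assumes "has_chain s p A B" "has_chain s q B C"
  shows "has_chain s (p + q) A C"
proof -
  obtain N where N: "\<And>i. i \<le> p \<Longrightarrow> module.subspace s (N i)" "\<And>i. i \<le> p \<Longrightarrow> A \<subseteq> N i"
    "\<And>i. i \<le> p \<Longrightarrow> N i \<subseteq> B" "\<And>i. i < p \<Longrightarrow> N i \<subset> N (Suc i)"
    using assms(1) by (rule has_chainE) blast
  obtain L where L: "\<And>i. i \<le> q \<Longrightarrow> module.subspace s (L i)" "\<And>i. i \<le> q \<Longrightarrow> B \<subseteq> L i"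
    "\<And>i. i \<le> q \<Longrightarrow> L i \<subseteq> C" "\<And>i. i < q \<Longrightarrow> L i \<subset> L (Suc i)"
    using assms(2) by (rule has_chainE) blast
  have AB: "A \<subseteq> B" "B \<subseteq> C" using assms has_chain_subset by blast+
  show ?thesis
  proof (rule has_chainI[of _ s "\<lambda>i. if i \<le> p then N i else L (i - p)"], goal_cases)
    case (1 i)
    then have "i - p \<le> q" by simp
    then show ?case using N(1)[of i] L(1)[of "i - p"] by auto
  next
    case (2 i)
    then have "i - p \<le> q" by simp
    then show ?case using N(2)[of i] L(2)[of "i - p"] AB(1) by auto
  next
    case (3 i)
    then have "i - p \<le> q" by simp
    then show ?case using N(3)[of i] L(3)[of "i - p"] AB(2) by auto
  next
    case (4 i)
    consider "Suc i \<le> p" | "i = p" | "p < i" by linarith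
    then show ?case
    proof cases
      case 1
      then show ?thesis using N(4)[of i] by simp
    next
      case 2
      then have "0 < q" using 4 by simp
      then have "N p \<subset> L (Suc 0)" using N(3)[of p] L(2)[of 0] L(4)[of 0] by blast
      then show ?thesis using 2 by simp
    next
      case 3
      then show ?thesis using L(4)[of "i - p"] 4 by (simp add: Suc_diff_le)
    qed
  qed
qed

lemma has_chain_extend:
  assumes "has_chain s p A S" "module.subspace s S" "module.subspace s T" "S \<subset> T"
  shows "has_chain s (Suc p) A T"
proof -
  have "has_chain s 1 S T"
    using assms(2-) by (intro has_chainI[of 1 s "\<lambda>i. if i = 0 then S else T"]) auto
  from has_chain_append[OF assms(1) this] show ?thesis by simp
qed

lemma module_subspace_sums:
  assumes "Modules.module s" and S: "module.subspace s S" and T: "module.subspace s T"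
  shows "module.subspace s {x + y |x y. x \<in> S \<and> y \<in> T}"
proof -
  interpret Modules.module s by fact
  have eq: "{x + y |x y. x \<in> S \<and> y \<in> T} = span (S \<union> T)"
    unfolding span_Un span_eq_iff[THEN iffD2, OF S] span_eq_iff[THEN iffD2, OF T] ..
  show ?thesis unfolding eq by (rule subspace_span)
qed

text \<open>By the modular law, each step of a chain remains strict after intersecting with \<open>B\<close>
  or after adding \<open>B\<close>.\<close>

lemma has_chain_split:
  assumes s: "Modules.module s" and "has_chain s k A C"
    and B: "module.subspace s B" "A \<subseteq> B" "B \<subseteq> C" and A: "module.subspace s A" and C: "module.subspace s C"
  shows "\<exists>p q. has_chain s p A B \<and> has_chain s q B C \<and> k \<le> p + q"
proof -
  interpret Modules.module s by (rule s)
  obtain N where N: "\<And>i. i \<le> k \<Longrightarrow> subspace (N i)" "\<And>i. i \<le> k \<Longrightarrow> A \<subseteq> N i"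
    "\<And>i. i \<le> k \<Longrightarrow> N i \<subseteq> C" "\<And>i. i < k \<Longrightarrow> N i \<subset> N (Suc i)"
    using assms(2) by (rule has_chainE) blast
  let ?M = "\<lambda>i. N i \<inter> B" and ?L = "\<lambda>i. {x + y |x y. x \<in> N i \<and> y \<in> B}"
  have L: "?L i \<subseteq> C" if "i \<le> k" for i
  proof -
    have "N i \<subseteq> C" using N(3)[OF that] .
    then show ?thesis using B(3) subspace_add[OF C] by blast
  qed
  \<comment> \<open>Both chains grow along \<open>N\<close>: every strict step of \<open>N\<close>
    is passed on to at least one of them.\<close>
  have "\<exists>p q. has_chain s p A (?M i) \<and> has_chain s q B (?L i) \<and> i \<le> p + q" if "i \<le> k" for i
    using that
  proof (induction i)
    case 0
    have "0 \<in> N 0" using N(1)[of 0] by (simp add: subspace_0)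
    have "B \<subseteq> ?L 0"
    proof
      fix x assume "x \<in> B"
      then have "0 + x \<in> ?L 0" using \<open>0 \<in> N 0\<close> by blast
      then show "x \<in> ?L 0" by simp
    qed
    then have "has_chain s 0 B (?L 0)" by (rule has_chain_0[OF B(1)])
    moreover have "has_chain s 0 A (?M 0)"
      by (rule has_chain_0[OF A]) (use N(2)[of 0] B(2) in blast)
    ultimately show ?case by (intro exI[of _ 0]) simp
  next
    case (Suc i)
    then obtain p q where pq: "has_chain s p A (?M i)" "has_chain s q B (?L i)" "i \<le> p + q"
      by auto
    have lt: "N i \<subset> N (Suc i)" using N(4) Suc.prems by simp
    have Ni: "subspace (N i)" "subspace (N (Suc i))" using N(1) Suc.prems by auto
    note sub = subspace_inter[OF Ni(1) B(1)] subspace_inter[OF Ni(2) B(1)]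
      module_subspace_sums[OF s Ni(1) B(1)] module_subspace_sums[OF s Ni(2) B(1)]
    have le: "?M i \<subseteq> ?M (Suc i)" "?L i \<subseteq> ?L (Suc i)" using lt by auto
    show ?case
    proof (cases "?M i = ?M (Suc i)")
      case False
      then have "has_chain s (Suc p) A (?M (Suc i))"
        using has_chain_extend[OF pq(1) sub(1,2)] le(1) by blast
      moreover have "has_chain s q B (?L (Suc i))" using has_chain_mono[OF pq(2) _ le(2)] by simp
      ultimately show ?thesis using pq(3) by (intro exI[of _ "Suc p"] exI[of _ q]) simp
    next
      case True
      have "?L i \<noteq> ?L (Suc i)"
      proof
        assume eq: "?L i = ?L (Suc i)"
        \<comment> \<open>An element of the larger module differs from one of the smaller by an
          element of \<open>B\<close>, which lies in both intersections since these agree.\<close>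
        have "N (Suc i) \<subseteq> N i"
        proof
          fix x assume x: "x \<in> N (Suc i)"
          then have "x + 0 \<in> ?L (Suc i)" using subspace_0[OF B(1)] by blast
          then have "x \<in> ?L (Suc i)" by simp
          then obtain y z where yz: "x = y + z" "y \<in> N i" "z \<in> B" unfolding eq[symmetric] by blast
          then have "z = x - y" by simp
          moreover have "x - y \<in> N (Suc i)"
            using x yz(2) lt by (intro subspace_diff[OF Ni(2)]) auto
          ultimately have "z \<in> ?M (Suc i)" using yz(3) by simp
          then have "z \<in> N i" using True by blast
          then show "x \<in> N i" unfolding yz(1) by (intro subspace_add[OF Ni(1) yz(2)])
        qed
        with lt show False by blast
      qed
      then have "has_chain s (Suc q) B (?L (Suc i))"
        using has_chain_extend[OF pq(2) sub(3,4)] le(2) by blast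
      moreover have "has_chain s p A (?M (Suc i))" using pq(1) True by simp
      ultimately show ?thesis using pq(3) by (intro exI[of _ p] exI[of _ "Suc q"]) simp
    qed
  qed
  from this[of k] obtain p q where pq: "has_chain s p A (?M k)" "has_chain s q B (?L k)" "k \<le> p + q"
    by blast
  have "has_chain s q B C" using has_chain_mono[OF pq(2) subset_refl L] by simp
  moreover have "has_chain s p A B" using has_chain_mono[OF pq(1)] by blast
  ultimately show ?thesis using pq(3) by blast
qed


lemma has_chain_le:
  assumes "has_chain s k A B" "l \<le> k"
  shows "has_chain s l A B"
proof -
  obtain N where N: "\<And>i. i \<le> k \<Longrightarrow> module.subspace s (N i)" "\<And>i. i \<le> k \<Longrightarrow> A \<subseteq> N i"
    "\<And>i. i \<le> k \<Longrightarrow> N i \<subseteq> B" "\<And>i. i < k \<Longrightarrow> N i \<subset> N (Suc i)"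
    using assms(1) by (rule has_chainE) blast
  show ?thesis by (rule has_chainI[of l s N]) (use N assms(2) in simp_all)
qed

lemma has_length_add:
  assumes "Modules.module s" "has_length s p A B" "has_length s q B C"
    "module.subspace s A" "module.subspace s B" "module.subspace s C"
  shows "has_length s (p + q) A C"
  unfolding has_length_def
proof (intro conjI allI impI)
  show "has_chain s (p + q) A C" using assms(2,3) has_chain_append unfolding has_length_def by blast
  fix k assume "has_chain s k A C"
  moreover have "A \<subseteq> B" "B \<subseteq> C" using assms(2,3) has_chain_subset unfolding has_length_def by blast+
  ultimately obtain p' q' where "has_chain s p' A B" "has_chain s q' B C" "k \<le> p' + q'"
    using has_chain_split[OF assms(1)] assms by blast
  moreover from this(1,2) have "p' \<le> p" "q' \<le> q" using assms(2,3) unfolding has_length_def by blast+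
  ultimately show "k \<le> p + q" by simp
qed

lemma has_length_exists:
  assumes "has_chain s 0 A B" "\<And>k. has_chain s k A B \<Longrightarrow> k \<le> n"
  shows "\<exists>m\<le>n. has_length s m A B"
proof -
  let ?m = "GREATEST k. has_chain s k A B"
  have "has_chain s ?m A B" by (rule GreatestI_nat[of _ 0 n]) (use assms in auto)
  moreover have "k \<le> ?m" if "has_chain s k A B" for k
    by (rule Greatest_le_nat[of _ k n]) (use assms that in auto)
  ultimately show ?thesis using assms(2) unfolding has_length_def by blast
qed

lemma has_length_same: "module.subspace s A \<Longrightarrow> has_length s 0 A A"
  unfolding has_length_def
proof (intro conjI allI impI)
  fix k assume "has_chain s k A A"
  then obtain N where "\<And>i. i \<le> k \<Longrightarrow> module.subspace s (N i)" and N: "\<And>i. i \<le> k \<Longrightarrow> A \<subseteq> N i"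
    "\<And>i. i \<le> k \<Longrightarrow> N i \<subseteq> A" "\<And>i. i < k \<Longrightarrow> N i \<subset> N (Suc i)"
    by (rule has_chainE) blast
  show "k \<le> 0"
  proof (rule ccontr)
    assume "\<not> k \<le> 0"
    then show False using N(1)[of 0] N(2)[of "Suc 0"] N(3)[of 0] by auto
  qed
qed (simp add: has_chain_0)

lemma Sup_chain_eq:
  assumes "has_length s n A B"
  shows "Sup {enat k |k. has_chain s k A B} = enat n"
proof (rule antisym)
  show "Sup {enat k |k. has_chain s k A B} \<le> enat n"
  proof (rule Sup_least)
    fix x assume "x \<in> {enat k |k. has_chain s k A B}"
    then obtain k where "x = enat k" "has_chain s k A B" by blast
    then show "x \<le> enat n" using assms unfolding has_length_def by simp
  qed
  show "enat n \<le> Sup {enat k |k. has_chain s k A B}"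
    by (rule Sup_upper) (use assms in \<open>unfold has_length_def, blast\<close>)
qed

section \<open>The base ring as a module over itself, and cyclic extensions\<close>

lemma ring_module: "Modules.module ((*) :: 'a::comm_ring_1 \<Rightarrow> 'a \<Rightarrow> 'a)"
  by (rule Modules.module.intro) (simp_all add: distrib_left distrib_right mult.assoc)

abbreviation rideal :: "'a::comm_ring_1 set \<Rightarrow> bool" where
  "rideal \<equiv> module.subspace ((*) :: 'a \<Rightarrow> 'a \<Rightarrow> 'a)"

lemma rideal_iff:
  "rideal J \<longleftrightarrow> 0 \<in> J \<and> (\<forall>x\<in>J. \<forall>y\<in>J. x + y \<in> J) \<and> (\<forall>c. \<forall>x\<in>J. c * x \<in> J)"
  by (rule Modules.module.subspace_def[OF ring_module])

lemma rideal_UNIV: "rideal UNIV"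
  by (simp add: rideal_iff)

text \<open>A cyclic extension of modules is a quotient of the ring by a colon ideal.\<close>

lemma has_length_cyclic:
  assumes s: "Modules.module s" and A: "module.subspace s A"
    and len: "has_length (*) n {r. s r v \<in> A} UNIV"
  shows "has_length s n A {a + s r v |a r. a \<in> A}"
proof -
  interpret Modules.module s by (rule s)
  let ?B = "{a + s r v |a r. a \<in> A}"
  have iff: "has_chain s k A ?B \<longleftrightarrow> has_chain (*) k {r. s r v \<in> A} UNIV" for k
  proof
    assume "has_chain s k A ?B"
    then obtain N where N: "\<And>i. i \<le> k \<Longrightarrow> subspace (N i)" "\<And>i. i \<le> k \<Longrightarrow> A \<subseteq> N i"
      "\<And>i. i \<le> k \<Longrightarrow> N i \<subseteq> ?B" "\<And>i. i < k \<Longrightarrow> N i \<subset> N (Suc i)"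
      by (rule has_chainE) blast
    show "has_chain (*) k {r. s r v \<in> A} UNIV"
    proof (rule has_chainI[of _ _ "\<lambda>i. {r. s r v \<in> N i}"], goal_cases)
      case (1 i)
      note sub = N(1)[OF 1]
      show ?case
        unfolding rideal_iff
        using subspace_0[OF sub] subspace_add[OF sub] subspace_scale[OF sub]
        by (auto simp: scale_left_distrib simp flip: scale_scale)
    next
      case (2 i)
      then show ?case using N(2) by blast
    next
      case (4 i)
      have lt: "N i \<subset> N (Suc i)" using N(4)[OF 4] .
      have sub: "subspace (N i)" "subspace (N (Suc i))" "A \<subseteq> N i" "A \<subseteq> N (Suc i)"
        using N(1,2) 4 by simp_all
      \<comment> \<open>Modulo \<open>A\<close> every element of \<open>?B\<close> is a multiple of
        \<open>v\<close>, so a strict step is witnessed by a multiple of \<open>v\<close>.\<close>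
      obtain x where x: "x \<in> N (Suc i)" "x \<notin> N i" using lt by blast
      then obtain a r where ar: "x = a + s r v" "a \<in> A" using N(3)[of "Suc i"] 4 by fastforce
      have "s r v = x - a" using ar by simp
      then have "s r v \<in> N (Suc i)"
        using x(1) ar(2) sub(4) subspace_diff[OF sub(2), of x a] by auto
      moreover have "s r v \<notin> N i"
        using x(2) ar sub(3) subspace_add[OF sub(1), of a "s r v"] by auto
      ultimately show ?case using lt by blast
    qed simp
  next
    assume "has_chain (*) k {r. s r v \<in> A} UNIV"
    then obtain N where N: "\<And>i. i \<le> k \<Longrightarrow> rideal (N i)" "\<And>i. i \<le> k \<Longrightarrow> {r. s r v \<in> A} \<subseteq> N i"
      "\<And>i. i \<le> k \<Longrightarrow> N i \<subseteq> UNIV" "\<And>i. i < k \<Longrightarrow> N i \<subset> N (Suc i)"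
      by (rule has_chainE) blast
    let ?L = "\<lambda>i. {a + s r v |a r. a \<in> A \<and> r \<in> N i}"
    have AL: "A \<subseteq> ?L i" if "i \<le> k" for i
    proof
      fix a assume "a \<in> A"
      then have "a + s 0 v \<in> ?L i" using N(1)[OF that] unfolding rideal_iff by blast
      then show "a \<in> ?L i" by simp
    qed
    show "has_chain s k A ?B"
    proof (rule has_chainI[of _ _ ?L], goal_cases)
      case (1 i)
      have N0: "\<And>x y. x \<in> N i \<Longrightarrow> y \<in> N i \<Longrightarrow> x + y \<in> N i" "\<And>c x. x \<in> N i \<Longrightarrow> c * x \<in> N i"
        using N(1)[OF 1] unfolding rideal_iff by blast+
      show ?case
      proof (rule subspaceI)
        show "0 \<in> ?L i" using AL[OF 1] subspace_0[OF A] by blast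
        show "x + y \<in> ?L i" if xy: "x \<in> ?L i" "y \<in> ?L i" for x y
        proof -
          obtain a r where x: "x = a + s r v" "a \<in> A" "r \<in> N i" using xy(1) by blast
          obtain b t where y: "y = b + s t v" "b \<in> A" "t \<in> N i" using xy(2) by blast
          have "x + y = (a + b) + s (r + t) v" by (simp add: x y scale_left_distrib)
          then show ?thesis using subspace_add[OF A x(2) y(2)] N0(1)[OF x(3) y(3)] by blast
        qed
        show "s c x \<in> ?L i" if xi: "x \<in> ?L i" for c x
        proof -
          obtain a r where x: "x = a + s r v" "a \<in> A" "r \<in> N i" using xi by blast
          have "s c x = s c a + s (c * r) v" by (simp add: x scale_right_distrib)
          then show ?thesis using subspace_scale[OF A x(2)] N0(2)[OF x(3)] by blast
        qed
      qed
    next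
      case (2 i)
      then show ?case by (rule AL)
    next
      case (3 i)
      show ?case by blast
    next
      case (4 i)
      have lt: "N i \<subset> N (Suc i)" using N(4)[OF 4] .
      then obtain t where t: "t \<in> N (Suc i)" "t \<notin> N i" by blast
      have "0 + s t v \<in> ?L (Suc i)" using t(1) subspace_0[OF A] by blast
      moreover have "0 + s t v \<notin> ?L i"
      proof
        assume "0 + s t v \<in> ?L i"
        then obtain a r where ar: "0 + s t v = a + s r v" "a \<in> A" "r \<in> N i" by blast
        \<comment> \<open>The difference of the two coefficients lies in the colon ideal, hence in
          \<open>N i\<close>.\<close>
        then have "s (t - r) v \<in> A" by (simp add: scale_left_diff_distrib)
        moreover have Ni: "rideal (N i)" "{r. s r v \<in> A} \<subseteq> N i" using N(1,2)[of i] 4 by simp_all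
        ultimately have "t - r \<in> N i" by blast
        then have "(t - r) + r \<in> N i" using ar(3) Ni(1) unfolding rideal_iff by blast
        then show False using t(2) by simp
      qed
      moreover have "?L i \<subseteq> ?L (Suc i)" using lt by blast
      ultimately show ?case by blast
    qed
  qed
  show ?thesis using len unfolding has_length_def iff .
qed

section \<open>Local rings with descending chain condition\<close>

lemmas rideal_0 = Modules.module.subspace_0[OF ring_module]
lemmas rideal_add = Modules.module.subspace_add[OF ring_module]
lemmas rideal_mult = Modules.module.subspace_scale[OF ring_module]
lemmas rideal_diff = Modules.module.subspace_diff[OF ring_module]
lemmas ridealI = Modules.module.subspaceI[OF ring_module]

text \<open>Serves two purposes: with \<open>z = 1\<close> and \<open>C\<close> the whole ring it
  yields a maximal ideal, and inside an ideal \<open>C\<close> of a local ring it yields a maximal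
  subideal of \<open>C\<close>, provided that \<open>A\<close> contains the maximal ideal times
  \<open>C\<close>.\<close>

lemma exists_maximal_avoiding:
  assumes "rideal A" "A \<subseteq> C" "rideal C" "z \<notin> A"
  shows "\<exists>J. rideal J \<and> A \<subseteq> J \<and> J \<subseteq> C \<and> z \<notin> J \<and>
    (\<forall>K. rideal K \<longrightarrow> J \<subset> K \<longrightarrow> K \<subseteq> C \<longrightarrow> z \<in> K)"
proof -
  let ?F = "{J. rideal J \<and> A \<subseteq> J \<and> J \<subseteq> C \<and> z \<notin> J}"
  have "\<exists>M\<in>?F. \<forall>S\<in>?F. M \<subseteq> S \<longrightarrow> S = M"
  proof (rule subset_Zorn)
    fix ch assume ch: "subset.chain ?F ch"
    show "\<exists>U\<in>?F. \<forall>S\<in>ch. S \<subseteq> U"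
    proof (cases "ch = {}")
      case True
      have "A \<in> ?F" using assms by simp
      with True show ?thesis by auto
    next
      case False
      have F: "\<And>S. S \<in> ch \<Longrightarrow> rideal S \<and> A \<subseteq> S \<and> S \<subseteq> C \<and> z \<notin> S"
        and tot: "\<And>S T. S \<in> ch \<Longrightarrow> T \<in> ch \<Longrightarrow> S \<subseteq> T \<or> T \<subseteq> S"
        using ch unfolding subset_chain_def by blast+
      have "rideal (\<Union>ch)"
      proof (rule ridealI)
        obtain S where S: "S \<in> ch" using False by blast
        have "rideal S" using F[OF S] by simp
        from rideal_0[OF this] show "0 \<in> \<Union>ch" using S by blast
        show "x + y \<in> \<Union>ch" if xy: "x \<in> \<Union>ch" "y \<in> \<Union>ch" for x y
        proof -
          obtain S T where ST: "S \<in> ch" "T \<in> ch" "x \<in> S" "y \<in> T" using xy by blast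
          have "\<exists>U\<in>ch. x \<in> U \<and> y \<in> U"
            using tot[OF ST(1,2)] by (rule disjE) (use ST in blast)+
          then obtain U where U: "U \<in> ch" "x \<in> U" "y \<in> U" by blast
          have "rideal U" using F[OF U(1)] by simp
          from rideal_add[OF this U(2,3)] show ?thesis using U(1) by blast
        qed
        show "c * x \<in> \<Union>ch" if xi: "x \<in> \<Union>ch" for c x
        proof -
          obtain S where S: "S \<in> ch" "x \<in> S" using xi by blast
          have "rideal S" using F[OF S(1)] by simp
          from rideal_mult[OF this S(2)] show ?thesis using S(1) by blast
        qed
      qed
      moreover obtain S where S: "S \<in> ch" using False by blast
      have "A \<subseteq> \<Union>ch" using F[OF S] S by blast
      moreover have "\<Union>ch \<subseteq> C" "z \<notin> \<Union>ch" using F by blast+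
      ultimately have "\<Union>ch \<in> ?F" by simp
      then show ?thesis by (rule bexI[rotated]) blast
    qed
  qed
  then obtain M where M: "M \<in> ?F" and max: "\<forall>S\<in>?F. M \<subseteq> S \<longrightarrow> S = M" by (elim bexE)
  have "z \<in> K" if K: "rideal K" "M \<subset> K" "K \<subseteq> C" for K
  proof (rule ccontr)
    assume "z \<notin> K"
    with K M have "K \<in> ?F" by auto
    with max K(2) show False by blast
  qed
  with M show ?thesis by blast
qed

lemma dcc_minimal:
  assumes dcc: "\<And>J :: nat \<Rightarrow> 'a::comm_ring_1 set. (\<And>n. rideal (J n)) \<Longrightarrow> (\<And>n. J (Suc n) \<subseteq> J n) \<Longrightarrow>
      \<exists>k. \<forall>n\<ge>k. J n = J k"
    and "rideal (J0 :: 'a set)" "Q J0"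
  shows "\<exists>J. rideal J \<and> Q J \<and> (\<forall>K. rideal K \<longrightarrow> Q K \<longrightarrow> K \<subseteq> J \<longrightarrow> K = J)"
proof (rule ccontr)
  assume neg: "\<not> ?thesis"
  have "\<exists>K. (rideal K \<and> Q K) \<and> K \<subset> J" if "rideal J \<and> Q J" for J
    using neg that by blast
  then obtain g where g: "\<And>J. rideal J \<and> Q J \<Longrightarrow> (rideal (g J) \<and> Q (g J)) \<and> g J \<subset> J" by metis
  define f where "f n = (g ^^ n) J0" for n
  have fQ: "rideal (f n) \<and> Q (f n)" for n
    by (induction n) (use assms(2,3) g in \<open>auto simp: f_def\<close>)
  have lt: "f (Suc n) \<subset> f n" for n
    using g[OF fQ[of n]] by (simp add: f_def)
  have "\<exists>k. \<forall>n\<ge>k. f n = f k"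
    by (rule dcc) (use fQ lt in blast)+
  then obtain k where "\<And>n. n \<ge> k \<Longrightarrow> f n = f k" by blast
  from this[of "Suc k"] lt[of k] show False by simp
qed

text \<open>Let \<open>J\<close> be minimal among the ideals of finite colength. If \<mm> times
  \<open>J\<close> were smaller, a hyperplane of \<open>J\<close> modulo it would be a smaller ideal
  of finite colength; so \<open>J\<close> equals \<mm> times \<open>J\<close>. A nonzero
  \<open>J\<close> is excluded by a minimal ideal \<open>A\<close> whose product with
  \<open>J\<close> is nonzero: it has the form \<open>a\<close> times \<mm> for some
  \<open>a\<close> in \<open>A\<close>, and \<open>a = a * y\<close> with \<open>y\<close> in \<mm>
  forces \<open>a = 0\<close>.\<close>

lemma finite_length_local:
  fixes \<mm> :: "'a::comm_ring_1 set"
  assumes dcc: "\<And>J :: nat \<Rightarrow> 'a set. (\<And>n. rideal (J n)) \<Longrightarrow> (\<And>n. J (Suc n) \<subseteq> J n) \<Longrightarrow>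
      \<exists>k. \<forall>n\<ge>k. J n = J k"
    and m: "rideal \<mm>" "1 \<notin> \<mm>" and unit: "\<And>r. r \<notin> \<mm> \<Longrightarrow> \<exists>u. u * r = 1"
  shows "\<exists>n. has_length (*) n {0::'a} UNIV"
proof -
  interpret R: Modules.module "(*) :: 'a \<Rightarrow> 'a \<Rightarrow> 'a" by (rule ring_module)
  note R.scale_scale [simp del]
  have "\<exists>J. rideal J \<and> (\<exists>n. has_length (*) n J (UNIV :: 'a set)) \<and>
      (\<forall>K. rideal K \<longrightarrow> (\<exists>n. has_length (*) n K UNIV) \<longrightarrow> K \<subseteq> J \<longrightarrow> K = J)"
    proof (rule dcc_minimal[OF _ rideal_UNIV])
      show "\<exists>k. \<forall>n\<ge>k. J n = J k"
        if "\<And>n. rideal (J n)" "\<And>n. J (Suc n) \<subseteq> J n" for J :: "nat \<Rightarrow> 'a set"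
        using that by (rule dcc)
      show "\<exists>n. has_length (*) n (UNIV :: 'a set) UNIV" using has_length_same[OF rideal_UNIV] by blast
    qed
  then obtain J :: "'a set" where J: "rideal J" "\<exists>n. has_length (*) n J UNIV"
    and Jmin: "\<And>K. rideal K \<Longrightarrow> \<exists>n. has_length (*) n K UNIV \<Longrightarrow> K \<subseteq> J \<Longrightarrow> K = J"
    by blast
  define mJ where "mJ = R.span {y * z |y z. y \<in> \<mm> \<and> z \<in> J}"
  have mJ: "rideal mJ" "\<And>y z. y \<in> \<mm> \<Longrightarrow> z \<in> J \<Longrightarrow> y * z \<in> mJ"
    unfolding mJ_def by (auto intro: R.span_base)
  have mJ_J: "mJ \<subseteq> J"
    unfolding mJ_def by (rule R.span_minimal[OF _ J(1)]) (use rideal_mult[OF J(1)] in blast)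
  \<comment> \<open>Otherwise \<open>J\<close> would have a maximal submodule, contradicting minimality.\<close>
  have J_mJ: "J \<subseteq> mJ"
  proof (rule ccontr)
    assume "\<not> J \<subseteq> mJ"
    then obtain z where z: "z \<in> J" "z \<notin> mJ" by blast
    obtain K where K: "rideal K" "mJ \<subseteq> K" "K \<subseteq> J" "z \<notin> K"
      and Kmax: "\<And>L. rideal L \<Longrightarrow> K \<subset> L \<Longrightarrow> L \<subseteq> J \<Longrightarrow> z \<in> L"
      using exists_maximal_avoiding[OF mJ(1) mJ_J J(1) z(2)] by blast
    have top: "L = J" if L: "rideal L" "K \<subset> L" "L \<subseteq> J" for L
    proof -
      \<comment> \<open>\<open>z\<close> lies in \<open>K\<close> plus the multiples of
        \<open>w\<close>. Its coefficient at \<open>w\<close> is a unit because \<mm> times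
        \<open>w\<close> falls into \<open>K\<close>; so \<open>w\<close> is recovered from
        \<open>z\<close>, which every proper enlargement of \<open>K\<close> contains.\<close>
      have "w \<in> L" if w: "w \<in> J" for w
      proof (cases "w \<in> K")
        case False
        let ?Kw = "{x + y |x y. x \<in> K \<and> y \<in> range (\<lambda>r. r * w)}"
        have "range (\<lambda>r. r * w) = R.span {w}" by (simp add: R.span_singleton)
        then have rw: "rideal (range (\<lambda>r. r * w))" by (simp only: R.subspace_span)
        have "rideal ?Kw" by (rule module_subspace_sums[OF ring_module K(1) rw])
        moreover have "K \<subset> ?Kw"
        proof
          show "K \<subseteq> ?Kw"
          proof
            fix x assume "x \<in> K"
            then have "x + 0 * w \<in> ?Kw" by blast
            then show "x \<in> ?Kw" by simp
          qed
          have "0 + 1 * w \<in> ?Kw" using rideal_0[OF K(1)] by blast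
          then show "K \<noteq> ?Kw" using False by auto
        qed
        moreover have "?Kw \<subseteq> J"
          using K(3) rideal_add[OF J(1)] rideal_mult[OF J(1) w] by blast
        ultimately have "z \<in> ?Kw" by (rule Kmax)
        then obtain x r where xr: "z = x + r * w" "x \<in> K" by blast
        have "r \<notin> \<mm>"
        proof
          assume "r \<in> \<mm>"
          then have "r * w \<in> K" using mJ(2) w K(2) by blast
          then show False using xr K(4) rideal_add[OF K(1)] by blast
        qed
        then obtain u where u: "u * r = 1" using unit by blast
        have "z \<in> L" using Kmax L by blast
        have "w = u * (z - x)" using u unfolding xr(1) by (simp flip: mult.assoc)
        moreover have "z - x \<in> L"
          using \<open>z \<in> L\<close> xr(2) L(2) by (intro rideal_diff[OF L(1)]) auto
        ultimately show ?thesis using rideal_mult[OF L(1)] by simp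
      qed (use L in blast)
      then show ?thesis using L by blast
    qed
    have "has_length (*) 1 K J"
      unfolding has_length_def
    proof (intro conjI allI impI)
      have "K \<subset> J" using K z by blast
      then show "has_chain (*) 1 K J"
        using K(1) J(1) by (intro has_chainI[of 1 _ "\<lambda>i. if i = 0 then K else J"]) auto
      fix k assume k: "has_chain (*) k K J"
      show "k \<le> 1"
      proof (rule ccontr)
        assume "\<not> k \<le> 1"
        then have "has_chain (*) 2 K J" using has_chain_le[OF k, of 2] by simp
        then obtain N where N: "\<And>i. i \<le> 2 \<Longrightarrow> rideal (N i)" "\<And>i. i \<le> 2 \<Longrightarrow> K \<subseteq> N i"
          "\<And>i. i \<le> 2 \<Longrightarrow> N i \<subseteq> J" "\<And>i. i < 2 \<Longrightarrow> N i \<subset> N (Suc i)"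
          by (rule has_chainE) blast
        have "K \<subset> N 1" using N(2)[of 0] N(4)[of 0] by auto
        then have "N 1 = J" using top N(1,3)[of 1] by simp
        moreover have "N 1 \<subset> N 2" using N(4)[of 1] by (simp add: numeral_2_eq_2)
        ultimately show False using N(3)[of 2] by blast
      qed
    qed
    moreover obtain n where "has_length (*) n J UNIV" using J(2) by blast
    ultimately have "has_length (*) (1 + n) K UNIV"
      by (rule has_length_add[OF ring_module _ _ K(1) J(1) rideal_UNIV])
    then have "K = J" using Jmin[OF K(1)] K(3) by blast
    then show False using K(4) z(1) by blast
  qed
  have "J = {0}"
  proof (rule ccontr)
    assume "J \<noteq> {0}"
    then obtain z0 where z0: "z0 \<in> J" "z0 \<noteq> 0" using rideal_0[OF J(1)] by blast
    then have "1 * z0 \<noteq> 0" by simp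
    have "\<exists>A. rideal A \<and> (\<exists>a\<in>A. \<exists>z\<in>J. a * z \<noteq> 0) \<and>
        (\<forall>K. rideal K \<longrightarrow> (\<exists>a\<in>K. \<exists>z\<in>J. a * z \<noteq> 0) \<longrightarrow> K \<subseteq> A \<longrightarrow> K = A)"
      proof (rule dcc_minimal[OF _ rideal_UNIV])
      show "\<exists>k. \<forall>n\<ge>k. J n = J k"
        if "\<And>n. rideal (J n)" "\<And>n. J (Suc n) \<subseteq> J n" for J :: "nat \<Rightarrow> 'a set"
        using that by (rule dcc)
      show "\<exists>a\<in>UNIV. \<exists>z\<in>J. a * z \<noteq> 0" using z0(1) \<open>1 * z0 \<noteq> 0\<close> by blast
    qed
    then obtain A where A: "rideal A" "\<exists>a\<in>A. \<exists>z\<in>J. a * z \<noteq> 0"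
      and Amin: "\<And>K. rideal K \<Longrightarrow> \<exists>a\<in>K. \<exists>z\<in>J. a * z \<noteq> 0 \<Longrightarrow> K \<subseteq> A \<Longrightarrow> K = A"
      by blast
    obtain a z where az: "a \<in> A" "z \<in> J" "a * z \<noteq> 0" using A(2) by blast
    \<comment> \<open>\<open>a\<close> does not annihilate \<open>J\<close>, which is spanned by the
      products of \<mm> and \<open>J\<close>.\<close>
    have "\<exists>y\<in>\<mm>. \<exists>z'\<in>J. a * (y * z') \<noteq> 0"
    proof (rule ccontr)
      assume neg: "\<not> ?thesis"
      have "rideal {x. a * x = 0}"
      proof (rule ridealI)
        fix c x assume "x \<in> {x. a * x = 0}"
        then have "c * (a * x) = 0" by simp
        then show "c * x \<in> {x. a * x = 0}" by (simp add: mult.left_commute)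
      qed (simp_all add: distrib_left)
      then have "mJ \<subseteq> {x. a * x = 0}"
        unfolding mJ_def by (rule R.span_minimal[rotated]) (use neg in blast)
      then show False using J_mJ az by blast
    qed
    then obtain y z' where "y \<in> \<mm>" "z' \<in> J" "a * (y * z') \<noteq> 0" by blast
    then have yz: "y \<in> \<mm>" "z' \<in> J" "(a * y) * z' \<noteq> 0" by (simp_all add: mult.assoc)
    let ?aM = "(*) a ` \<mm>"
    \<comment> \<open>\<open>?aM\<close> lies in \<open>A\<close> and still has a nonzero product
      with \<open>J\<close>, so minimality applies.\<close>
    have "?aM = A"
    proof (rule Amin)
      show "rideal ?aM"
      proof (rule ridealI)
        show "0 \<in> ?aM" using rideal_0[OF m(1)] by (metis image_eqI mult_zero_right)
        show "x + x' \<in> ?aM" if xx: "x \<in> ?aM" "x' \<in> ?aM" for x x'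
        proof -
          obtain p q where "x = a * p" "x' = a * q" "p \<in> \<mm>" "q \<in> \<mm>" using xx by blast
          then have "x + x' = a * (p + q)" "p + q \<in> \<mm>"
            using rideal_add[OF m(1)] by (auto simp: distrib_left)
          then show ?thesis by blast
        qed
        show "c * x \<in> ?aM" if xi: "x \<in> ?aM" for c x
        proof -
          obtain p where "x = a * p" "p \<in> \<mm>" using xi by blast
          then have "c * x = a * (c * p)" "c * p \<in> \<mm>"
            using rideal_mult[OF m(1)] by (auto simp: mult.left_commute)
          then show ?thesis by blast
        qed
      qed
      show "\<exists>b\<in>?aM. \<exists>z\<in>J. b * z \<noteq> 0" using yz by blast
      show "?aM \<subseteq> A"
      proof
        fix x assume "x \<in> ?aM"
        then obtain p where "x = p * a" by (auto simp: mult.commute)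
        then show "x \<in> A" using rideal_mult[OF A(1) az(1)] by simp
      qed
    qed
    then obtain y' where y': "y' \<in> \<mm>" "a = a * y'" using az(1) by blast
    have "1 - y' \<notin> \<mm>"
    proof
      assume "1 - y' \<in> \<mm>"
      then have "(1 - y') + y' \<in> \<mm>" by (rule rideal_add[OF m(1) _ y'(1)])
      then show False using m(2) by simp
    qed
    then obtain u where "u * (1 - y') = 1" using unit by blast
    then have "a = u * ((1 - y') * a)" by (simp flip: mult.assoc)
    also have "(1 - y') * a = a - a * y'" by (simp only: left_diff_distrib mult_1 mult.commute[of y'])
    also have "a - a * y' = 0" using y'(2) by simp
    finally show False using az(3) by simp
  qed
  then show ?thesis using J(2) by simp
qed

section \<open>Ideals and lengths in the record-based algebra library\<close>

lemma m_inv_additive: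
  assumes "monoid.mult G = (+)" "one G = (0 :: 'b::ab_group_add)" "- x \<in> carrier G"
  shows "m_inv G x = - x"
  unfolding m_inv_def
  by (rule the_equality) (use assms in \<open>auto simp: eq_neg_iff_add_eq_0 add.commute\<close>)

lemma subgroup_additive_iff:
  assumes "monoid.mult G = (+)" "one G = (0 :: 'b::ab_group_add)" "H \<subseteq> carrier G"
    "\<And>x. x \<in> carrier G \<Longrightarrow> - x \<in> carrier G"
  shows "subgroup H G \<longleftrightarrow> 0 \<in> H \<and> (\<forall>x\<in>H. \<forall>y\<in>H. x + y \<in> H) \<and> (\<forall>x\<in>H. - x \<in> H)"
proof -
  have inv: "m_inv G x = - x" if "x \<in> H" for x
    using m_inv_additive[OF assms(1,2)] assms(3,4) that by blast
  show ?thesis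
    unfolding subgroup_def assms(1,2) using inv assms(3) by auto
qed

lemma rideal_neg: "rideal J \<Longrightarrow> x \<in> J \<Longrightarrow> - x \<in> J"
  using rideal_mult[of J x "- 1"] by simp

lemma ideal_type_algebra_iff:
  "ideal J (ring_of_type_algebra :: 'a::comm_ring_1 ring) \<longleftrightarrow> rideal J"
proof
  let ?R = "ring_of_type_algebra :: 'a ring"
  assume "ideal J ?R"
  then interpret ideal J ?R .
  have "0 \<in> J" using additive_subgroup.zero_closed[OF is_additive_subgroup] by (simp add: ring_of_type_algebra_def)
  moreover have "x + y \<in> J" if "x \<in> J" "y \<in> J" for x y
    using additive_subgroup.a_closed[OF is_additive_subgroup that] by (simp add: ring_of_type_algebra_def)
  moreover have "c * x \<in> J" if "x \<in> J" for c x
    using I_l_closed[OF that, of c] by (simp add: ring_of_type_algebra_def)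
  ultimately show "rideal J" by (intro ridealI)
next
  assume J: "rideal J"
  show "ideal J (ring_of_type_algebra :: 'a ring)"
  proof (rule idealI)
    show "ring (ring_of_type_algebra :: 'a ring)" by (rule ring_from_type_algebra)
    show "subgroup J (add_monoid (ring_of_type_algebra :: 'a ring))"
      by (subst subgroup_additive_iff)
        (simp_all add: ring_of_type_algebra_def fun_eq_iff rideal_0[OF J] rideal_add[OF J] rideal_neg[OF J])
    show mult: "x \<otimes>\<^bsub>ring_of_type_algebra\<^esub> a \<in> J" if "a \<in> J" for a x
      using rideal_mult[OF J that] by (simp add: ring_of_type_algebra_def)
    show "a \<otimes>\<^bsub>ring_of_type_algebra\<^esub> x \<in> J" if "a \<in> J" for a x
      using mult[OF that, of x] by (simp add: ring_of_type_algebra_def mult.commute)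
  qed
qed

lemma artinian_dcc:
  fixes J :: "nat \<Rightarrow> 'a::comm_ring_1 set"
  assumes "artinian_ring (ring_of_type_algebra :: 'a ring)"
    "\<And>n. rideal (J n)" "\<And>n. J (Suc n) \<subseteq> J n"
  shows "\<exists>k. \<forall>n\<ge>k. J n = J k"
  using assms unfolding artinian_ring_def ideal_type_algebra_iff by simp

text \<open>A non-unit lies in some maximal ideal, and there is only one.\<close>

lemma local_ring_maximal:
  assumes "local_ring (ring_of_type_algebra :: 'a::comm_ring_1 ring) \<mm>"
  shows "rideal \<mm>" "1 \<notin> \<mm>" "\<And>r. r \<notin> \<mm> \<Longrightarrow> \<exists>u. u * r = 1"
proof -
  let ?R = "ring_of_type_algebra :: 'a ring"
  have max: "maximalideal \<mm> ?R" and uniq: "\<And>J. maximalideal J ?R \<Longrightarrow> J = \<mm>"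
    using assms unfolding local_ring_def by auto
  have car: "carrier ?R = UNIV" by (simp add: ring_of_type_algebra_def)
  show m: "rideal \<mm>" using maximalideal.axioms(1)[OF max] ideal_type_algebra_iff by blast
  have ne: "\<mm> \<noteq> UNIV" using maximalideal.I_notcarr[OF max] car by simp
  have one: "J = UNIV" if "rideal J" "1 \<in> J" for J :: "'a set"
    using rideal_mult[OF that] by auto
  show "1 \<notin> \<mm>" using one[OF m] ne by blast
  show "\<exists>u. u * r = 1" if r: "r \<notin> \<mm>" for r
  proof (rule ccontr)
    assume neg: "\<not> (\<exists>u. u * r = 1)"
    let ?A = "range (\<lambda>u. u * r)"
    have "?A = module.span (*) {r}"
      by (rule Modules.module.span_singleton[OF ring_module, symmetric])
    then have A: "rideal ?A" using Modules.module.subspace_span[OF ring_module, of "{r}"] by simp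
    have "1 \<notin> ?A" using neg by force
    then obtain J where J: "rideal J" "?A \<subseteq> J" "1 \<notin> J"
      and Jmax: "\<And>K. rideal K \<Longrightarrow> J \<subset> K \<Longrightarrow> 1 \<in> K"
      using exists_maximal_avoiding[OF A subset_UNIV rideal_UNIV] by (metis subset_UNIV)
    have "maximalideal J ?R"
    proof (rule maximalidealI)
      show "ideal J ?R" using J ideal_type_algebra_iff by blast
      show "carrier ?R \<noteq> J" using J(3) car by auto
      show "K = J \<or> K = carrier ?R" if K: "ideal K ?R" "J \<subseteq> K" "K \<subseteq> carrier ?R" for K
      proof (cases "K = J")
        case False
        have "rideal K" using K(1) ideal_type_algebra_iff by blast
        moreover from this False K(2) have "1 \<in> K" using Jmax by blast
        ultimately show ?thesis using one car by simp
      qed simp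
    qed
    then have "J = \<mm>" by (rule uniq)
    moreover have "1 * r \<in> J" using J(2) by blast
    ultimately show False using r by simp
  qed
qed

section \<open>Lengths of module records\<close>

lemma module_length_self:
  "module_length (ring_of_type_algebra :: 'a::comm_ring_1 ring) (self_module ring_of_type_algebra) =
     Sup {enat k |k. has_chain ((*) :: 'a \<Rightarrow> 'a \<Rightarrow> 'a) k {0} UNIV}"
proof -
  let ?R = "ring_of_type_algebra :: 'a ring"
  have sub: "submodule H ?R (self_module ?R) \<longleftrightarrow> rideal H" for H
  proof -
    have "subgroup H (add_monoid (self_module ?R)) \<longleftrightarrow>
        0 \<in> H \<and> (\<forall>x\<in>H. \<forall>y\<in>H. x + y \<in> H) \<and> (\<forall>x\<in>H. - x \<in> H)"
      by (rule subgroup_additive_iff) (simp_all add: self_module_def ring_of_type_algebra_def fun_eq_iff)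
    moreover have "submodule_axioms H ?R (self_module ?R) \<longleftrightarrow> (\<forall>c. \<forall>x\<in>H. c * x \<in> H)"
      unfolding submodule_axioms_def by (auto simp: self_module_def ring_of_type_algebra_def)
    moreover have "rideal H \<Longrightarrow> \<forall>x\<in>H. - x \<in> H" using rideal_neg by blast
    ultimately show ?thesis unfolding submodule_def rideal_iff by blast
  qed
  have "has_chain ((*) :: 'a \<Rightarrow> 'a \<Rightarrow> 'a) k {0} UNIV \<longleftrightarrow>
    (\<exists>N. (\<forall>i\<le>k. submodule (N i) ?R (self_module ?R)) \<and> (\<forall>i<k. N i \<subset> N (Suc i)))" for k
  proof
    assume "has_chain ((*) :: 'a \<Rightarrow> _) k {0} UNIV"
    then obtain N :: "nat \<Rightarrow> 'a set" where N: "\<And>i. i \<le> k \<Longrightarrow> rideal (N i)" "\<And>i. i \<le> k \<Longrightarrow> {0} \<subseteq> N i"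
      "\<And>i. i \<le> k \<Longrightarrow> N i \<subseteq> UNIV" "\<And>i. i < k \<Longrightarrow> N i \<subset> N (Suc i)"
      by (rule has_chainE) blast
    show "\<exists>N. (\<forall>i\<le>k. submodule (N i) ?R (self_module ?R)) \<and> (\<forall>i<k. N i \<subset> N (Suc i))"
      unfolding sub using N by (intro exI[of _ N]) simp
  next
    assume "\<exists>N. (\<forall>i\<le>k. submodule (N i) ?R (self_module ?R)) \<and> (\<forall>i<k. N i \<subset> N (Suc i))"
    then obtain N :: "nat \<Rightarrow> 'a set" where N: "(\<forall>i\<le>k. rideal (N i)) \<and> (\<forall>i<k. N i \<subset> N (Suc i))" unfolding sub ..
    show "has_chain ((*) :: 'a \<Rightarrow> _) k {0} UNIV"
      by (rule has_chainI[of k _ N]) (use N in \<open>simp_all add: rideal_0\<close>)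
  qed
  then show ?thesis unfolding module_length_def by simp
qed

text \<open>\<open>M\<close> is specified through its additive and scalar structure alone: in the
  application it is a graded piece of the polynomial ring, which in general is not closed under
  multiplication.\<close>

locale quotient_data =
  fixes s :: "'a::comm_ring_1 \<Rightarrow> 'b::ab_group_add \<Rightarrow> 'b" and N C :: "'b set"
    and M :: "('a, 'b) module"
  assumes s: "Modules.module s" and N: "module.subspace s N" and C: "module.subspace s C"
    and NC: "N \<subseteq> C"
    and M: "carrier M = C" "ring.zero M = 0" "ring.add M = (+)" "module.smult M = s"
begin

interpretation Modules.module s by (rule s)

definition coset :: "'b \<Rightarrow> 'b set" where "coset x = (\<lambda>h. h + x) ` N"

abbreviation "Q \<equiv> quotient_module M N"

lemma coset_self: "x \<in> coset x"
  unfolding coset_def using subspace_0[OF N] by (metis add_0 image_eqI)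

lemma coset_memD: "y \<in> coset x \<Longrightarrow> y - x \<in> N"
  unfolding coset_def by auto

lemma coset_memI: "y - x \<in> N \<Longrightarrow> y \<in> coset x"
  unfolding coset_def by (metis diff_add_cancel image_eqI)

lemma coset_eqI:
  assumes "y - x \<in> N"
  shows "coset y = coset x"
proof (intro Set.set_eqI iffI)
  fix z assume "z \<in> coset y"
  then have "(z - y) + (y - x) \<in> N" using coset_memD assms subspace_add[OF N] by blast
  then show "z \<in> coset x" by (intro coset_memI) simp
next
  fix z assume "z \<in> coset x"
  then have "(z - x) - (y - x) \<in> N" using coset_memD assms subspace_diff[OF N] by blast
  then show "z \<in> coset y" by (intro coset_memI) simp
qed

lemma coset_0: "coset 0 = N"
  by (simp add: coset_def)

lemma r_coset: "N +>\<^bsub>M\<^esub> x = coset x"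
  unfolding a_r_coset_def r_coset_def coset_def by (auto simp: M)

lemma Q_carrier: "carrier Q = coset ` C"
proof -
  have "a_rcosets\<^bsub>M\<^esub> N = coset ` C"
    unfolding A_RCOSETS_def RCOSETS_def using r_coset unfolding a_r_coset_def by (auto simp: M)
  then show ?thesis by (simp add: quotient_module_def)
qed

lemma Q_add: "coset x \<oplus>\<^bsub>Q\<^esub> coset y = coset (x + y)"
proof -
  have "coset x <+>\<^bsub>M\<^esub> coset y = {p + q |p q. p \<in> coset x \<and> q \<in> coset y}"
    unfolding set_add_def set_mult_def by (auto simp: M)
  also have "\<dots> = coset (x + y)"
  proof (intro Set.set_eqI iffI)
    fix z assume "z \<in> {p + q |p q. p \<in> coset x \<and> q \<in> coset y}"
    then obtain p q where z: "z = p + q" "p \<in> coset x" "q \<in> coset y" by blast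
    then have "(p - x) + (q - y) \<in> N" using coset_memD subspace_add[OF N] by blast
    then show "z \<in> coset (x + y)" by (intro coset_memI) (simp add: z algebra_simps)
  next
    fix z assume "z \<in> coset (x + y)"
    then have "z - (x + y) \<in> N" by (rule coset_memD)
    then have "z - y - x \<in> N" by (simp add: diff_diff_eq add.commute)
    then have "z - y \<in> coset x" by (rule coset_memI)
    moreover have "z = (z - y) + y" by simp
    ultimately show "z \<in> {p + q |p q. p \<in> coset x \<and> q \<in> coset y}" using coset_self by blast
  qed
  finally show ?thesis by (simp add: quotient_module_def)
qed

lemma Q_smult: "a \<odot>\<^bsub>Q\<^esub> coset x = coset (s a x)"
proof -
  have "coset (s a z) = coset (s a x)" if "z \<in> coset x" for z
  proof (rule coset_eqI)
    have "s a (z - x) \<in> N" using coset_memD[OF that] by (rule subspace_scale[OF N])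
    then show "s a z - s a x \<in> N" by (simp add: scale_right_diff_distrib)
  qed
  then have "(\<Union>z\<in>coset x. coset (s a z)) = coset (s a x)" using coset_self[of x] by blast
  then show ?thesis by (simp add: quotient_module_def r_coset M)
qed

lemma Q_zero: "\<zero>\<^bsub>Q\<^esub> = N"
  by (simp add: quotient_module_def)

lemma submodule_coset_image:
  assumes "subspace U" "N \<subseteq> U" "U \<subseteq> C"
  shows "submodule (coset ` U) (ring_of_type_algebra :: 'a ring) Q"
proof -
  \<comment> \<open>Computed from the definite description itself, so that the quotient need not be
    shown to be a group first.\<close>
  have inv: "m_inv (add_monoid Q) (coset x) = coset (- x)" if x: "x \<in> U" for x
    unfolding m_inv_def
  proof (rule the_equality)
    have "- x \<in> C" using x assms(3) subspace_neg[OF C] by blast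
    then show "coset (- x) \<in> carrier (add_monoid Q) \<and>
        coset x \<otimes>\<^bsub>add_monoid Q\<^esub> coset (- x) = \<one>\<^bsub>add_monoid Q\<^esub> \<and>
        coset (- x) \<otimes>\<^bsub>add_monoid Q\<^esub> coset x = \<one>\<^bsub>add_monoid Q\<^esub>"
      by (simp add: Q_carrier Q_add Q_zero coset_0)
  next
    fix y assume y: "y \<in> carrier (add_monoid Q) \<and>
        coset x \<otimes>\<^bsub>add_monoid Q\<^esub> y = \<one>\<^bsub>add_monoid Q\<^esub> \<and> y \<otimes>\<^bsub>add_monoid Q\<^esub> coset x = \<one>\<^bsub>add_monoid Q\<^esub>"
    then obtain z where z: "y = coset z" using Q_carrier by auto
    with y have "coset (z + x) = N" by (simp add: Q_add Q_zero)
    then have "z - - x \<in> N" using coset_self[of "z + x"] by simp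
    then show "y = coset (- x)" unfolding z by (rule coset_eqI)
  qed
  show ?thesis
    unfolding submodule_def
  proof
    show "subgroup (coset ` U) (add_monoid Q)"
    proof (rule subgroup.intro)
      show "coset ` U \<subseteq> carrier (add_monoid Q)" using assms(3) by (auto simp: Q_carrier)
      show "x \<otimes>\<^bsub>add_monoid Q\<^esub> y \<in> coset ` U" if "x \<in> coset ` U" "y \<in> coset ` U" for x y
        using that subspace_add[OF assms(1)] by (auto simp: Q_add)
      show "\<one>\<^bsub>add_monoid Q\<^esub> \<in> coset ` U"
        using subspace_0[OF assms(1)] coset_0 by (auto simp: Q_zero image_iff)
      show "m_inv (add_monoid Q) x \<in> coset ` U" if xi: "x \<in> coset ` U" for x
      proof -
        obtain u where u: "u \<in> U" "x = coset u" using xi by blast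
        have "coset (- u) \<in> coset ` U" using subspace_neg[OF assms(1) u(1)] by blast
        then show ?thesis unfolding u(2) inv[OF u(1)] .
      qed
    qed
    show "submodule_axioms (coset ` U) (ring_of_type_algebra :: 'a ring) Q"
      unfolding submodule_axioms_def using subspace_scale[OF assms(1)] by (auto simp: Q_smult)
  qed
qed

lemma Union_coset_image:
  assumes "subspace U" "N \<subseteq> U"
  shows "\<Union> (coset ` U) = U"
proof
  show "U \<subseteq> \<Union> (coset ` U)" using coset_self by blast
  show "\<Union> (coset ` U) \<subseteq> U"
  proof
    fix z assume "z \<in> \<Union> (coset ` U)"
    then obtain x where x: "x \<in> U" "z \<in> coset x" by blast
    then have "(z - x) + x \<in> U"
      using coset_memD assms(2) subspace_add[OF assms(1)] by blast
    then show "z \<in> U" by simp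
  qed
qed

lemma submodule_Union:
  assumes H: "submodule H (ring_of_type_algebra :: 'a ring) Q"
  shows "H = coset ` (\<Union>H)" "subspace (\<Union>H)" "N \<subseteq> \<Union>H" "\<Union>H \<subseteq> C"
proof -
  have sg: "subgroup H (add_monoid Q)" and sm: "submodule_axioms H (ring_of_type_algebra :: 'a ring) Q"
    using H unfolding submodule_def by auto
  have sub: "H \<subseteq> coset ` C" using subgroup.subset[OF sg] Q_carrier by simp
  have mem: "h = coset x" if hx: "h \<in> H" "x \<in> h" for h x
  proof -
    obtain y where "h = coset y" using hx(1) sub by blast
    then show ?thesis using coset_eqI[OF coset_memD] hx(2) by blast
  qed
  show "H = coset ` (\<Union>H)" 
  proof (intro Set.set_eqI iffI)
    fix h assume h: "h \<in> H"
    then obtain y where "h = coset y" using sub by blast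
    then have "y \<in> \<Union>H" "h = coset y" using h coset_self by blast+
    then show "h \<in> coset ` (\<Union>H)" by blast
  next
    fix h assume "h \<in> coset ` (\<Union>H)"
    then obtain x h' where x: "h = coset x" "x \<in> h'" "h' \<in> H" by blast
    then show "h \<in> H" using mem[OF x(3,2)] by simp
  qed
  have in_iff: "coset x \<in> H" if "x \<in> \<Union>H" for x using that mem by blast
  have NH: "N \<in> H" using subgroup.one_closed[OF sg] by (simp add: Q_zero)
  then show "N \<subseteq> \<Union>H" by blast
  show "\<Union>H \<subseteq> C"
  proof
    fix z assume "z \<in> \<Union>H"
    then obtain y where y: "y \<in> C" "z \<in> coset y" using sub by blast
    then have "(z - y) + y \<in> C" using coset_memD NC subspace_add[OF C] by blast
    then show "z \<in> C" by simp
  qed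
  show "subspace (\<Union>H)"
  proof (rule subspaceI)
    show "0 \<in> \<Union>H" using NH subspace_0[OF N] by blast
    show "x + y \<in> \<Union>H" if "x \<in> \<Union>H" "y \<in> \<Union>H" for x y
    proof -
      have "coset (x + y) \<in> H"
        using subgroup.m_closed[OF sg in_iff[OF that(1)] in_iff[OF that(2)]] by (simp add: Q_add)
      then show ?thesis using coset_self by blast
    qed
    show "s c x \<in> \<Union>H" if "x \<in> \<Union>H" for c x
    proof -
      have "c \<odot>\<^bsub>Q\<^esub> coset x \<in> H"
        using sm in_iff[OF that] unfolding submodule_axioms_def by (simp add: ring_of_type_algebra_def)
      then have "coset (s c x) \<in> H" by (simp add: Q_smult)
      then show ?thesis using coset_self by blast
    qed
  qed
qed

text \<open>The correspondence theorem: taking cosets and taking unions are mutually inverse and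
  monotone, so chains of submodules of the quotient match chains between \<open>N\<close> and
  \<open>C\<close>.\<close>

lemma module_length_quotient:
  "module_length (ring_of_type_algebra :: 'a ring) Q = Sup {enat k |k. has_chain s k N C}"
proof -
  let ?R = "ring_of_type_algebra :: 'a ring"
  have "(\<exists>H. (\<forall>i\<le>k. submodule (H i) ?R Q) \<and> (\<forall>i<k. H i \<subset> H (Suc i))) \<longleftrightarrow> has_chain s k N C" for k
  proof
    assume "\<exists>H. (\<forall>i\<le>k. submodule (H i) ?R Q) \<and> (\<forall>i<k. H i \<subset> H (Suc i))"
    then obtain H where H: "\<And>i. i \<le> k \<Longrightarrow> submodule (H i) ?R Q" "\<And>i. i < k \<Longrightarrow> H i \<subset> H (Suc i)"
      by auto
    show "has_chain s k N C"
    proof (rule has_chainI[of k s "\<lambda>i. \<Union>(H i)"])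
      show "\<Union>(H i) \<subset> \<Union>(H (Suc i))" if "i < k" for i
      proof -
        have "H i = coset ` \<Union>(H i)" "H (Suc i) = coset ` \<Union>(H (Suc i))"
          using submodule_Union(1)[OF H(1)] that by simp_all
        then have "\<Union>(H i) \<noteq> \<Union>(H (Suc i))" using H(2)[OF that] by (metis less_irrefl)
        then show ?thesis using H(2)[OF that] by blast
      qed
    qed (use submodule_Union(2-4)[OF H(1)] in simp_all)
  next
    assume "has_chain s k N C"
    then obtain U where U: "\<And>i. i \<le> k \<Longrightarrow> subspace (U i)" "\<And>i. i \<le> k \<Longrightarrow> N \<subseteq> U i"
      "\<And>i. i \<le> k \<Longrightarrow> U i \<subseteq> C" "\<And>i. i < k \<Longrightarrow> U i \<subset> U (Suc i)"
      by (rule has_chainE) blast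
    have "coset ` U i \<subset> coset ` U (Suc i)" if "i < k" for i
    proof -
      have "\<Union> (coset ` U i) = U i" "\<Union> (coset ` U (Suc i)) = U (Suc i)"
        using Union_coset_image U(1,2) that by simp_all
      then have "coset ` U i \<noteq> coset ` U (Suc i)" using U(4)[OF that] by (metis less_irrefl)
      then show ?thesis using U(4)[OF that] by blast
    qed
    moreover have "submodule (coset ` U i) ?R Q" if "i \<le> k" for i
      using submodule_coset_image U(1-3)[OF that] by blast
    ultimately show "\<exists>H. (\<forall>i\<le>k. submodule (H i) ?R Q) \<and> (\<forall>i<k. H i \<subset> H (Suc i))"
      by (intro exI[of _ "\<lambda>i. coset ` U i"]) simp
  qed
  then show ?thesis unfolding module_length_def by simp
qed

end

section \<open>The leading coefficient filtration\<close>

definition mscale :: "'a::comm_ring_1 \<Rightarrow> 'a mpoly \<Rightarrow> 'a mpoly" where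
  "mscale a p = Poly_Mapping.single 0 a * p"

lemma mscale_module: "Modules.module (mscale :: 'a::comm_ring_1 \<Rightarrow> _)"
proof (rule Modules.module.intro)
  fix a b :: 'a and p q :: "'a mpoly"
  show "mscale a (p + q) = mscale a p + mscale a q" by (simp add: mscale_def distrib_left)
  show "mscale (a + b) p = mscale a p + mscale b p" by (simp add: mscale_def single_add distrib_right)
  show "mscale a (mscale b p) = mscale (a * b) p"
    by (simp add: mscale_def mult.assoc[symmetric] mult_single)
  show "mscale 1 p = p" by (simp add: mscale_def)
qed

lemma lookup_mscale: "Poly_Mapping.lookup (mscale a p) \<alpha> = a * Poly_Mapping.lookup p \<alpha>"
proof (cases "Poly_Mapping.lookup p \<alpha> = 0")
  case True
  then show ?thesis unfolding mscale_def mult_map_scale_conv_mult[symmetric] by (simp add: Poly_Mapping.map.rep_eq)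
next
  case False
  then show ?thesis unfolding mscale_def mult_map_scale_conv_mult[symmetric] by (simp add: Poly_Mapping.map.rep_eq when_def)
qed

lemma mscale_single: "mscale a (Poly_Mapping.single \<alpha> c) = Poly_Mapping.single \<alpha> (a * c)"
  by (simp add: mscale_def mult_single)

lemma keys_mscale: "Poly_Mapping.keys (mscale a p) \<subseteq> Poly_Mapping.keys p"
  by (auto simp: in_keys_iff lookup_mscale)

definition supported :: "(nat \<Rightarrow>\<^sub>0 nat) set \<Rightarrow> 'a::comm_ring_1 mpoly set" where
  "supported T = {p. Poly_Mapping.keys p \<subseteq> T}"

lemma supported_subspace: "module.subspace mscale (supported T)"
proof (rule Modules.module.subspaceI[OF mscale_module])
  show "0 \<in> supported T" by (simp add: supported_def)
  show "p + q \<in> supported T" if "p \<in> supported T" "q \<in> supported T" for p q :: "'a mpoly"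
    using that keys_add[of p q] unfolding supported_def by blast
  show "mscale c p \<in> supported T" if "p \<in> supported T" for c and p :: "'a mpoly"
    using that keys_mscale[of c p] unfolding supported_def by blast
qed

text \<open>Monomials are compared in the linear order on exponent vectors. \<open>a = 0\<close> is
  allowed and the remainder is confined to \<open>T\<close>, so that this becomes the colon ideal of
  one step of the filtration.\<close>

definition lead_coeffs :: "'a::comm_ring_1 mpoly set \<Rightarrow> (nat \<Rightarrow>\<^sub>0 nat) set \<Rightarrow> (nat \<Rightarrow>\<^sub>0 nat) \<Rightarrow> 'a set" where
  "lead_coeffs W T \<alpha> = {a. \<exists>w\<in>W. w - Poly_Mapping.single \<alpha> a \<in> supported {\<beta>\<in>T. \<beta> < \<alpha>}}"

text \<open>Monomials are added in increasing order. Each step adjoins one monomial to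
  \<open>W\<close> plus the span of the smaller ones, so it is a cyclic extension, and its colon
  ideal is the ideal of leading coefficients.\<close>

lemma has_length_filtration:
  fixes W :: "'a::comm_ring_1 mpoly set"
  assumes W: "module.subspace mscale W" and "finite T"
    and "\<And>\<alpha>. \<alpha> \<in> T \<Longrightarrow> has_length (*) (h \<alpha>) (lead_coeffs W T \<alpha>) UNIV"
  shows "has_length mscale (\<Sum>\<alpha>\<in>T. h \<alpha>) W {w + p |w p. w \<in> W \<and> p \<in> supported T}"
  using assms(2,3)
proof (induction T rule: finite_linorder_max_induct)
  case empty
  have "{w + p |w p. w \<in> W \<and> p \<in> supported {}} = W" by (simp add: supported_def)
  then show ?case using has_length_same[OF W] by simp
next
  case (insert b T)
  interpret Modules.module mscale by (rule mscale_module)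
  let ?F = "{w + p |w p. w \<in> W \<and> p \<in> supported T}"
  let ?F' = "{w + p |w p. w \<in> W \<and> p \<in> supported (insert b T)}"
  have b: "b \<notin> T" using insert.hyps(2) by blast
  have F: "subspace ?F" by (rule module_subspace_sums[OF mscale_module W supported_subspace])
  have F': "subspace ?F'" by (rule module_subspace_sums[OF mscale_module W supported_subspace])
  have len: "has_length mscale (\<Sum>\<alpha>\<in>T. h \<alpha>) W ?F"
  proof (rule insert.IH)
    fix \<alpha> assume \<alpha>: "\<alpha> \<in> T"
    \<comment> \<open>The new monomial is the largest, so earlier leading coefficients do not see
      it.\<close>
    then have "{\<beta>\<in>insert b T. \<beta> < \<alpha>} = {\<beta>\<in>T. \<beta> < \<alpha>}" using insert.hyps(2) by auto
    then have "lead_coeffs W (insert b T) \<alpha> = lead_coeffs W T \<alpha>" unfolding lead_coeffs_def by simp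
    then show "has_length (*) (h \<alpha>) (lead_coeffs W T \<alpha>) UNIV" using insert.prems[of \<alpha>] \<alpha> by simp
  qed
  have colon: "{r. mscale r (Poly_Mapping.single b 1) \<in> ?F} = lead_coeffs W (insert b T) b"
  proof -
    have T: "{\<beta>\<in>insert b T. \<beta> < b} = T" using insert.hyps(2) by auto
    have "Poly_Mapping.single b r \<in> ?F \<longleftrightarrow> (\<exists>w\<in>W. w - Poly_Mapping.single b r \<in> supported T)" for r
    proof
      assume "Poly_Mapping.single b r \<in> ?F"
      then obtain w p where wp: "Poly_Mapping.single b r = w + p" "w \<in> W" "p \<in> supported T" by blast
      then have "w - Poly_Mapping.single b r = - p" by simp
      then have "w - Poly_Mapping.single b r \<in> supported T"
        using subspace_neg[OF supported_subspace wp(3)] by (simp only:)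
      then show "\<exists>w\<in>W. w - Poly_Mapping.single b r \<in> supported T" using wp(2) by blast
    next
      assume "\<exists>w\<in>W. w - Poly_Mapping.single b r \<in> supported T"
      then obtain w where w: "w \<in> W" "w - Poly_Mapping.single b r \<in> supported T" by blast
      have "Poly_Mapping.single b r = w + - (w - Poly_Mapping.single b r)" by simp
      then show "Poly_Mapping.single b r \<in> ?F"
        using w(1) subspace_neg[OF supported_subspace w(2)] by blast
    qed
    then show ?thesis unfolding lead_coeffs_def T mscale_single by simp
  qed
  have "has_length (*) (h b) {r. mscale r (Poly_Mapping.single b 1) \<in> ?F} UNIV"
    unfolding colon by (rule insert.prems) simp
  from has_length_cyclic[OF mscale_module F this]
  have "has_length mscale (h b) ?F {a + mscale r (Poly_Mapping.single b 1) |a r. a \<in> ?F}" .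
  moreover have "{a + mscale r (Poly_Mapping.single b 1) |a r. a \<in> ?F} = ?F'"
  proof (intro Set.set_eqI iffI)
    fix x assume "x \<in> {a + mscale r (Poly_Mapping.single b 1) |a r. a \<in> ?F}"
    then obtain w p r where x: "x = w + p + Poly_Mapping.single b r" "w \<in> W" "p \<in> supported T"
      by (auto simp: mscale_single)
    have "p \<in> supported (insert b T)" using x(3) unfolding supported_def by blast
    moreover have "Poly_Mapping.single b r \<in> supported (insert b T)" unfolding supported_def by simp
    ultimately have "p + Poly_Mapping.single b r \<in> supported (insert b T)"
      by (rule subspace_add[OF supported_subspace])
    moreover have "x = w + (p + Poly_Mapping.single b r)" by (simp add: x(1) add.assoc)
    ultimately show "x \<in> ?F'" using x(2) by blast
  next
    fix x assume "x \<in> ?F'"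
    then obtain w p where x: "x = w + p" "w \<in> W" "p \<in> supported (insert b T)" by blast
    let ?c = "Poly_Mapping.lookup p b"
    have "p - Poly_Mapping.single b ?c \<in> supported T"
      using x(3) unfolding supported_def
      by (auto simp: in_keys_iff lookup_minus lookup_single when_def split: if_splits)
    then have "w + (p - Poly_Mapping.single b ?c) \<in> ?F" using x(2) by blast
    moreover have "x = (w + (p - Poly_Mapping.single b ?c)) + mscale ?c (Poly_Mapping.single b 1)"
      by (simp add: x(1) mscale_single)
    ultimately show "x \<in> {a + mscale r (Poly_Mapping.single b 1) |a r. a \<in> ?F}" by blast
  qed
  ultimately have "has_length mscale ((\<Sum>\<alpha>\<in>T. h \<alpha>) + h b) W ?F'"
    using has_length_add[OF mscale_module len _ W F F'] by simp
  then show ?case using insert.hyps(1) b by (simp add: add.commute)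
qed

section \<open>Graded pieces and leading coefficient ideals\<close>

lemma graded_part_eq: "graded_part b n = supported {\<alpha> \<in> monoms {..<b}. monom_degree \<alpha> = n}"
  by (auto simp: graded_part_def mpoly_ring_def supported_def monoms_def)

lemma carrier_mpoly_ring: "carrier (mpoly_ring b) = supported (monoms {..<b})"
  by (auto simp: mpoly_ring_def supported_def monoms_def)

lemma mpoly_ring_simps:
  "monoid.mult (mpoly_ring b) = (*)" "monoid.one (mpoly_ring b) = 1" "ring.zero (mpoly_ring b) = 0"
  "ring.add (mpoly_ring b) = (+)" "module.smult (mpoly_ring b) = mscale"
  by (simp_all add: mpoly_ring_def mscale_def fun_eq_iff)

definition lead_ideal :: "nat \<Rightarrow> 'a::comm_ring_1 mpoly set \<Rightarrow> (nat \<Rightarrow>\<^sub>0 nat) \<Rightarrow> 'a set" where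
  "lead_ideal b I \<alpha> = lead_coeffs (I \<inter> graded_part b (monom_degree \<alpha>))
     {\<beta> \<in> monoms {..<b}. monom_degree \<beta> = monom_degree \<alpha>} \<alpha>"

lemma single_in_carrier: "\<delta> \<in> monoms {..<b} \<Longrightarrow> Poly_Mapping.single \<delta> c \<in> carrier (mpoly_ring b)"
  unfolding carrier_mpoly_ring supported_def by simp

lemma mpoly_ideal:
  assumes "ideal I (mpoly_ring b)"
  shows "I \<subseteq> carrier (mpoly_ring b)" "0 \<in> I" "\<And>p q. p \<in> I \<Longrightarrow> q \<in> I \<Longrightarrow> p + q \<in> I"
    "\<And>r p. r \<in> carrier (mpoly_ring b) \<Longrightarrow> p \<in> I \<Longrightarrow> r * p \<in> I"
proof -
  have add: "additive_subgroup I (mpoly_ring b)" using assms by (rule ideal.axioms(1))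
  show "I \<subseteq> carrier (mpoly_ring b)" by (rule additive_subgroup.a_subset[OF add])
  show "0 \<in> I" using additive_subgroup.zero_closed[OF add] by (simp add: mpoly_ring_simps)
  show "p + q \<in> I" if "p \<in> I" "q \<in> I" for p q
    using additive_subgroup.a_closed[OF add that] by (simp add: mpoly_ring_simps)
  show "r * p \<in> I" if "r \<in> carrier (mpoly_ring b)" "p \<in> I" for r p
    using ideal.I_l_closed[OF assms that(2,1)] by (simp add: mpoly_ring_simps)
qed

lemma ideal_subspace:
  assumes "ideal I (mpoly_ring b)"
  shows "module.subspace mscale I"
proof (rule Modules.module.subspaceI[OF mscale_module])
  show "mscale c p \<in> I" if "p \<in> I" for c p
    unfolding mscale_def using single_in_carrier[of 0 b c] that by (intro mpoly_ideal(4)[OF assms]) auto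
qed (use mpoly_ideal[OF assms] in auto)

text \<open>The filtration is run through all monomials of degree \<open>n\<close>, where
  \<open>W\<close> plus their span is the whole graded piece.\<close>

lemma hilbert_function_eq:
  fixes I :: "'a::comm_ring_1 mpoly set"
  assumes I: "ideal I (mpoly_ring b)"
    and h: "\<And>\<alpha>. \<alpha> \<in> monoms {..<b} \<Longrightarrow> monom_degree \<alpha> = n \<Longrightarrow> has_length (*) (h \<alpha>) (lead_ideal b I \<alpha>) UNIV"
  shows "hilbert_function b I n = enat (\<Sum>\<alpha> | \<alpha> \<in> monoms {..<b} \<and> monom_degree \<alpha> = n. h \<alpha>)"
proof -
  let ?T = "{\<alpha> \<in> monoms {..<b}. monom_degree \<alpha> = n}"
  let ?W = "I \<inter> graded_part b n" and ?C = "graded_part b n :: 'a mpoly set"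
  interpret Modules.module "mscale :: 'a \<Rightarrow> _" by (rule mscale_module)
  have C: "subspace ?C" unfolding graded_part_eq by (rule supported_subspace)
  have W: "subspace ?W" by (rule subspace_inter[OF ideal_subspace[OF I] C])
  have "{w + p |w p. w \<in> ?W \<and> p \<in> supported ?T} = ?C"
  proof
    show "{w + p |w p. w \<in> ?W \<and> p \<in> supported ?T} \<subseteq> ?C"
      unfolding graded_part_eq[symmetric] using subspace_add[OF C] by blast
    show "?C \<subseteq> {w + p |w p. w \<in> ?W \<and> p \<in> supported ?T}"
    proof
      fix p assume p: "p \<in> ?C"
      have "0 + p \<in> {w + p |w p. w \<in> ?W \<and> p \<in> supported ?T}"
        using p subspace_0[OF W] unfolding graded_part_eq[symmetric] by blast
      then show "p \<in> {w + p |w p. w \<in> ?W \<and> p \<in> supported ?T}" by simp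
    qed
  qed
  moreover have "has_length mscale (\<Sum>\<alpha>\<in>?T. h \<alpha>) ?W {w + p |w p. w \<in> ?W \<and> p \<in> supported ?T}"
  proof (rule has_length_filtration[OF W finite_monoms_deg])
    show "has_length (*) (h \<alpha>) (lead_coeffs ?W ?T \<alpha>) UNIV" if "\<alpha> \<in> ?T" for \<alpha>
      using h[of \<alpha>] that unfolding lead_ideal_def by simp
  qed simp
  ultimately have len: "has_length mscale (\<Sum>\<alpha>\<in>?T. h \<alpha>) ?W ?C" by simp
  have "quotient_data (mscale :: 'a \<Rightarrow> _) ?W ?C ((mpoly_ring b)\<lparr>carrier := graded_part b n\<rparr>)"
    by (rule quotient_data.intro) (use mscale_module W C in \<open>simp_all add: mpoly_ring_simps\<close>)
  from quotient_data.module_length_quotient[OF this] show ?thesis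
    unfolding hilbert_function_def using Sup_chain_eq[OF len] by simp
qed

lemma rideal_lead_ideal:
  assumes I: "ideal I (mpoly_ring b)"
  shows "rideal (lead_ideal b I \<alpha>)"
proof -
  let ?W = "I \<inter> graded_part b (monom_degree \<alpha>)"
  let ?S = "supported {\<beta> \<in> {\<beta> \<in> monoms {..<b}. monom_degree \<beta> = monom_degree \<alpha>}. \<beta> < \<alpha>}"
  interpret Modules.module "mscale :: 'a \<Rightarrow> _" by (rule mscale_module)
  have W: "subspace ?W"
    unfolding graded_part_eq by (rule subspace_inter[OF ideal_subspace[OF I] supported_subspace])
  have S: "subspace ?S" by (rule supported_subspace)
  show ?thesis
    unfolding lead_ideal_def lead_coeffs_def
  proof (rule ridealI; clarify)
    show "\<exists>w\<in>?W. w - Poly_Mapping.single \<alpha> 0 \<in> ?S"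
      using subspace_0[OF W] subspace_0[OF S] by (intro bexI[of _ 0]) simp_all
  next
    fix x y v w assume vw: "v \<in> I" "v \<in> graded_part b (monom_degree \<alpha>)" "w \<in> I" "w \<in> graded_part b (monom_degree \<alpha>)"
      "v - Poly_Mapping.single \<alpha> x \<in> ?S" "w - Poly_Mapping.single \<alpha> y \<in> ?S"
    have "(v + w) - Poly_Mapping.single \<alpha> (x + y) = (v - Poly_Mapping.single \<alpha> x) + (w - Poly_Mapping.single \<alpha> y)"
      by (simp add: single_add)
    then have "(v + w) - Poly_Mapping.single \<alpha> (x + y) \<in> ?S" using subspace_add[OF S vw(5,6)] by (simp only:)
    moreover have "v + w \<in> ?W" using subspace_add[OF W] vw by blast
    ultimately show "\<exists>w\<in>?W. w - Poly_Mapping.single \<alpha> (x + y) \<in> ?S" by blast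
  next
    fix c x w assume w: "w \<in> I" "w \<in> graded_part b (monom_degree \<alpha>)" "w - Poly_Mapping.single \<alpha> x \<in> ?S"
    have "mscale c w - Poly_Mapping.single \<alpha> (c * x) = mscale c (w - Poly_Mapping.single \<alpha> x)"
      by (simp add: scale_right_diff_distrib mscale_single)
    then have "mscale c w - Poly_Mapping.single \<alpha> (c * x) \<in> ?S" using subspace_scale[OF S w(3)] by (simp only:)
    moreover have "mscale c w \<in> ?W" using subspace_scale[OF W] w by blast
    ultimately show "\<exists>w\<in>?W. w - Poly_Mapping.single \<alpha> (c * x) \<in> ?S" by blast
  qed
qed

text \<open>Addition preserves the order of exponent vectors, so multiplying by a monomial carries
  leading coefficients at \<alpha> to leading coefficients at
  \<open>\<alpha> + \<delta>\<close>.\<close>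

lemma lead_ideal_mono:
  fixes I :: "'a::comm_ring_1 mpoly set"
  assumes I: "ideal I (mpoly_ring b)" and \<delta>: "\<delta> \<in> monoms {..<b}"
  shows "lead_ideal b I \<alpha> \<subseteq> lead_ideal b I (\<alpha> + \<delta>)"
proof
  fix a assume "a \<in> lead_ideal b I \<alpha>"
  then obtain w where w: "w \<in> I" "w \<in> graded_part b (monom_degree \<alpha>)"
    "w - Poly_Mapping.single \<alpha> a \<in> supported {\<beta> \<in> {\<beta> \<in> monoms {..<b}. monom_degree \<beta> = monom_degree \<alpha>}. \<beta> < \<alpha>}"
    unfolding lead_ideal_def lead_coeffs_def by blast
  let ?d = "Poly_Mapping.single \<delta> (1 :: 'a)"
  have kd: "Poly_Mapping.keys (?d * p) \<subseteq> {\<beta> + \<delta> |\<beta>. \<beta> \<in> Poly_Mapping.keys p}" for p :: "'a mpoly"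
    using keys_mult[of ?d p] by (auto simp: add.commute split: if_splits)
  have "?d * w \<in> I" using mpoly_ideal(4)[OF I single_in_carrier[OF \<delta>] w(1)] .
  moreover have "?d * w \<in> graded_part b (monom_degree (\<alpha> + \<delta>))"
    using kd[of w] w(2) \<delta> unfolding graded_part_eq supported_def by (fastforce simp: monom_degree_add)
  moreover have "?d * w - Poly_Mapping.single (\<alpha> + \<delta>) a = ?d * (w - Poly_Mapping.single \<alpha> a)"
    by (simp add: right_diff_distrib mult_single add.commute)
  moreover have "?d * (w - Poly_Mapping.single \<alpha> a) \<in>
    supported {\<beta> \<in> {\<beta> \<in> monoms {..<b}. monom_degree \<beta> = monom_degree (\<alpha> + \<delta>)}. \<beta> < \<alpha> + \<delta>}"
  proof -
    have "\<gamma> + \<delta> \<in> {\<beta> \<in> {\<beta> \<in> monoms {..<b}. monom_degree \<beta> = monom_degree (\<alpha> + \<delta>)}. \<beta> < \<alpha> + \<delta>}"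
      if \<gamma>: "\<gamma> \<in> Poly_Mapping.keys (w - Poly_Mapping.single \<alpha> a)" for \<gamma>
    proof -
      have "\<gamma> \<in> monoms {..<b}" "monom_degree \<gamma> = monom_degree \<alpha>" "\<gamma> < \<alpha>"
        using w(3) \<gamma> unfolding supported_def by blast+
      moreover from this(3) have "\<gamma> + \<delta> < \<alpha> + \<delta>" by (rule add_strict_right_mono)
      ultimately show ?thesis using \<delta> by (simp add: monom_degree_add)
    qed
    then show ?thesis using kd[of "w - Poly_Mapping.single \<alpha> a"] unfolding supported_def by blast
  qed
  ultimately show "a \<in> lead_ideal b I (\<alpha> + \<delta>)"
    unfolding lead_ideal_def lead_coeffs_def by (intro CollectI bexI[of _ "?d * w"]) simp_all
qed

section \<open>Gotzmann developments\<close>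

lemma gsum_nth: "gsum k cs n = (\<Sum>i<length cs. gterm (k + i) (cs ! i) n)"
  by (induction cs arbitrary: k) (simp_all add: sum.lessThan_Suc_shift del: sum.lessThan_Suc)

text \<open>Lists absorb the case \<open>P = 0\<close> as the empty list and count places from
  0.\<close>

lemma gotzmann_development_iff:
  "gotzmann_development P \<longleftrightarrow>
    (\<exists>cs. sorted_wrt (\<ge>) cs \<and> (\<forall>\<^sub>F n in sequentially. poly P (of_nat n) = of_nat (gsum 0 cs n)))"
proof
  assume "gotzmann_development P"
  then consider "P = 0"
    | s c where "1 \<le> s" "\<And>i j. 1 \<le> i \<Longrightarrow> i \<le> j \<Longrightarrow> j \<le> s \<Longrightarrow> c j \<le> (c i :: nat)"
      "\<forall>\<^sub>F n in sequentially. poly P (of_nat n) = of_nat (\<Sum>i=1..s. (n + c i - (i - 1)) choose c i)"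
    unfolding gotzmann_development_def by blast
  then show "\<exists>cs. sorted_wrt (\<ge>) cs \<and> (\<forall>\<^sub>F n in sequentially. poly P (of_nat n) = of_nat (gsum 0 cs n))"
  proof cases
    case 1
    then show ?thesis by (intro exI[of _ "[]"]) simp
  next
    case (2 s c)
    let ?cs = "map (\<lambda>i. c (Suc i)) [0..<s]"
    have "sorted_wrt (\<ge>) ?cs"
      using 2(2) by (simp add: sorted_wrt_iff_nth_less)
    moreover have "gsum 0 ?cs n = (\<Sum>i=1..s. (n + c i - (i - 1)) choose c i)" for n
      by (simp add: gsum_nth gterm_def sum.atLeast1_atMost_eq)
    ultimately show ?thesis using 2(3) by (intro exI[of _ ?cs]) simp
  qed
next
  assume "\<exists>cs. sorted_wrt (\<ge>) cs \<and> (\<forall>\<^sub>F n in sequentially. poly P (of_nat n) = of_nat (gsum 0 cs n))"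
  then obtain cs where cs: "sorted_wrt (\<ge>) cs"
    "\<forall>\<^sub>F n in sequentially. poly P (of_nat n) = of_nat (gsum 0 cs n)" by blast
  show "gotzmann_development P"
  proof (cases "cs = []")
    case True
    then have "P = 0" using cs(2) by (intro poly_eq_of_eventually_eq) simp
    then show ?thesis by (simp add: gotzmann_development_def)
  next
    case False
    let ?c = "\<lambda>i. cs ! (i - 1)"
    have "gsum 0 cs n = (\<Sum>i=1..length cs. (n + ?c i - (i - 1)) choose ?c i)" for n
      by (simp add: gsum_nth gterm_def sum.atLeast1_atMost_eq)
    then have "\<forall>\<^sub>F n in sequentially. poly P (of_nat n) =
        of_nat (\<Sum>i=1..length cs. (n + ?c i - (i - 1)) choose ?c i)"
      using cs(2) by simp
    moreover have "?c j \<le> ?c i" if "1 \<le> i" "i \<le> j" "j \<le> length cs" for i j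
    proof (cases "i = j")
      case False
      then show ?thesis using cs(1) that by (simp add: sorted_wrt_iff_nth_less)
    qed simp
    moreover have "1 \<le> length cs" using False by (cases cs) auto
    ultimately show ?thesis unfolding gotzmann_development_def
      by (intro disjI2 exI[of _ "length cs"] exI[of _ ?c] conjI) auto
  qed
qed

lemma gotz_lt_gterm:
  assumes "gotz d 0 f"
  shows "\<forall>\<^sub>F n in sequentially. f n < gterm 0 d n"
proof -
  obtain cs where cs: "\<And>c. c \<in> set cs \<Longrightarrow> c < d" "\<forall>\<^sub>F n in sequentially. f n = gsum 0 cs n"
    using assms unfolding gotz_def by blast
  \<comment> \<open>The vanishing coefficient at \<open>d\<close> stands in for a degree below
    \<open>d\<close>, which could not be expressed for \<open>d = 0\<close>.\<close>
  have Q: "poly.coeff (gsum_poly 0 cs) d = 0 \<and> Polynomial.degree (gsum_poly 0 cs) \<le> d"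
  proof (cases d)
    case 0
    with cs(1) have "cs = []" by (cases cs) auto
    then show ?thesis by simp
  next
    case (Suc e)
    then have "Polynomial.degree (gsum_poly 0 cs) \<le> e"
      using cs(1) by (intro degree_gsum_poly) (auto simp: less_Suc_eq_le)
    then show ?thesis using Suc by (simp add: coeff_eq_0)
  qed
  let ?p = "gterm_poly 0 d - gsum_poly 0 cs"
  have cd: "poly.coeff ?p d = 1 / fact d" using Q gterm_poly_lead[of 0 d] by auto
  have "Polynomial.degree ?p \<le> d" using Q gterm_poly_lead[of 0 d] by (intro degree_diff_le) auto
  moreover have "d \<le> Polynomial.degree ?p" by (rule le_degree, unfold cd) simp
  ultimately have "Polynomial.degree ?p = d" by simp
  then have "0 < Polynomial.lead_coeff ?p" using cd by simp
  from poly_eventually_pos[OF this] show ?thesis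
    using cs(2) eventually_poly_gsum_poly[of 0 cs]
    by eventually_elim (simp add: poly_gterm_poly)
qed

section \<open>Division by the leading binomial\<close>

text \<open>Settles both definite descriptions at once: an eventual division with constant quotient
  and polynomial remainder is unique.\<close>

lemma gamma_Gamma_eqI:
  assumes "\<forall>\<^sub>F n in sequentially.
      poly P (of_nat n) = of_nat (g * gterm 0 (Polynomial.degree P) n + r n) \<and>
      r n < gterm 0 (Polynomial.degree P) n \<and> poly Q (of_nat n) = of_nat (r n)"
  shows "gamma_of P = g" "Gamma_of P = Q"
proof -
  let ?d = "Polynomial.degree P"
  have at: "\<forall>\<^sub>F n in sequentially. gamma_at P n = g \<and> Gamma_at P n = r n"
    using assms
  proof eventually_elim
    case (elim n)
    have "nat \<lfloor>poly P (of_nat n)\<rfloor> = r n + ((n + ?d) choose ?d) * g"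
      using elim by (simp add: gterm_def flip: of_nat_mult of_nat_add)
    then show ?case
      using elim unfolding gamma_at_def Gamma_at_def gterm_def by simp
  qed
  show "gamma_of P = g"
    unfolding gamma_of_def
  proof (rule the_equality)
    show "\<forall>\<^sub>F n in sequentially. gamma_at P n = g" using at by eventually_elim simp
    fix g' assume "\<forall>\<^sub>F n in sequentially. gamma_at P n = g'"
    with at have "\<forall>\<^sub>F n::nat in sequentially. g' = g" by eventually_elim simp
    then show "g' = g" by simp
  qed
  show "Gamma_of P = Q"
    unfolding Gamma_of_def
  proof (rule the_equality)
    show "\<forall>\<^sub>F n in sequentially. poly Q (of_nat n) = of_nat (Gamma_at P n)"
      using at assms by eventually_elim simp
    fix Q' :: "rat poly" assume "\<forall>\<^sub>F n in sequentially. poly Q' (of_nat n) = of_nat (Gamma_at P n)"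
    with at assms have "\<forall>\<^sub>F n in sequentially. poly Q' (of_nat n) = poly Q (of_nat n)"
      by eventually_elim simp
    then show "Q' = Q" by (rule poly_eq_of_eventually_eq)
  qed
qed

lemma exists_nat_switch:
  fixes Q :: "nat \<Rightarrow> bool"
  shows "\<not> Q 0 \<Longrightarrow> Q n \<Longrightarrow> \<exists>k. \<not> Q k \<and> Q (Suc k)"
  by (induction n) auto

text \<open>A polynomial has an eventual sign, so the quotient is found as the place
  \<open>k\<close> where \<open>P\<close> minus \<open>k\<close> times the binomial is last
  eventually nonnegative. This is why the quotient is eventually constant.\<close>

lemma gamma_Gamma_exist:
  assumes "P \<in> nat_valued_polys" "P \<noteq> 0"
  shows "\<exists>r. \<forall>\<^sub>F n in sequentially.
      poly P (of_nat n) = of_nat (gamma_of P * gterm 0 (Polynomial.degree P) n + r n) \<and>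
      r n < gterm 0 (Polynomial.degree P) n \<and> poly (Gamma_of P) (of_nat n) = of_nat (r n)"
proof -
  let ?d = "Polynomial.degree P"
  let ?B = "gterm_poly 0 ?d"
  define p where "p k = P - smult (of_nat k) ?B" for k :: nat
  have B: "Polynomial.degree ?B = ?d" "poly.coeff ?B ?d = 1 / fact ?d" using gterm_poly_lead[of 0 ?d] by auto
  have nat: "\<forall>\<^sub>F n in sequentially. poly P (of_nat n) \<in> \<nat>"
    using assms(1) by (simp add: nat_valued_polys_def)
  let ?neg = "\<lambda>k. \<forall>\<^sub>F n in sequentially. poly (p k) (of_nat n) < 0"
  \<comment> \<open>The binomial has leading coefficient \<open>1 / fact ?d\<close>, so beyond this
    bound the difference is eventually negative.\<close>
  obtain K :: nat where K: "Polynomial.lead_coeff P * fact ?d < of_nat K" using reals_Archimedean2 by blast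
  have "?neg K"
  proof -
    have cd: "poly.coeff (- p K) ?d = of_nat K / fact ?d - Polynomial.lead_coeff P" by (simp add: p_def B)
    moreover have "0 < of_nat K / fact ?d - Polynomial.lead_coeff P" using K by (simp add: field_simps)
    ultimately have pos: "0 < poly.coeff (- p K) ?d" by simp
    have "Polynomial.degree (- p K) \<le> ?d"
      unfolding p_def degree_minus by (intro degree_diff_le) (auto simp: B)
    moreover have "?d \<le> Polynomial.degree (- p K)" using pos by (intro le_degree) simp
    ultimately have "0 < Polynomial.lead_coeff (- p K)" using pos by simp
    from poly_eventually_pos[OF this] show ?thesis by simp
  qed
  moreover have "\<not> ?neg 0"
  proof
    assume "?neg 0"
    with nat have "\<forall>\<^sub>F n::nat in sequentially. False"
    proof eventually_elim
      case (elim n)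
      from elim(1) obtain m where "poly P (of_nat n) = of_nat m" by (rule Nats_cases)
      with elim(2) show ?case by (simp add: p_def)
    qed
    then show False by simp
  qed
  ultimately obtain g where "\<not> ?neg g \<and> ?neg (Suc g)" using exists_nat_switch[of ?neg K] by blast
  then have g: "\<not> ?neg g" "?neg (Suc g)" by simp_all
  from g(1) have ge: "\<forall>\<^sub>F n in sequentially. 0 \<le> poly (p g) (of_nat n)"
    using poly_eventually_sign[of "p g"] by blast
  define r where "r n = nat \<lfloor>poly (p g) (of_nat n)\<rfloor>" for n :: nat
  have *: "\<forall>\<^sub>F n in sequentially. poly P (of_nat n) = of_nat (g * gterm 0 ?d n + r n) \<and>
      r n < gterm 0 ?d n \<and> poly (p g) (of_nat n) = of_nat (r n)"
    using ge g(2) nat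
  proof eventually_elim
    case (elim n)
    obtain m :: nat where m: "poly P (of_nat n) = of_nat m" using elim(3) by (rule Nats_cases)
    have pk: "poly (p k) (of_nat n) = of_nat m - of_nat (k * gterm 0 ?d n)" for k
      by (simp add: p_def m poly_gterm_poly)
    have "(of_nat (g * gterm 0 ?d n) :: rat) \<le> of_nat m"
      using elim(1) by (simp only: pk diff_ge_0_iff_ge)
    then have le: "g * gterm 0 ?d n \<le> m" by (simp only: of_nat_le_iff)
    have pg: "poly (p g) (of_nat n) = of_nat (m - g * gterm 0 ?d n)"
      by (simp only: pk of_nat_diff[OF le])
    have r: "r n = m - g * gterm 0 ?d n"
      unfolding r_def by (simp only: pg floor_of_nat nat_int)
    have "(of_nat m :: rat) < of_nat (Suc g * gterm 0 ?d n)"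
      using elim(2) by (simp only: pk diff_less_0_iff_less)
    then have lt: "m < Suc g * gterm 0 ?d n" by (simp only: of_nat_less_iff)
    have m2: "m = g * gterm 0 ?d n + r n" using le r by linarith
    show ?case
    proof (intro conjI)
      show "poly P (of_nat n) = of_nat (g * gterm 0 ?d n + r n)" by (simp only: m flip: m2)
      show "r n < gterm 0 ?d n" using lt m2 by simp
      show "poly (p g) (of_nat n) = of_nat (r n)" by (simp only: pg r)
    qed
  qed
  show ?thesis using * gamma_Gamma_eqI[OF *] by (intro exI[of _ r]) simp
qed

section \<open>Ideals of prescribed colength\<close>

lemma rideal_single_0: "rideal {0}"
  by (rule Modules.module.subspace_single_0[OF ring_module])

lemma rideal_colength:
  fixes J :: "'a::comm_ring_1 set"
  assumes "has_length (*) L {0::'a} UNIV" "rideal J"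
  shows "\<exists>n\<le>L. has_length (*) n J UNIV"
proof (rule has_length_exists)
  show "has_chain (*) 0 J UNIV" using assms(2) by (rule has_chain_0) simp
  show "k \<le> L" if "has_chain (*) k J UNIV" for k
    using has_chain_mono[OF that, of "{0}" UNIV] assms rideal_0 unfolding has_length_def by auto
qed

text \<open>Members of a composition series, counted from the top. The chain above gives colength at
  least \<open>g\<close>, and the chain below leaves room for no more than \<open>g\<close> out of
  \<open>L\<close>.\<close>

lemma exists_rideal_colength:
  assumes len: "has_length (*) L {0::'a::comm_ring_1} UNIV"
  shows "\<exists>J :: nat \<Rightarrow> 'a set. (\<forall>g\<le>L. rideal (J g) \<and> has_length (*) g (J g) UNIV) \<and>
    (\<forall>g<L. J (Suc g) \<subseteq> J g)"
proof -
  have "has_chain (*) L {0::'a} UNIV" using len unfolding has_length_def by blast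
  then obtain N :: "nat \<Rightarrow> 'a set" where N: "\<And>i. i \<le> L \<Longrightarrow> rideal (N i)" "\<And>i. i \<le> L \<Longrightarrow> {0} \<subseteq> N i"
    "\<And>i. i \<le> L \<Longrightarrow> N i \<subseteq> UNIV" "\<And>i. i < L \<Longrightarrow> N i \<subset> N (Suc i)"
    by (rule has_chainE) blast
  have mono: "N i \<subseteq> N j" if "i \<le> j" "j \<le> L" for i j
    using that(1,2)
  proof (induction j rule: dec_induct)
    case (step j)
    then show ?case using N(4)[of j] by auto
  qed simp
  have "has_length (*) g (N (L - g)) UNIV" if g: "g \<le> L" for g
  proof -
    obtain n where n: "has_length (*) n (N (L - g)) UNIV"
      using rideal_colength[OF len N(1)[of "L - g"]] by auto
    have low: "has_chain (*) (L - g) {0} (N (L - g))"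
    proof (rule has_chainI[of _ _ N])
      fix i assume "i \<le> L - g"
      then show "N i \<subseteq> N (L - g)" by (intro mono) auto
    qed (use N(1,2,4) g in auto)
    have up: "has_chain (*) g (N (L - g)) UNIV"
    proof (rule has_chainI[of _ _ "\<lambda>i. N (L - g + i)"])
      fix i assume i: "i \<le> g"
      show "rideal (N (L - g + i))" using i g by (intro N(1)) simp
      show "N (L - g) \<subseteq> N (L - g + i)" using i g by (intro mono) auto
    next
      fix i assume i: "i < g"
      show "N (L - g + i) \<subset> N (L - g + Suc i)" using N(4)[of "L - g + i"] i g by simp
    qed simp
    have "has_chain (*) (L - g + n) {0} (UNIV :: 'a set)"
      using has_chain_append[OF low] n unfolding has_length_def by blast
    then have "L - g + n \<le> L" using len unfolding has_length_def by blast
    moreover have "g \<le> n" using n up unfolding has_length_def by blast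
    ultimately have "n = g" using g by simp
    then show ?thesis using n by simp
  qed
  moreover have "N (L - Suc g) \<subseteq> N (L - g)" for g by (rule mono) simp_all
  ultimately show ?thesis using N(1) by (intro exI[of _ "\<lambda>g. N (L - g)"]) simp
qed

section \<open>Ideals defined by coefficient conditions\<close>

lemma mpoly_decomp: "p = (\<Sum>\<beta>\<in>Poly_Mapping.keys p. Poly_Mapping.single \<beta> (Poly_Mapping.lookup p \<beta>))"
proof (rule poly_mapping_eqI)
  fix \<alpha>
  have "(\<Sum>\<beta>\<in>Poly_Mapping.keys p. Poly_Mapping.lookup (Poly_Mapping.single \<beta> (Poly_Mapping.lookup p \<beta>)) \<alpha>) =
    (\<Sum>\<beta>\<in>Poly_Mapping.keys p. if \<beta> = \<alpha> then Poly_Mapping.lookup p \<beta> else 0)"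
    by (intro sum.cong) (auto simp: lookup_single when_def)
  also have "\<dots> = Poly_Mapping.lookup p \<alpha>" by (simp add: sum.delta in_keys_iff)
  finally show "Poly_Mapping.lookup p \<alpha> = Poly_Mapping.lookup
    (\<Sum>\<beta>\<in>Poly_Mapping.keys p. Poly_Mapping.single \<beta> (Poly_Mapping.lookup p \<beta>)) \<alpha>"
    by (simp add: lookup_sum)
qed

lemma lookup_hom_component:
  "Poly_Mapping.lookup (hom_component n p) \<alpha> = (if monom_degree \<alpha> = n then Poly_Mapping.lookup p \<alpha> else 0)"
proof -
  let ?K = "{\<beta> \<in> Poly_Mapping.keys p. monom_degree \<beta> = n}"
  have "Poly_Mapping.lookup (hom_component n p) \<alpha> =
    (\<Sum>\<beta>\<in>?K. if \<beta> = \<alpha> then Poly_Mapping.lookup p \<beta> else 0)"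
    unfolding hom_component_def lookup_sum by (intro sum.cong) (auto simp: lookup_single when_def)
  also have "\<dots> = (if \<alpha> \<in> ?K then Poly_Mapping.lookup p \<alpha> else 0)" by (simp add: sum.delta)
  finally show ?thesis by (auto simp: in_keys_iff)
qed

lemma ring_mpoly_ring: "ring (mpoly_ring b :: ('a::comm_ring_1, 'a mpoly) module)"
proof -
  let ?R = "mpoly_ring b :: ('a, 'a mpoly) module"
  interpret Modules.module "mscale :: 'a \<Rightarrow> _" by (rule mscale_module)
  have add: "p + q \<in> carrier ?R" if "p \<in> carrier ?R" "q \<in> carrier ?R" for p q
    using that subspace_add[OF supported_subspace] unfolding carrier_mpoly_ring by blast
  have neg: "- p \<in> carrier ?R" if "p \<in> carrier ?R" for p
    using that subspace_neg[OF supported_subspace] unfolding carrier_mpoly_ring by blast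
  have zero: "0 \<in> carrier ?R" unfolding carrier_mpoly_ring supported_def by simp
  have one: "1 \<in> carrier ?R" unfolding carrier_mpoly_ring supported_def by simp
  have mult: "p * q \<in> carrier ?R" if "p \<in> carrier ?R" "q \<in> carrier ?R" for p q
    using that keys_mult[of p q] unfolding carrier_mpoly_ring supported_def by (fastforce simp: subset_iff)
  show ?thesis
  proof (rule ringI)
    show "abelian_group ?R"
    proof (rule abelian_groupI)
      show "\<exists>q\<in>carrier ?R. q \<oplus>\<^bsub>?R\<^esub> p = \<zero>\<^bsub>?R\<^esub>" if "p \<in> carrier ?R" for p
        using neg[OF that] by (intro bexI[of _ "- p"]) (simp_all add: mpoly_ring_simps)
    qed (use add zero in \<open>simp_all add: mpoly_ring_simps ac_simps\<close>)
    show "Group.monoid ?R"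
      by (rule monoidI) (use mult one in \<open>simp_all add: mpoly_ring_simps mult.assoc\<close>)
  qed (simp_all add: mpoly_ring_simps distrib_left distrib_right)
qed

text \<open>A monomial ideal with coefficients. It is closed under multiplication because
  \<open>J\<close> is required to grow along divisibility in the context below.\<close>

definition coeff_ideal :: "nat \<Rightarrow> ((nat \<Rightarrow>\<^sub>0 nat) \<Rightarrow> 'a set) \<Rightarrow> 'a::comm_ring_1 mpoly set" where
  "coeff_ideal b J = {p \<in> carrier (mpoly_ring b). \<forall>\<alpha>. Poly_Mapping.lookup p \<alpha> \<in> J \<alpha>}"

context
  fixes b :: nat and J :: "(nat \<Rightarrow>\<^sub>0 nat) \<Rightarrow> 'a::comm_ring_1 set"
  assumes J: "\<And>\<alpha>. rideal (J \<alpha>)" and mono: "\<And>\<alpha> \<delta>. J \<alpha> \<subseteq> J (\<alpha> + \<delta>)"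
begin

lemma coeff_ideal_subspace: "module.subspace mscale (coeff_ideal b J)"
proof -
  interpret Modules.module "mscale :: 'a \<Rightarrow> _" by (rule mscale_module)
  have c: "subspace (carrier (mpoly_ring b) :: 'a mpoly set)"
    unfolding carrier_mpoly_ring by (rule supported_subspace)
  show ?thesis
  proof (rule subspaceI)
    show "0 \<in> coeff_ideal b J" unfolding coeff_ideal_def using subspace_0[OF c] rideal_0[OF J] by simp
    show "p + q \<in> coeff_ideal b J" if "p \<in> coeff_ideal b J" "q \<in> coeff_ideal b J" for p q
      using that subspace_add[OF c] rideal_add[OF J] unfolding coeff_ideal_def by (simp add: lookup_add)
    show "mscale a p \<in> coeff_ideal b J" if "p \<in> coeff_ideal b J" for a p
      using that subspace_scale[OF c] rideal_mult[OF J] unfolding coeff_ideal_def by (simp add: lookup_mscale)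
  qed
qed

lemma single_in_coeff_ideal:
  assumes "\<alpha> \<in> monoms {..<b}" "a \<in> J \<alpha>"
  shows "Poly_Mapping.single \<alpha> a \<in> coeff_ideal b J"
  using assms rideal_0[OF J] unfolding coeff_ideal_def
  by (auto simp: single_in_carrier lookup_single when_def)

lemma ideal_coeff_ideal: "ideal (coeff_ideal b J) (mpoly_ring b)"
proof -
  interpret Modules.module "mscale :: 'a \<Rightarrow> _" by (rule mscale_module)
  note sub = coeff_ideal_subspace
  have c: "subspace (carrier (mpoly_ring b) :: 'a mpoly set)"
    unfolding carrier_mpoly_ring by (rule supported_subspace)
  have mult: "r * p \<in> coeff_ideal b J" if r: "r \<in> carrier (mpoly_ring b)" and p: "p \<in> coeff_ideal b J" for r p
  proof -
    have "r * p = (\<Sum>\<gamma>\<in>Poly_Mapping.keys r. Poly_Mapping.single \<gamma> (Poly_Mapping.lookup r \<gamma>)) *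
        (\<Sum>\<beta>\<in>Poly_Mapping.keys p. Poly_Mapping.single \<beta> (Poly_Mapping.lookup p \<beta>))"
      using mpoly_decomp[of r] mpoly_decomp[of p] by (simp only: flip: mpoly_decomp)
    also have "\<dots> = (\<Sum>\<gamma>\<in>Poly_Mapping.keys r. \<Sum>\<beta>\<in>Poly_Mapping.keys p.
        Poly_Mapping.single (\<gamma> + \<beta>) (Poly_Mapping.lookup r \<gamma> * Poly_Mapping.lookup p \<beta>))"
      by (simp add: sum_product mult_single)
    also have "\<dots> \<in> coeff_ideal b J"
    proof (intro subspace_sum[OF sub] single_in_coeff_ideal)
      fix \<gamma> \<beta> assume k: "\<gamma> \<in> Poly_Mapping.keys r" "\<beta> \<in> Poly_Mapping.keys p"
      show "\<gamma> + \<beta> \<in> monoms {..<b}"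
        using k r p unfolding coeff_ideal_def carrier_mpoly_ring supported_def by auto
      have "Poly_Mapping.lookup p \<beta> \<in> J (\<beta> + \<gamma>)" using p mono[of \<beta> \<gamma>] unfolding coeff_ideal_def by blast
      then show "Poly_Mapping.lookup r \<gamma> * Poly_Mapping.lookup p \<beta> \<in> J (\<gamma> + \<beta>)"
        using rideal_mult[OF J] by (simp add: add.commute)
    qed
    finally show ?thesis .
  qed
  show ?thesis
  proof (rule idealI)
    show "ring (mpoly_ring b :: ('a, 'a mpoly) module)" by (rule ring_mpoly_ring)
    show "subgroup (coeff_ideal b J) (add_monoid (mpoly_ring b))"
      by (subst subgroup_additive_iff)
        (use subspace_0[OF sub] subspace_add[OF sub] subspace_neg[OF sub] subspace_neg[OF c]
          in \<open>auto simp: mpoly_ring_simps coeff_ideal_def\<close>)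
    fix p r :: "'a mpoly" assume *: "p \<in> coeff_ideal b J" "r \<in> carrier (mpoly_ring b)"
    from mult[OF *(2,1)]
    show "r \<otimes>\<^bsub>mpoly_ring b\<^esub> p \<in> coeff_ideal b J" "p \<otimes>\<^bsub>mpoly_ring b\<^esub> r \<in> coeff_ideal b J"
      by (simp_all only: mpoly_ring_simps mult.commute[of p])
  qed
qed

lemma homogeneous_coeff_ideal: "homogeneous_ideal b (coeff_ideal b J)"
  unfolding homogeneous_ideal_def
proof (intro conjI ballI allI)
  fix p n assume p: "p \<in> coeff_ideal b J"
  have "Poly_Mapping.keys (hom_component n p) \<subseteq> Poly_Mapping.keys p"
    by (auto simp: in_keys_iff lookup_hom_component split: if_splits)
  then have "hom_component n p \<in> carrier (mpoly_ring b)"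
    using p unfolding coeff_ideal_def carrier_mpoly_ring supported_def by blast
  then show "hom_component n p \<in> coeff_ideal b J"
    using p rideal_0[OF J] unfolding coeff_ideal_def by (simp add: lookup_hom_component)
qed (rule ideal_coeff_ideal)

lemma lead_ideal_coeff_ideal:
  assumes \<alpha>: "\<alpha> \<in> monoms {..<b}"
  shows "lead_ideal b (coeff_ideal b J) \<alpha> = J \<alpha>"
proof (intro Set.set_eqI iffI)
  fix a assume "a \<in> lead_ideal b (coeff_ideal b J) \<alpha>"
  then obtain w where w: "w \<in> coeff_ideal b J"
    "w - Poly_Mapping.single \<alpha> a \<in> supported {\<beta> \<in> {\<beta> \<in> monoms {..<b}. monom_degree \<beta> = monom_degree \<alpha>}. \<beta> < \<alpha>}"
    unfolding lead_ideal_def lead_coeffs_def by blast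
  have "\<alpha> \<notin> Poly_Mapping.keys (w - Poly_Mapping.single \<alpha> a)"
    using w(2) unfolding supported_def by blast
  then have "Poly_Mapping.lookup w \<alpha> = a" by (simp add: in_keys_iff lookup_minus)
  then show "a \<in> J \<alpha>" using w(1) unfolding coeff_ideal_def by blast
next
  fix a assume a: "a \<in> J \<alpha>"
  have "Poly_Mapping.single \<alpha> a \<in> coeff_ideal b J" by (rule single_in_coeff_ideal[OF \<alpha> a])
  moreover have "Poly_Mapping.single \<alpha> a \<in> graded_part b (monom_degree \<alpha>)"
    unfolding graded_part_eq supported_def using \<alpha> by simp
  ultimately show "a \<in> lead_ideal b (coeff_ideal b J) \<alpha>"
    unfolding lead_ideal_def lead_coeffs_def
    by (intro CollectI bexI[of _ "Poly_Mapping.single \<alpha> a"]) (simp_all add: supported_def)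
qed

end

section \<open>Admissible polynomials\<close>

text \<open>Layer-cake summation: \<open>h \<alpha>\<close> is the number of levels \<open>j\<close>
  that it reaches.\<close>

lemma sum_eq_sum_card:
  fixes h :: "'c \<Rightarrow> nat"
  assumes "finite T" "\<And>\<alpha>. \<alpha> \<in> T \<Longrightarrow> h \<alpha> \<le> l"
  shows "(\<Sum>\<alpha>\<in>T. h \<alpha>) = (\<Sum>j=1..l. card {\<alpha>\<in>T. j \<le> h \<alpha>})"
proof -
  have "h \<alpha> = (\<Sum>j=1..l. if j \<le> h \<alpha> then 1 else 0)" if "\<alpha> \<in> T" for \<alpha>
  proof -
    have "{1..l} \<inter> {j. j \<le> h \<alpha>} = {1..h \<alpha>}" using assms(2)[OF that] by auto
    then show ?thesis by (simp add: sum.If_cases)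
  qed
  then have "(\<Sum>\<alpha>\<in>T. h \<alpha>) = (\<Sum>\<alpha>\<in>T. \<Sum>j=1..l. if j \<le> h \<alpha> then 1 else 0)" by (intro sum.cong) auto
  also have "\<dots> = (\<Sum>j=1..l. \<Sum>\<alpha>\<in>T. if j \<le> h \<alpha> then 1 else 0)" by (rule sum.swap)
  also have "\<dots> = (\<Sum>j=1..l. card {\<alpha>\<in>T. j \<le> h \<alpha>})"
    using assms(1) by (intro sum.cong refl) (simp add: sum.If_cases Int_def)
  finally show ?thesis .
qed

lemma admissible_downsets:
  assumes len: "has_length (*) L {0::'a::comm_ring_1} UNIV" and adm: "admissible TYPE('a) b P"
  shows "\<exists>D. (\<forall>j. downset {..<b} (D j)) \<and>
    (\<forall>\<^sub>F n in sequentially. poly P (of_nat n) = of_nat (\<Sum>j=1..L. count_deg (D j) n))"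
proof -
  obtain I :: "'a mpoly set" where "homogeneous_ideal b I" and hp: "is_hilbert_poly b I P"
    using adm unfolding admissible_def by blast
  then have I: "ideal I (mpoly_ring b)" unfolding homogeneous_ideal_def by blast
  have "\<forall>\<alpha>. \<exists>n. n \<le> L \<and> has_length (*) n (lead_ideal b I \<alpha>) UNIV"
    using rideal_colength[OF len rideal_lead_ideal[OF I]] by blast
  then obtain h where h: "\<And>\<alpha>. h \<alpha> \<le> L" "\<And>\<alpha>. has_length (*) (h \<alpha>) (lead_ideal b I \<alpha>) UNIV"
    by metis
  define D where "D j = {\<alpha> \<in> monoms {..<b}. j \<le> h \<alpha>}" for j
  \<comment> \<open>A larger ideal admits fewer chains above it, so colength drops along
    divisibility.\<close>
  have anti: "h (\<alpha> + \<delta>) \<le> h \<alpha>" if "\<delta> \<in> monoms {..<b}" for \<alpha> \<delta>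
    using h(2)[of \<alpha>] h(2)[of "\<alpha> + \<delta>"] has_chain_mono[OF _ lead_ideal_mono[OF I that], of _ _ \<alpha> UNIV UNIV]
    unfolding has_length_def by blast
  have "downset {..<b} (D j)" for j
    unfolding downset_def D_def using anti by (auto intro: le_trans)
  moreover have "\<forall>\<^sub>F n in sequentially. poly P (of_nat n) = of_nat (\<Sum>j=1..L. count_deg (D j) n)"
    using hp unfolding is_hilbert_poly_def
  proof eventually_elim
    case (elim n)
    let ?T = "{\<alpha> \<in> monoms {..<b}. monom_degree \<alpha> = n}"
    have cd: "card {\<alpha>\<in>?T. j \<le> h \<alpha>} = count_deg (D j) n" for j
      unfolding count_deg_def D_def by (rule arg_cong[of _ _ card]) auto
    have "hilbert_function b I n = enat (\<Sum>\<alpha>\<in>?T. h \<alpha>)" by (rule hilbert_function_eq[OF I h(2)])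
    then have "poly P (of_nat n) = of_nat (\<Sum>\<alpha>\<in>?T. h \<alpha>)" using elim by auto
    also have "(\<Sum>\<alpha>\<in>?T. h \<alpha>) = (\<Sum>j=1..L. card {\<alpha>\<in>?T. j \<le> h \<alpha>})"
      by (rule sum_eq_sum_card) (simp_all add: finite_monoms_deg h(1))
    finally show ?case by (simp only: cd)
  qed
  ultimately show ?thesis by blast
qed

text \<open>Coefficients come from \<open>c\<close> off \<open>D\<close> and from the smaller
  \<open>c'\<close> on \<open>D\<close>, so each monomial contributes \<open>g\<close>, and one more
  if it lies in \<open>D\<close>. Colength \<open>Suc g\<close> is asked for only when
  \<open>D\<close> is nonempty, because no such ideal exists once \<open>g\<close> is the full
  length.\<close>

lemma admissibleI:
  fixes c c' :: "'a::comm_ring_1 set"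
  assumes b: "1 \<le> b" and D: "downset {..<b} D"
    and c: "rideal c" "has_length (*) g c UNIV" and c': "rideal c'" "c' \<subseteq> c"
    and len: "D \<noteq> {} \<Longrightarrow> has_length (*) (Suc g) c' UNIV"
    and P: "\<forall>\<^sub>F n in sequentially. poly P (of_nat n) = of_nat (g * gterm 0 (b - 1) n + count_deg D n)"
  shows "admissible TYPE('a) b P"
proof -
  have DV: "D \<subseteq> monoms {..<b}" and Dd: "\<And>\<alpha> \<delta>. \<alpha> + \<delta> \<in> D \<Longrightarrow> \<alpha> \<in> D"
    using D unfolding downset_def by simp_all (metis)
  \<comment> \<open>The value at 0 keeps the ideal inside the irrelevant ideal; it affects degree 0
    only.\<close>
  define J where "J \<alpha> = (if \<alpha> = 0 then {0} else if \<alpha> \<in> D then c' else c)" for \<alpha> :: "nat \<Rightarrow>\<^sub>0 nat"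
  have J: "rideal (J \<alpha>)" for \<alpha>
    using c(1) c'(1) unfolding J_def by (simp add: rideal_single_0)
  have mono: "J \<alpha> \<subseteq> J (\<alpha> + \<delta>)" for \<alpha> \<delta>
  proof (cases "\<alpha> = 0")
    case True
    then show ?thesis using rideal_0[OF J, of \<delta>] by (simp add: J_def[of 0])
  next
    case False
    then obtain i where "i \<in> Poly_Mapping.keys \<alpha>" by (metis keys_eq_empty all_not_in_conv)
    then have "i \<in> Poly_Mapping.keys (\<alpha> + \<delta>)" by (simp add: keys_add_nat)
    then have "\<alpha> + \<delta> \<noteq> 0" using keys_zero by (metis empty_iff)
    then show ?thesis using False c'(2) Dd[of \<alpha> \<delta>] unfolding J_def by simp
  qed
  let ?I = "coeff_ideal b J"
  have irr: "?I \<subseteq> irrelevant_ideal b"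
  proof
    fix p assume p: "p \<in> ?I"
    have "1 \<le> monom_degree \<alpha>" if "\<alpha> \<in> Poly_Mapping.keys p" for \<alpha>
    proof (rule ccontr)
      assume "\<not> 1 \<le> monom_degree \<alpha>"
      then have "\<alpha> = 0" by (simp add: monom_degree_eq_0_iff Suc_le_eq)
      moreover have "Poly_Mapping.lookup p \<alpha> \<in> J \<alpha>" using p unfolding coeff_ideal_def by blast
      ultimately have "Poly_Mapping.lookup p \<alpha> = 0" by (simp add: J_def)
      then show False using that by (simp add: in_keys_iff)
    qed
    then show "p \<in> irrelevant_ideal b" using p unfolding irrelevant_ideal_def coeff_ideal_def by blast
  qed
  have "is_hilbert_poly b ?I P"
    unfolding is_hilbert_poly_def
    using P eventually_ge_at_top[of 1]
  proof eventually_elim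
    case (elim n)
    let ?T = "{\<alpha> \<in> monoms {..<b}. monom_degree \<alpha> = n}"
    let ?h = "\<lambda>\<alpha>. g + (if \<alpha> \<in> D then 1 else 0)"
    have fin: "finite ?T" by (rule finite_monoms_deg) simp
    have "hilbert_function b ?I n = enat (\<Sum>\<alpha>\<in>?T. ?h \<alpha>)"
    proof (rule hilbert_function_eq[OF ideal_coeff_ideal[OF J mono]])
      fix \<alpha> assume \<alpha>: "\<alpha> \<in> monoms {..<b}" "monom_degree \<alpha> = n"
      then have "\<alpha> \<noteq> 0" using elim by auto
      then have "has_length (*) (?h \<alpha>) (J \<alpha>) UNIV" using c(2) len unfolding J_def by auto
      then show "has_length (*) (?h \<alpha>) (lead_ideal b ?I \<alpha>) UNIV"
        using lead_ideal_coeff_ideal[OF J mono \<alpha>(1)] by simp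
    qed
    moreover have "(\<Sum>\<alpha>\<in>?T. ?h \<alpha>) = g * gterm 0 (b - 1) n + count_deg D n"
    proof -
      have "card ?T = gterm 0 (b - 1) n"
        using count_deg_monoms[of "{..<b}" n] b by (auto simp: count_deg_def lessThan_empty_iff)
      moreover have "?T \<inter> {\<alpha>. \<alpha> \<in> D} = {\<alpha> \<in> D. monom_degree \<alpha> = n}"
        using DV by blast
      ultimately show ?thesis
        using fin by (simp add: sum.distrib sum.If_cases count_deg_def)
    qed
    ultimately show ?case using elim by (intro exI[of _ "g * gterm 0 (b - 1) n + count_deg D n"]) simp
  qed
  then show ?thesis
    unfolding admissible_def
    by (intro exI[of _ ?I] conjI homogeneous_coeff_ideal[OF J mono] irr)
qed

theorem theorem4p11:
  fixes \<mm> :: "'a::comm_ring_1 set" and P :: "rat poly" and b :: nat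
  assumes "artinian_ring (ring_of_type_algebra :: 'a ring)"
    and "local_ring (ring_of_type_algebra :: 'a ring) \<mm>"
    and "equicharacteristic (ring_of_type_algebra :: 'a ring) \<mm>"
    and "P \<in> nat_valued_polys" and "P \<noteq> 0" and "1 \<le> b"
  shows "(admissible TYPE('a) b P \<longrightarrow> Polynomial.degree P + 1 \<le> b \<and> gotzmann_development P) \<and>
         (Polynomial.degree P + 2 \<le> b \<and> gotzmann_development P \<longrightarrow> admissible TYPE('a) b P) \<and>
         (admissible TYPE('a) (Polynomial.degree P + 1) P \<longleftrightarrow>
            0 < gamma_of P \<and>
              enat (gamma_of P) < module_length (ring_of_type_algebra :: 'a ring)
                                    (self_module (ring_of_type_algebra :: 'a ring)) \<and>
              gotzmann_development (Gamma_of P)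
          \<or> enat (gamma_of P) = module_length (ring_of_type_algebra :: 'a ring)
                                  (self_module (ring_of_type_algebra :: 'a ring)) \<and>
              Gamma_of P = 0)"
proof -
  note loc = local_ring_maximal[OF assms(2)]
  have "\<exists>n. has_length (*) n {0::'a} UNIV"
    by (rule finite_length_local[OF artinian_dcc[OF assms(1)] loc])
  then obtain L where len: "has_length (*) L {0::'a} UNIV" by blast
  have ml: "module_length (ring_of_type_algebra :: 'a ring) (self_module ring_of_type_algebra) = enat L"
    unfolding module_length_self by (rule Sup_chain_eq[OF len])
  have "1 \<noteq> (0 :: 'a)" using loc(2) rideal_0[OF loc(1)] by metis
  \<comment> \<open>Part (ii) will need an ideal of colength 1.\<close>
  have L: "1 \<le> L"
  proof -
    have "has_chain (*) 1 {0::'a} UNIV"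
    proof (rule has_chainI[of 1 _ "\<lambda>i. if i = 0 then {0} else UNIV"])
      have "{0 :: 'a} \<noteq> UNIV" using \<open>1 \<noteq> (0 :: 'a)\<close> by blast
      then show "(if i = 0 then {0 :: 'a} else UNIV) \<subset> (if Suc i = 0 then {0} else UNIV)" if "i < 1" for i
        using that by auto
    qed (simp_all add: rideal_UNIV rideal_single_0)
    then show ?thesis using len unfolding has_length_def by blast
  qed
  obtain J :: "nat \<Rightarrow> 'a set" where J: "\<And>g. g \<le> L \<Longrightarrow> rideal (J g)"
    "\<And>g. g \<le> L \<Longrightarrow> has_length (*) g (J g) UNIV" "\<And>g. g < L \<Longrightarrow> J (Suc g) \<subseteq> J g"
    using exists_rideal_colength[OF len] by blast
  let ?d = "Polynomial.degree P"

  have part1: "?d + 1 \<le> b \<and> gotzmann_development P" if adm: "admissible TYPE('a) b P"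
  proof -
    obtain D where D: "\<And>j. downset {..<b} (D j)"
      "\<forall>\<^sub>F n in sequentially. poly P (of_nat n) = of_nat (\<Sum>j=1..L. count_deg (D j) n)"
      using admissible_downsets[OF len adm] by blast
    have "gotz b 0 (\<lambda>n. \<Sum>j=1..L. count_deg (D j) n)"
      using gotz_downset_card[OF _ D(1)] by (intro gotz_sum) simp_all
    then obtain cs where cs: "sorted_wrt (\<ge>) cs" "\<And>c. c \<in> set cs \<Longrightarrow> c < b"
      "\<forall>\<^sub>F n in sequentially. (\<Sum>j=1..L. count_deg (D j) n) = gsum 0 cs n"
      unfolding gotz_def by blast
    have ev: "\<forall>\<^sub>F n in sequentially. poly P (of_nat n) = of_nat (gsum 0 cs n)"
      using D(2) cs(3) by eventually_elim (simp only:)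
    have "P = gsum_poly 0 cs"
      by (rule poly_eq_of_eventually_eq)
        (use ev eventually_poly_gsum_poly[of 0 cs] in eventually_elim, simp)
    moreover have "Polynomial.degree (gsum_poly 0 cs) \<le> b - 1"
      using cs(2) by (intro degree_gsum_poly) fastforce
    ultimately have "?d + 1 \<le> b" using assms(6) by simp
    moreover have "gotzmann_development P" using ev cs(1) gotzmann_development_iff by blast
    ultimately show ?thesis by blast
  qed

  have part2: "admissible TYPE('a) b P" if db: "?d + 2 \<le> b" and gd: "gotzmann_development P"
  proof -
    obtain cs where cs: "sorted_wrt (\<ge>) cs"
      "\<forall>\<^sub>F n in sequentially. poly P (of_nat n) = of_nat (gsum 0 cs n)"
      using gd gotzmann_development_iff by blast
    have cd: "c \<le> ?d" if c: "c \<in> set cs" for c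
    proof -
      \<comment> \<open>The leading summand alone is at most \<open>P\<close>, which bounds every
        entry by the degree of \<open>P\<close>.\<close>
      obtain c1 cs' where c1: "cs = c1 # cs'" "c \<le> c1" using cs(1) c by (cases cs) auto
      have "\<forall>\<^sub>F n in sequentially. poly (gterm_poly 0 c1) (of_nat n) \<le> poly P (of_nat n)"
        using cs(2) by eventually_elim (simp add: poly_gterm_poly c1(1))
      moreover have "0 < Polynomial.lead_coeff (gterm_poly 0 c1)"
        using conjunct2[OF gterm_poly_lead[of 0 c1]] by (simp only:) simp
      ultimately have "c1 \<le> ?d"
        using degree_le_of_eventually_le[of "gterm_poly 0 c1" P] gterm_poly_lead[of 0 c1] by simp
      then show ?thesis using c1(2) by simp
    qed
    have csb: "c + 2 \<le> b" if "c \<in> set cs" for c using cd[OF that] db by simp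
    have "\<forall>\<^sub>F n in sequentially. poly P (of_nat n) =
        of_nat (0 * gterm 0 (b - 1) n + count_deg (lex_downset b cs) n)"
      using cs(2) eventually_ge_at_top[of "length cs"]
      by eventually_elim (simp add: count_deg_lex_downset[OF cs(1) csb])
    \<comment> \<open>Take \<open>g = 0\<close>: every coefficient is allowed off the order ideal,
      and an ideal of colength 1 on it.\<close>
    then show ?thesis
      using L J(1,2)[of 0] J(1,2)[of "Suc 0"] J(3)[of 0]
      by (intro admissibleI[OF assms(6) downset_lex_downset[OF cs(1) csb]]) auto
  qed

  have part3: "0 < gamma_of P \<and> gamma_of P < L \<and> gotzmann_development (Gamma_of P) \<or>
      gamma_of P = L \<and> Gamma_of P = 0" if adm: "admissible TYPE('a) (?d + 1) P"
  proof -
    obtain D where D: "\<And>j. downset {..<?d + 1} (D j)"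
      "\<forall>\<^sub>F n in sequentially. poly P (of_nat n) = of_nat (\<Sum>j=1..L. count_deg (D j) n)"
      using admissible_downsets[OF len adm] by blast
    let ?V = "{..<?d + 1}"
    define F where "F = {j \<in> {1..L}. D j = monoms ?V}"
    define r where "r n = (\<Sum>j\<in>{1..L} - F. count_deg (D j) n)" for n
    \<comment> \<open>There is one variable more than the degree of \<open>P\<close>, so a slice
      that is not full has entries below \<open>?d\<close>.\<close>
    have "gotz ?d 0 r"
      unfolding r_def
    proof (rule gotz_sum)
      fix j assume "j \<in> {1..L} - F"
      then have "D j \<noteq> monoms ?V" by (auto simp: F_def)
      from gotz_downset_proper[OF _ _ D(1) this] show "gotz ?d 0 (count_deg (D j))" by auto
    qed simp
    then obtain cs where cs: "sorted_wrt (\<ge>) cs" "\<forall>\<^sub>F n in sequentially. r n = gsum 0 cs n"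
      and csd: "\<And>c. c \<in> set cs \<Longrightarrow> c < ?d"
      and lt: "\<forall>\<^sub>F n in sequentially. r n < gterm 0 ?d n"
      using gotz_lt_gterm unfolding gotz_def by blast
    let ?Q = "gsum_poly 0 cs"
    have full: "count_deg (monoms ?V) n = gterm 0 ?d n" for n
      by (subst count_deg_monoms) auto
    have sumeq: "(\<Sum>j=1..L. count_deg (D j) n) = card F * gterm 0 ?d n + r n" for n
    proof -
      have "(\<Sum>j=1..L. count_deg (D j) n) = r n + (\<Sum>j\<in>F. count_deg (D j) n)"
        unfolding r_def by (rule sum.subset_diff) (auto simp: F_def)
      also have "(\<Sum>j\<in>F. count_deg (D j) n) = (\<Sum>j\<in>F. gterm 0 ?d n)"
        by (rule sum.cong) (use full in \<open>auto simp: F_def\<close>)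
      finally show ?thesis by simp
    qed
    have *: "\<forall>\<^sub>F n in sequentially. poly P (of_nat n) = of_nat (card F * gterm 0 ?d n + r n) \<and>
        r n < gterm 0 ?d n \<and> poly ?Q (of_nat n) = of_nat (r n)"
      using D(2) lt cs(2) eventually_poly_gsum_poly[of 0 cs]
    proof eventually_elim
      case (elim n)
      then show ?case using sumeq[of n] by (simp only: simp_thms)
    qed
    note gG = gamma_Gamma_eqI[OF *]
    have gd: "gotzmann_development ?Q"
      using cs(1) eventually_poly_gsum_poly gotzmann_development_iff by blast
    have F: "F \<subseteq> {1..L}" by (auto simp: F_def)
    have pos: "0 < card F"
    proof (rule ccontr)
      assume "\<not> 0 < card F"
      then have F0: "card F = 0" by simp
      from * have "\<forall>\<^sub>F n in sequentially. poly P (of_nat n) = poly ?Q (of_nat n)"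
        by eventually_elim (simp only: F0 mult_0 add_0)
      then have PQ: "P = ?Q" by (rule poly_eq_of_eventually_eq)
      \<comment> \<open>Without full slices \<open>P\<close> has only entries below
        \<open>?d\<close>. Truncated subtraction then forces \<open>?d = 0\<close>, hence an empty
        list and \<open>P = 0\<close>.\<close>
      have "?d \<le> ?d - 1"
        using degree_gsum_poly[of cs "?d - 1" 0] csd unfolding PQ[symmetric] by fastforce
      then have "cs = []" using csd by (cases cs) fastforce+
      then show False using PQ assms(5) by simp
    qed
    have "card F \<le> L" using card_mono[OF _ F] by simp
    moreover have "?Q = 0" if "card F = L"
    proof -
      have "F = {1..L}" using F that by (intro card_subset_eq) auto
      then have r0: "r n = 0" for n by (simp add: r_def)
      from * have "\<forall>\<^sub>F n in sequentially. poly ?Q (of_nat n) = poly 0 (of_nat n)"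
        by eventually_elim (simp only: r0 of_nat_0 poly_0)
      then show ?thesis by (rule poly_eq_of_eventually_eq)
    qed
    ultimately show ?thesis using pos gd unfolding gG by (cases "card F = L") auto
  qed

  have part4: "admissible TYPE('a) (?d + 1) P"
    if "0 < gamma_of P \<and> gamma_of P < L \<and> gotzmann_development (Gamma_of P) \<or>
      gamma_of P = L \<and> Gamma_of P = 0"
  proof -
    obtain r where r: "\<forall>\<^sub>F n in sequentially.
      poly P (of_nat n) = of_nat (gamma_of P * gterm 0 ?d n + r n) \<and>
      r n < gterm 0 ?d n \<and> poly (Gamma_of P) (of_nat n) = of_nat (r n)"
      using gamma_Gamma_exist[OF assms(4,5)] by blast
    let ?g = "gamma_of P"
    show ?thesis
      using that
    proof (elim disjE conjE)
      assume g: "?g < L" and gd: "gotzmann_development (Gamma_of P)"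
      obtain ds where ds: "sorted_wrt (\<ge>) ds"
        "\<forall>\<^sub>F n in sequentially. poly (Gamma_of P) (of_nat n) = of_nat (gsum 0 ds n)"
        using gd gotzmann_development_iff by blast
      have "\<forall>\<^sub>F n in sequentially. r n = gsum 0 ds n" using r ds(2) by eventually_elim simp
      \<comment> \<open>Any bound on the entries will do here; the bound on the remainder cuts it
        down to \<open>?d\<close> next.\<close>
      then have "gotz (Suc (Max (set ds))) 0 r" using ds(1) by (intro gotzI) (auto simp: less_Suc_eq_le)
      moreover have "\<forall>\<^sub>F n in sequentially. r n < gterm 0 ?d n" using r by eventually_elim simp
      ultimately have "gotz ?d 0 r" by (rule gotz_lower)
      then obtain cs where cs: "sorted_wrt (\<ge>) cs" "\<And>c. c \<in> set cs \<Longrightarrow> c < ?d"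
        "\<forall>\<^sub>F n in sequentially. r n = gsum 0 cs n"
        unfolding gotz_def by blast
      \<comment> \<open>\<open>c < ?d\<close> leaves, among \<open>?d + 1\<close> variables, the
        extra one that the lexicographic construction spends.\<close>
      have csb: "c + 2 \<le> ?d + 1" if "c \<in> set cs" for c using cs(2)[OF that] by simp
      have "\<forall>\<^sub>F n in sequentially. poly P (of_nat n) =
          of_nat (?g * gterm 0 (?d + 1 - 1) n + count_deg (lex_downset (?d + 1) cs) n)"
        using r cs(3) eventually_ge_at_top[of "length cs"]
        by eventually_elim (use count_deg_lex_downset[OF cs(1) csb] in simp)
      then show ?thesis
        using g J(1)[of ?g] J(1)[of "Suc ?g"] J(2)[of ?g] J(2)[of "Suc ?g"] J(3)[of ?g]
        by (intro admissibleI[OF _ downset_lex_downset[OF cs(1) csb]]) auto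
    next
      assume g: "?g = L" and G: "Gamma_of P = 0"
      have "\<forall>\<^sub>F n in sequentially. poly P (of_nat n) =
          of_nat (?g * gterm 0 (?d + 1 - 1) n + count_deg {} n)"
        using r by eventually_elim (use G in \<open>simp add: count_deg_def\<close>)
      \<comment> \<open>With the empty order ideal no ideal of colength \<open>Suc L\<close> is
        asked for.\<close>
      then show ?thesis
        using g J(1,2)[of ?g] by (intro admissibleI[of _ "{}" "J ?g" ?g "J ?g"]) (auto simp: downset_def)
    qed
  qed
  show ?thesis unfolding ml enat_ord_simps enat.inject using part1 part2 part3 part4 by blast
qed

end
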